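(* Let $n\ge 2$ and let $\psi(r)=1$ for $0\le r\le 1$ and $\psi(r)=0$ for $r>1$. For an integer $1\le k<n$ consider the Abel type integral equation $$c_{n,k}\, r^{2-n}\int_0^r s^{n-k-1}\,w(s)\,(r^2-s^2)^{k/2-1}\,ds=\psi(r),\qquad r>0,\qquad c_{n,k}=\frac{\sigma_{k-1}\,\sigma_{n-k-1}}{\sigma_{n-1}}. \qquad ( * )$$ (i) Let $k=1$. Then the function $$w(r)=\begin{cases}1 & \text{if } 0\le r\le 1,\\[4pt] \displaystyle -\frac{\Gamma\left(\frac{n-1}{2}\right) r^{3-n}}{2\sqrt{\pi}\,\Gamma\left(\frac n2\right)}\int_0^1 v^{n/2-1}(r^2-v)^{-3/2}\,dv & \text{if } r>1,\end{cases}$$ is a solution of $( * )$. Moreover, with $W_a^*$ the wavelet-like transform generated by this $w$ (with $k=1$), for every $f\in L^p(\mathbb{R}^n)$ with $1\le p<n$ one has $$\lim_{a\to 0}(W_a^*\hat f)(x)=\lambda f(x),\qquad \lambda=\int_{\mathbb{R}^n}\psi(|x|)\,dx,$$ where the limit is understood both in the $L^p$-norm and in the almost everywhere sense; and if $f\in C_0(\mathbb{R}^n)\cap L^p(\mathbb{R}^n)$ for some $1\le p<n$, the limit holds uniformly on $\mathbb{R}^n$. (ii) If $1<k<n$, then equation $( * )$ with this $\psi$ has no solution $w$.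
   Context: Notation. $\sigma_{m-1}=2\pi^{m/2}/\Gamma(m/2)$ is the area of the unit sphere $S^{m-1}$ in $\mathbb{R}^m$ (so $\sigma_0=2$). $C_0(\mathbb{R}^n)$ is the space of continuous functions on $\mathbb{R}^n$ vanishing at infinity. A solution of $( * )$ means a measurable function $w$ on $(0,\infty)$ such that $s^{n-k-1}w(s)$ is integrable on $(0,R)$ for every $R>0$ and the equation holds for every $r>0$ (with the integral absolutely convergent). For $1\le k<n$, let $G_{n,k}$ be the Grassmann manifold of $k$-dimensional linear subspaces $\zeta$ of $\mathbb{R}^n$, and $\mathcal{G}_{n,k}$ the affine Grassmann manifold of all non-oriented $k$-planes $\tau$ in $\mathbb{R}^n$. Each $\tau\in\mathcal{G}_{n,k}$ is parameterized by a pair $(\zeta,x'')$ with $\zeta\in G_{n,k}$, $x''\in\zeta^\perp$ (so $\tau=\zeta+x''$). $\mathcal{G}_{n,k}$ is endowed with the measure $d\tau=d\zeta\,dx''$, where $d\zeta$ is the $SO(n)$-invariant probability measure on $G_{n,k}$ and $dx''$ is Lebesgue measure on $\zeta^\perp$. The $k$-plane transform of a function $f$ on $\mathbb{R}^n$ is $$\hat f(\tau)=\int_\zeta f(x'+x'')\,dx',\qquad \tau=(\zeta,x'')\in\mathcal{G}_{n,k};$$ for $f\in L^p(\mathbb{R}^n)$, $1\le p<n/k$, it is finite for almost every $\tau$. The wavelet-like transform generated by a function $w$ on $(0,\infty)$ is $$(W_a^*\varphi)(x)=\frac{1}{a^n}\int_{\mathcal{G}_{n,k}}\varphi(\tau)\,w\!\left(\frac{|x-\tau|}{a}\right)d\tau,\qquad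 a>0,\ x\in\mathbb{R}^n,$$ where $|x-\tau|$ is the Euclidean distance from the point $x$ to the $k$-plane $\tau$. *)

theory Defs
  imports "HOL-Analysis.Analysis" "HOL-Probability.Probability"
begin

text \<open>Area of the unit sphere \<open>S\<^sup>d\<close> in Euclidean \<open>(d+1)\<close>-space.\<close>

definition sphere_area :: "nat \<Rightarrow> real" where
  "sphere_area d = 2 * pi powr ((real d + 1) / 2) / Gamma ((real d + 1) / 2)"

definition abel_const :: "nat \<Rightarrow> nat \<Rightarrow> real" where
  "abel_const n k = sphere_area (k - 1) * sphere_area (n - k - 1) / sphere_area (n - 1)"

definition abel_kernel :: "nat \<Rightarrow> nat \<Rightarrow> real \<Rightarrow> real \<Rightarrow> real" where
  "abel_kernel n k r s = s ^ (n - k - 1) * (r\<^sup>2 - s\<^sup>2) powr (real k / 2 - 1)"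

text \<open>The values of \<open>w\<close> outside the open half-line are irrelevant. Solutions are allowed to be
  complex valued.\<close>

definition abel_solution :: "nat \<Rightarrow> nat \<Rightarrow> (real \<Rightarrow> real) \<Rightarrow> (real \<Rightarrow> complex) \<Rightarrow> bool" where
  "abel_solution n k \<psi> w \<longleftrightarrow>
     w \<in> borel_measurable (lebesgue_on {0<..}) \<and>
     (\<forall>R>0. set_integrable lebesgue {0<..<R} (\<lambda>s. of_real (s ^ (n - k - 1)) * w s)) \<and>
     (\<forall>r>0. set_integrable lebesgue {0<..<r} (\<lambda>s. of_real (abel_kernel n k r s) * w s) \<and>
        of_real (abel_const n k * r powr (2 - real n)) *
          (LINT s:{0<..<r}|lebesgue. of_real (abel_kernel n k r s) * w s) = of_real (\<psi> r))"

definition psi :: "real \<Rightarrow> real" where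
  "psi = indicator {0..1}"

definition abel_w :: "nat \<Rightarrow> real \<Rightarrow> real" where
  "abel_w n r =
     (if r \<le> 1 then 1
      else - (Gamma ((real n - 1) / 2) * r powr (3 - real n) / (2 * sqrt pi * Gamma (real n / 2))) *
             (LINT v:{0..1}|lebesgue. v powr (real n / 2 - 1) * (r\<^sup>2 - v) powr (- (3 / 2))))"

definition grassmannian :: "nat \<Rightarrow> (real ^ 'n) set set" where
  "grassmannian k = {\<zeta>. subspace \<zeta> \<and> dim \<zeta> = k}"

text \<open>The manifold topology of the Grassmannian is the one induced by the embedding that sends a
  subspace to the matrix of the orthogonal projection onto it (\<open>closest_point \<zeta>\<close> is this
  projection). The following is the corresponding Borel sigma-algebra.\<close>

definition grassmann_algebra :: "nat \<Rightarrow> (real ^ 'n) set measure" where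
  "grassmann_algebra k =
     vimage_algebra (grassmannian k) (\<lambda>\<zeta>. matrix (closest_point \<zeta>) :: real ^ 'n ^ 'n) borel"

definition invariant_grassmann_prob :: "nat \<Rightarrow> (real ^ 'n) set measure \<Rightarrow> bool" where
  "invariant_grassmann_prob k \<mu> \<longleftrightarrow>
     prob_space \<mu> \<and> sets \<mu> = sets (grassmann_algebra k) \<and>
     (\<forall>Q. rotation_matrix Q \<longrightarrow> distr \<mu> \<mu> (\<lambda>\<zeta>. (\<lambda>x. Q *v x) ` \<zeta>) = \<mu>)"

text \<open>For \<open>1 \<le> k < n\<close> the rotation group acts transitively on the Grassmannian, so there is
  exactly one invariant probability measure. Existence for \<open>k = 1\<close> is shown at the end of this
  theory.\<close>

definition grassmann_measure :: "nat \<Rightarrow> (real ^ 'n) set measure" where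
  "grassmann_measure k = (SOME \<mu>. invariant_grassmann_prob k \<mu>)"

text \<open>Lebesgue measure on a subspace \<open>V\<close>, regarded as a measure on the whole space that lives on
  \<open>V\<close>: the image of the product Lebesgue measure under orthonormal coordinates. It does not
  depend on the chosen orthonormal basis.\<close>

definition orthonormal_basis_of :: "(real ^ 'n) set \<Rightarrow> (real ^ 'n) set \<Rightarrow> bool" where
  "orthonormal_basis_of V B \<longleftrightarrow>
     pairwise orthogonal B \<and> (\<forall>b\<in>B. norm b = 1) \<and> independent B \<and> span B = V"

definition lebesgue_subspace :: "(real ^ 'n) set \<Rightarrow> (real ^ 'n) measure" where
  "lebesgue_subspace V =
     (let B = (SOME B. orthonormal_basis_of V B)
      in completion (distr (\<Pi>\<^sub>M b\<in>B. lborel) borel (\<lambda>c. \<Sum>b\<in>B. c b *\<^sub>R b)))"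

text \<open>A \<open>k\<close>-plane is represented by its unique pair of parameters \<open>(\<zeta>, x'')\<close>.\<close>

definition affine_grassmannian :: "nat \<Rightarrow> ((real ^ 'n) set \<times> (real ^ 'n)) set" where
  "affine_grassmannian k = (SIGMA \<zeta>:grassmannian k. \<zeta>\<^sup>\<bottom>)"

definition kplane :: "(real ^ 'n) set \<times> (real ^ 'n) \<Rightarrow> (real ^ 'n) set" where
  "kplane \<tau> = (\<lambda>x'. x' + snd \<tau>) ` fst \<tau>"

definition affine_grassmann_measure :: "nat \<Rightarrow> ((real ^ 'n) set \<times> (real ^ 'n)) measure" where
  "affine_grassmann_measure k =
     completion (measure_of (affine_grassmannian k)
       (sets (restrict_space (grassmann_algebra k \<Otimes>\<^sub>M borel) (affine_grassmannian k)))
       (\<lambda>A. \<integral>\<^sup>+\<zeta>. emeasure (lebesgue_subspace (\<zeta>\<^sup>\<bottom>)) (Pair \<zeta> -` A) \<partial>grassmann_measure k))"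

definition kplane_transform ::
  "(real ^ 'n \<Rightarrow> complex) \<Rightarrow> (real ^ 'n) set \<times> (real ^ 'n) \<Rightarrow> complex" where
  "kplane_transform f \<tau> = (\<integral>x'. f (x' + snd \<tau>) \<partial>lebesgue_subspace (fst \<tau>))"

definition wavelet_integrand ::
  "(real \<Rightarrow> complex) \<Rightarrow> real \<Rightarrow> ((real ^ 'n) set \<times> (real ^ 'n) \<Rightarrow> complex) \<Rightarrow> real ^ 'n
     \<Rightarrow> (real ^ 'n) set \<times> (real ^ 'n) \<Rightarrow> complex" where
  "wavelet_integrand w a \<phi> x \<tau> = \<phi> \<tau> * w (infdist x (kplane \<tau>) / a)"

definition wavelet_transform ::
  "nat \<Rightarrow> (real \<Rightarrow> complex) \<Rightarrow> real \<Rightarrow> ((real ^ 'n) set \<times> (real ^ 'n) \<Rightarrow> complex) \<Rightarrow> real ^ 'n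
     \<Rightarrow> complex" where
  "wavelet_transform k w a \<phi> x =
     of_real (1 / a ^ CARD('n)) * (\<integral>\<tau>. wavelet_integrand w a \<phi> x \<tau> \<partial>affine_grassmann_measure k)"

definition in_Lp :: "real \<Rightarrow> (real ^ 'n \<Rightarrow> complex) \<Rightarrow> bool" where
  "in_Lp p f \<longleftrightarrow>
     f \<in> borel_measurable lebesgue \<and> integrable lebesgue (\<lambda>x. norm (f x) powr p)"

definition Lp_norm :: "real \<Rightarrow> (real ^ 'n \<Rightarrow> complex) \<Rightarrow> real" where
  "Lp_norm p f = (\<integral>x. norm (f x) powr p \<partial>lebesgue) powr (1 / p)"

definition in_C0 :: "(real ^ 'n \<Rightarrow> complex) \<Rightarrow> bool" where
  "in_C0 f \<longleftrightarrow> continuous_on UNIV f \<and> (f \<longlongrightarrow> 0) at_infinity"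

lemma closest_point_span:
  fixes x :: "real ^ 'n"
  assumes "x \<noteq> 0"
  shows "closest_point (span {x}) = (\<lambda>y. ((x \<bullet> y) / (norm x)\<^sup>2) *\<^sub>R x)"
proof (rule ext, rule sym, rule closest_point_unique)
  fix y
  let ?z = "((x \<bullet> y) / (norm x)\<^sup>2) *\<^sub>R x"
  show "convex (span {x})" by (simp add: subspace_imp_convex)
  show "closed (span {x})" by (simp add: closed_subspace)
  show "?z \<in> span {x}" by (simp add: span_base span_scale)
  show "\<forall>z\<in>span {x}. dist y ?z \<le> dist y z"
  proof
    fix z assume "z \<in> span {x}"
    then obtain c where c: "z = c *\<^sub>R x" by (auto simp: span_singleton)
    define u where "u = ?z - z"
    define v where "v = y - ?z"
    have "v \<bullet> x = 0"
      using assms by (simp add: v_def inner_diff_left inner_commute[of y x] dot_square_norm)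
    then have o: "v \<bullet> u = 0" by (simp add: u_def c inner_diff_right)
    have "y - z = v + u" by (simp add: u_def v_def)
    then have "(norm (y - z))\<^sup>2 = (norm v)\<^sup>2 + (norm u)\<^sup>2"
      using o by (simp add: norm_add_Pythagorean orthogonal_def)
    then have "(norm v)\<^sup>2 \<le> (norm (y - z))\<^sup>2" by simp
    then have "norm v \<le> norm (y - z)"
      by (rule power2_le_imp_le) simp
    then show "dist y ?z \<le> dist y z" by (simp add: dist_norm v_def)
  qed
qed

lemma matrix_closest_point_span:
  fixes x :: "real ^ 'n"
  assumes "x \<noteq> 0"
  shows "matrix (closest_point (span {x})) = (\<chi> i j. x $ i * x $ j / (norm x)\<^sup>2)"
  by (simp add: matrix_def closest_point_span[OF assms] vec_eq_iff inner_axis field_simps)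

lemma matrix_closest_point_rotation:
  fixes x :: "real ^ 'n"
  assumes Q: "orthogonal_matrix Q" and x: "x \<noteq> 0"
  shows "matrix (closest_point (span {Q *v x})) =
    Q ** matrix (closest_point (span {x})) ** transpose Q"
proof -
  have nQ: "norm (Q *v x) = norm x"
    using Q by (metis orthogonal_transformation_def orthogonal_transformation_matrix
        orthogonal_transformation_norm matrix_of_matrix_vector_mul matrix_vector_mul_linear)
  then have "Q *v x \<noteq> 0" using x by (metis norm_eq_zero)
  then have "closest_point (span {Q *v x}) =
      (\<lambda>y. Q *v y) \<circ> (closest_point (span {x}) \<circ> (\<lambda>y. transpose Q *v y))"
    by (simp add: closest_point_span x nQ fun_eq_iff matrix_vector_mult_scaleR
        dot_lmul_matrix[symmetric] vector_transpose_matrix inner_commute)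
  moreover have "linear (closest_point (span {x}))"
    unfolding closest_point_span[OF x]
    by (rule linearI) (simp_all add: inner_add_right add_divide_distrib scaleR_add_left)
  ultimately show ?thesis
    by (simp add: matrix_compose linear_compose matrix_mul_assoc matrix_vector_mul_linear
        del: transpose_matrix_vector)
qed

lemma rotation_image_span:
  "(\<lambda>y. Q *v y) ` span {x} = span {Q *v x}" for Q :: "real ^ 'n ^ 'n"
  by (auto simp: span_singleton matrix_vector_mult_scaleR image_iff)

lemma distr_lborel_rotation:
  fixes Q :: "real ^ 'n ^ 'n"
  assumes "orthogonal_matrix Q"
  shows "distr lborel borel (\<lambda>x. Q *v x) = lborel"
proof -
  let ?L = "lborel :: (real ^ 'n) measure"
  define M where "M = distr ?L borel (\<lambda>x. Q *v x)"
  have QQ: "Q ** transpose Q = mat 1"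
    using assms by (auto simp: orthogonal_matrix_def)
  have nQ: "norm (Q *v x) = norm x" for x
    using assms by (metis orthogonal_transformation_matrix orthogonal_transformation_norm
        matrix_of_matrix_vector_mul matrix_vector_mul_linear)
  have [measurable]: "(\<lambda>x. Q *v x) \<in> borel_measurable borel"
    by (intro borel_measurable_continuous_onI matrix_vector_mult_linear_continuous_on)
  have sets_M[measurable_cong]: "sets M = sets borel" and space_M: "space M = UNIV"
    by (simp_all add: M_def)
  have ball_M: "emeasure M (ball 0 r) = emeasure ?L (ball 0 r)" for r
  proof -
    have "(\<lambda>x. Q *v x) -` ball 0 r = ball 0 r" by (auto simp: nQ)
    then show ?thesis by (simp add: M_def emeasure_distr)
  qed
  interpret M: sigma_finite_measure M
  proof
    show "\<exists>A. countable A \<and> A \<subseteq> sets M \<and> \<Union> A = space M \<and> (\<forall>a\<in>A. emeasure M a \<noteq> \<infinity>)"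
    proof (intro exI conjI)
      show "countable (range (\<lambda>i::nat. ball (0 :: real ^ 'n) (real i)))" by simp
      show "range (\<lambda>i::nat. ball (0 :: real ^ 'n) (real i)) \<subseteq> sets M" by (auto simp: sets_M)
      show "\<Union> (range (\<lambda>i::nat. ball (0 :: real ^ 'n) (real i))) = space M"
        using reals_Archimedean2 by (auto simp: space_M)
      show "\<forall>a\<in>range (\<lambda>i::nat. ball (0 :: real ^ 'n) (real i)). emeasure M a \<noteq> \<infinity>"
        using emeasure_lborel_ball_finite[of "0 :: real ^ 'n"] by (auto simp: ball_M less_top)
    qed
  qed
  interpret P: pair_sigma_finite M ?L ..
  have shift_M: "(\<integral>\<^sup>+x. g (a + x) \<partial>M) = (\<integral>\<^sup>+x. g x \<partial>M)"
    if [measurable]: "g \<in> borel_measurable borel" for g a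
  proof -
    have "(\<integral>\<^sup>+x. g (a + x) \<partial>M) = (\<integral>\<^sup>+x. g (a + Q *v x) \<partial>?L)"
      by (simp add: M_def nn_integral_distr)
    also have "\<dots> = (\<integral>\<^sup>+x. g (Q *v (transpose Q *v a + x)) \<partial>?L)"
      by (simp only: matrix_vector_right_distrib matrix_vector_mul_assoc QQ matrix_vector_mul_lid)
    also have "\<dots> = (\<integral>\<^sup>+x. g (Q *v x) \<partial>distr ?L borel ((+) (transpose Q *v a)))"
      by (subst nn_integral_distr) auto
    also have "\<dots> = (\<integral>\<^sup>+x. g x \<partial>M)"
      by (simp only: lborel_distr_plus) (simp add: M_def nn_integral_distr)
    finally show ?thesis .
  qed
  have shift_L: "(\<integral>\<^sup>+x. g (a + x) \<partial>?L) = (\<integral>\<^sup>+x. g x \<partial>?L)"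
    if [measurable]: "g \<in> borel_measurable borel" for g a
    by (subst lborel_distr_plus[of a, symmetric], subst nn_integral_distr) auto
  have neg_L: "(\<integral>\<^sup>+x. g (a - x) \<partial>?L) = (\<integral>\<^sup>+x. g x \<partial>?L)"
    if [measurable]: "g \<in> borel_measurable borel" for g a
    by (subst lborel_affine[of "-1" a], simp, subst nn_integral_density)
      (auto simp: nn_integral_distr)
  have swap: "emeasure M A * emeasure ?L B = emeasure M B * emeasure ?L A"
    if [measurable]: "A \<in> sets borel" "B \<in> sets borel" for A B
  proof -
    have "emeasure M A * emeasure ?L B = (\<integral>\<^sup>+x. indicator A x * (\<integral>\<^sup>+y. indicator B y \<partial>?L) \<partial>M)"
      by (simp add: nn_integral_multc)
    also have "\<dots> = (\<integral>\<^sup>+x. indicator A x * (\<integral>\<^sup>+y. indicator B (x + y) \<partial>?L) \<partial>M)"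
      by (subst shift_L) simp_all
    also have "\<dots> = (\<integral>\<^sup>+x. (\<integral>\<^sup>+y. indicator A x * indicator B (x + y) \<partial>?L) \<partial>M)"
      by (simp add: nn_integral_cmult)
    also have "\<dots> = (\<integral>\<^sup>+y. (\<integral>\<^sup>+x. indicator A x * indicator B (x + y) \<partial>M) \<partial>?L)"
      by (rule P.Fubini'[symmetric]) simp
    also have "\<dots> = (\<integral>\<^sup>+y. (\<integral>\<^sup>+x. indicator A (- y + x) * indicator B x \<partial>M) \<partial>?L)"
    proof (rule nn_integral_cong)
      fix y
      show "(\<integral>\<^sup>+x. indicator A x * indicator B (x + y) \<partial>M) =
          (\<integral>\<^sup>+x. indicator A (- y + x) * indicator B x \<partial>M)"
        using shift_M[of "\<lambda>x. indicator A x * indicator B (x + y)" "- y"] by simp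
    qed
    also have "\<dots> = (\<integral>\<^sup>+x. (\<integral>\<^sup>+y. indicator A (- y + x) * indicator B x \<partial>?L) \<partial>M)"
      by (rule P.Fubini') simp
    also have "\<dots> = (\<integral>\<^sup>+x. (\<integral>\<^sup>+y. indicator A (- y + x) \<partial>?L) * indicator B x \<partial>M)"
      by (simp add: nn_integral_multc)
    also have "\<dots> = (\<integral>\<^sup>+x. (\<integral>\<^sup>+y. indicator A y \<partial>?L) * indicator B x \<partial>M)"
      using neg_L[of "indicator A"] by simp
    also have "\<dots> = emeasure M B * emeasure ?L A"
      by (simp add: nn_integral_cmult) (simp add: mult.commute)
    finally show ?thesis .
  qed
  have ball: "emeasure ?L (ball 0 1) \<noteq> 0" "emeasure ?L (ball 0 1) \<noteq> \<infinity>"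
    using emeasure_lborel_ball_finite[of "0 :: real ^ 'n" 1]
      open_not_negligible[of "ball (0 :: real ^ 'n) 1"]
    by (auto simp: negligible_iff_emeasure0 top.not_eq_extremum)
  have "M = ?L"
  proof (rule measure_eqI)
    fix A assume "A \<in> sets M"
    then have "emeasure M A * emeasure ?L (ball 0 1) = emeasure ?L A * emeasure ?L (ball 0 1)"
      using swap[of A "ball 0 1"] by (simp add: sets_M ball_M mult.commute)
    then show "emeasure M A = emeasure ?L A"
      using ball by (simp add: mult.commute[of _ "emeasure ?L (ball 0 1)"] ennreal_mult_cancel_left)
  qed (simp add: sets_M)
  then show ?thesis by (simp add: M_def)
qed

lemma invariant_grassmann_prob_lines:
  "invariant_grassmann_prob 1 (grassmann_measure 1 :: (real ^ 'n) set measure)"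
proof -
  define e :: "real ^ 'n" where "e = axis undefined 1"
  have e: "e \<noteq> 0" by (simp add: e_def)
  define d where "d = (\<lambda>x :: real ^ 'n. span {if x = 0 then e else x})"
  define \<nu> where "\<nu> = uniform_measure lborel (ball (0 :: real ^ 'n) 1)"
  define G where "G = (grassmann_algebra 1 :: (real ^ 'n) set measure)"
  define \<mu> where "\<mu> = distr \<nu> G d"
  have ball: "emeasure lborel (ball (0 :: real ^ 'n) 1) \<noteq> 0"
    "emeasure lborel (ball (0 :: real ^ 'n) 1) \<noteq> \<infinity>"
    using emeasure_lborel_ball_finite[of "0 :: real ^ 'n" 1] open_not_negligible[of "ball (0 :: real ^ 'n) 1"]
    by (auto simp: negligible_iff_emeasure0 top.not_eq_extremum)
  interpret \<nu>: prob_space \<nu>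
    unfolding \<nu>_def using ball by (intro prob_space_uniform_measure)
  have sets_\<nu>[measurable_cong]: "sets \<nu> = sets borel" and space_\<nu>: "space \<nu> = UNIV"
    by (simp_all add: \<nu>_def)
  have spG: "space G = grassmannian 1"
    by (simp add: G_def grassmann_algebra_def)
  have dG: "d x \<in> grassmannian 1" for x
    using e by (simp add: d_def grassmannian_def dim_insert)
  have measd: "d \<in> \<nu> \<rightarrow>\<^sub>M G"
    unfolding G_def grassmann_algebra_def
  proof (rule measurable_vimage_algebra2)
    show "d \<in> space \<nu> \<rightarrow> grassmannian 1" using dG by auto
    have *: "(\<lambda>x. matrix (closest_point (d x))) =
        (\<lambda>x. if x = 0 then (\<chi> i j. e $ i * e $ j / (norm e)\<^sup>2)
             else (\<chi> i j. x $ i * x $ j / (norm x)\<^sup>2))"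
      using e by (auto simp: d_def matrix_closest_point_span fun_eq_iff)
    have "(\<lambda>x :: real ^ 'n. (\<chi> i j. x $ i * x $ j / (norm x)\<^sup>2) :: real ^ 'n ^ 'n)
        \<in> borel_measurable borel"
      by (subst borel_measurable_euclidean_space) (auto simp: Basis_vec_def inner_axis)
    then show "(\<lambda>x. matrix (closest_point (d x))) \<in> borel_measurable \<nu>"
      unfolding * by measurable
  qed
  have "prob_space \<mu>"
    unfolding \<mu>_def by (rule \<nu>.prob_space_distr[OF measd])
  moreover have "sets \<mu> = sets (grassmann_algebra 1)"
    by (simp add: \<mu>_def G_def)
  moreover have "distr \<mu> \<mu> (\<lambda>\<zeta>. (\<lambda>x. Q *v x) ` \<zeta>) = \<mu>" if "rotation_matrix Q" for Q
  proof -
    from that have Q: "orthogonal_matrix Q" by (simp add: rotation_matrix_def)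
    let ?Q = "\<lambda>x. Q *v x"
    have nQ: "norm (Q *v x) = norm x" for x
      using Q by (metis orthogonal_transformation_matrix orthogonal_transformation_norm
          matrix_of_matrix_vector_mul matrix_vector_mul_linear)
    have [measurable]: "?Q \<in> borel_measurable borel"
      by (intro borel_measurable_continuous_onI matrix_vector_mult_linear_continuous_on)
    have line: "\<exists>x. x \<noteq> 0 \<and> \<zeta> = span {x}" if "\<zeta> \<in> grassmannian 1" for \<zeta> :: "(real ^ 'n) set"
    proof -
      from that have \<zeta>: "subspace \<zeta>" "dim \<zeta> = 1" by (auto simp: grassmannian_def)
      then obtain B where B: "independent B" "card B = 1" "span B = \<zeta>"
        by (metis basis_subspace_exists)
      then obtain x where "B = {x}" by (metis card_1_singletonE)
      then show ?thesis using B by (auto simp: dependent_single)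
    qed
    have measQ: "(`) ?Q \<in> G \<rightarrow>\<^sub>M G"
    proof -
      have "(`) ?Q \<in> G \<rightarrow>\<^sub>M vimage_algebra (grassmannian 1)
          (\<lambda>\<zeta>. matrix (closest_point \<zeta>) :: real ^ 'n ^ 'n) borel"
      proof (rule measurable_vimage_algebra2)
        show "(`) ?Q \<in> space G \<rightarrow> grassmannian 1"
        proof
          fix \<zeta> assume "\<zeta> \<in> space G"
          then obtain x where "x \<noteq> 0" "\<zeta> = span {x}" using line spG by blast
          moreover from this have "Q *v x \<noteq> 0" by (metis nQ norm_eq_zero)
          ultimately show "?Q ` \<zeta> \<in> grassmannian 1"
            by (simp add: rotation_image_span grassmannian_def dim_insert)
        qed
        have "(\<lambda>\<zeta>. matrix (closest_point \<zeta>) :: real ^ 'n ^ 'n) \<in> borel_measurable G"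
          unfolding G_def grassmann_algebra_def by (rule measurable_vimage_algebra1) simp
        moreover have "(\<lambda>P. Q ** P ** transpose Q) \<in> borel_measurable borel"
          by (intro borel_measurable_continuous_onI)
            (auto simp: matrix_matrix_mult_def intro!: continuous_intros)
        ultimately have "(\<lambda>\<zeta>. Q ** matrix (closest_point \<zeta>) ** transpose Q) \<in> borel_measurable G"
          by (rule measurable_compose)
        moreover have "matrix (closest_point (?Q ` \<zeta>)) =
            Q ** matrix (closest_point \<zeta>) ** transpose Q" if "\<zeta> \<in> space G" for \<zeta>
          using line[of \<zeta>] that spG
          by (auto simp: rotation_image_span matrix_closest_point_rotation[OF Q])
        ultimately show "(\<lambda>\<zeta>. matrix (closest_point (?Q ` \<zeta>))) \<in> borel_measurable G"
          by (simp cong: measurable_cong)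
      qed
      then show ?thesis by (simp add: G_def grassmann_algebra_def)
    qed
    have inv: "distr \<nu> \<nu> ?Q = \<nu>"
    proof (rule measure_eqI)
      fix A assume "A \<in> sets (distr \<nu> \<nu> ?Q)"
      then have [measurable]: "A \<in> sets borel" by (simp add: sets_\<nu>)
      have vm: "?Q -` B \<in> sets borel" if "B \<in> sets borel" for B
        using measurable_sets[of ?Q borel borel B] that by simp
      have eq: "emeasure lborel (?Q -` B) = emeasure lborel B" if "B \<in> sets borel" for B
        using arg_cong[OF distr_lborel_rotation[OF Q], of "\<lambda>M. emeasure M B"] that
        by (simp add: emeasure_distr)
      have bl: "ball 0 1 \<inter> ?Q -` A = ?Q -` (ball 0 1 \<inter> A)" by (auto simp: nQ)
      have "emeasure (distr \<nu> \<nu> ?Q) A = emeasure \<nu> (?Q -` A)"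
        by (subst emeasure_distr) (auto simp: sets_\<nu> space_\<nu> cong: measurable_cong_sets)
      also have "\<dots> = emeasure \<nu> A"
        using eq[of "ball 0 1 \<inter> A"] vm[of A] by (simp add: \<nu>_def bl)
      finally show "emeasure (distr \<nu> \<nu> ?Q) A = emeasure \<nu> A" .
    qed simp
    have Q\<nu>: "?Q \<in> \<nu> \<rightarrow>\<^sub>M \<nu>"
      by (auto simp: sets_\<nu> cong: measurable_cong_sets)
    have "distr \<mu> \<mu> ((`) ?Q) = distr \<mu> G ((`) ?Q)"
      by (rule distr_cong) (simp_all add: \<mu>_def)
    also have "\<dots> = distr \<nu> G ((`) ?Q \<circ> d)"
      unfolding \<mu>_def by (rule distr_distr[OF measQ measd])
    also have "\<dots> = distr \<nu> G (d \<circ> ?Q)"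
    proof (rule distr_cong_AE)
      have "AE x in lborel. x \<noteq> (0 :: real ^ 'n)" by (rule AE_lborel_singleton)
      then have "AE x in \<nu>. x \<noteq> 0"
        unfolding \<nu>_def using ball by (intro AE_uniform_measureI) auto
      then show "AE x in \<nu>. ((`) ?Q \<circ> d) x = (d \<circ> ?Q) x"
      proof (rule AE_mp, intro AE_I2 impI)
        fix x :: "real ^ 'n" assume "x \<noteq> 0"
        moreover from this have "Q *v x \<noteq> 0" by (metis nQ norm_eq_zero)
        ultimately show "((`) ?Q \<circ> d) x = (d \<circ> ?Q) x"
          by (simp add: d_def rotation_image_span)
      qed
    qed (use measQ measd Q\<nu> in \<open>auto intro: measurable_comp\<close>)
    also have "\<dots> = distr (distr \<nu> \<nu> ?Q) G d"
      by (rule distr_distr[OF measd Q\<nu>, symmetric])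
    also have "\<dots> = \<mu>" by (simp add: inv \<mu>_def)
    finally show ?thesis .
  qed
  ultimately have "invariant_grassmann_prob 1 \<mu>"
    by (simp add: invariant_grassmann_prob_def)
  then show ?thesis
    unfolding grassmann_measure_def by (rule someI)
qed

end

theory Submission
  imports Defs
begin

text \<open>The computation behind the theorem is the identity \<open>integral over affine lines of
  (kplane_transform f)(\<tau>) w(|x - \<tau>| / a) = integral of f(y) \<Phi>((x - y) / a)
  dy\<close>, where \<open>\<Phi>(z)\<close> is the mean of \<open>w(distance of z from
  \<zeta>)\<close> over all directions \<open>\<zeta>\<close>. It is Fubini's theorem along
  \<open>\<zeta>\<close> and its orthogonal complement (\<open>fibre_integral\<close>). The mean
  \<open>\<Phi>\<close> is a radial function, because the probability measure on the directions
  is rotation invariant. Integrating it against a radial function and using polar coordinates in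
  \<open>\<zeta>\<close> and in its complement shows that for almost every \<open>z\<close> it
  is the left side of the Abel equation at \<open>r = |z|\<close>
  (\<open>AE_mean_distance_eq_abel\<close>). Consequently a solution of the Abel equation has
  \<open>\<Phi> = psi \<circ> norm\<close>, and the wavelet transform of \<open>kplane_transform
  f\<close> is exactly the integral of \<open>f\<close> over the ball of radius \<open>a\<close>
  about \<open>x\<close>, divided by \<open>a\<^sup>n\<close>
  (\<open>wavelet_transform_eq_ball_integral\<close>).

  That \<open>abel_w\<close> solves the equation is a consequence of Tonelli's theorem. On
  \<open>(0,1]\<close> the equation is a Beta integral. For \<open>r > 1\<close> the power of
  \<open>v\<close> in the definition of \<open>abel_w\<close> is itself written as an Abel
  integral, and after two changes of the order of integration only two elementary integrals
  remain; the contribution of the negative tail of \<open>abel_w\<close> cancels that of its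
  value 1 on \<open>(0,1]\<close> (\<open>nn_integral_abel_w_tail\<close>). The same computation
  controls absolute convergence: the mean of \<open>|w|\<close> is bounded by a constant and
  decays like \<open>|z|\<^sup>(1-n)\<close>, hence lies in the dual of \<open>L\<^sup>p\<close>
  precisely for \<open>p < n\<close>, and Young's inequality applies.

  Once the transform is a ball mean, the almost everywhere limit is Lebesgue's differentiation
  theorem (\<open>AE_Lebesgue_point\<close>). The limit in \<open>L\<^sup>p\<close> follows from
  the almost everywhere limit because ball means do not increase the norm
  (\<open>Lp_convergence_from_norm_bound\<close>), and for \<open>f\<close> in
  \<open>C\<^sub>0\<close> the limit is uniform because \<open>f\<close> is uniformly
  continuous.

  If \<open>k > 1\<close>, the kernel \<open>(r\<^sup>2 - s\<^sup>2) powr (k/2 - 1)\<close> is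
  bounded, so by dominated convergence the left side of the equation is continuous from the
  right at \<open>r = 1\<close>, where \<open>psi\<close> jumps from 1 to 0
  (\<open>no_abel_solution\<close>).\<close>

section \<open>Lebesgue measure on subspaces\<close>

text \<open>The measure of which \<open>lebesgue_subspace\<close> is the completion. Its sigma-algebra does not
  depend on the subspace, so Fubini arguments are made for it and completed at the end.\<close>

definition borel_subspace :: "(real ^ 'n) set \<Rightarrow> (real ^ 'n) measure" where
  "borel_subspace V =
     (let B = (SOME B. orthonormal_basis_of V B)
      in distr (\<Pi>\<^sub>M b\<in>B. lborel) borel (\<lambda>c. \<Sum>b\<in>B. c b *\<^sub>R b))"

lemma lebesgue_subspace_eq_completion: "lebesgue_subspace V = completion (borel_subspace V)"
  by (simp add: lebesgue_subspace_def borel_subspace_def Let_def)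

lemma sets_borel_subspace [simp, measurable_cong]: "sets (borel_subspace V) = sets borel"
  and space_borel_subspace [simp]: "space (borel_subspace V) = UNIV"
  by (simp_all add: borel_subspace_def Let_def)

lemma finite_orthonormal_basis: "orthonormal_basis_of V B \<Longrightarrow> finite B"
  using independent_imp_finite by (auto simp: orthonormal_basis_of_def)

lemma card_orthonormal_basis: "orthonormal_basis_of V B \<Longrightarrow> card B = dim V"
  by (metis dim_eq_card_independent dim_span orthonormal_basis_of_def)

lemma orthonormal_basis_some:
  assumes "subspace V"
  shows "orthonormal_basis_of V (SOME B. orthonormal_basis_of V B)"
proof -
  obtain B where "B \<subseteq> V" "pairwise orthogonal B" "\<And>x. x \<in> B \<Longrightarrow> norm x = 1"
    "independent B" "card B = dim V" "span B = V"
    using orthonormal_basis_subspace[OF assms] by blast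
  then have "orthonormal_basis_of V B" by (simp add: orthonormal_basis_of_def)
  then show ?thesis by (rule someI)
qed

lemma inner_orthonormal_basis:
  assumes "orthonormal_basis_of V B" "a \<in> B" "b \<in> B"
  shows "a \<bullet> b = (if a = b then 1 else 0)"
  using assms by (auto simp: orthonormal_basis_of_def pairwise_def orthogonal_def norm_eq_1)

lemma norm_orthonormal_sum:
  assumes B: "orthonormal_basis_of V B"
  shows "norm (\<Sum>b\<in>B. c b *\<^sub>R b) = sqrt (\<Sum>b\<in>B. (c b)\<^sup>2)"
proof -
  note fin = finite_orthonormal_basis[OF B]
  have "(\<Sum>b\<in>B. c b *\<^sub>R b) \<bullet> (\<Sum>b\<in>B. c b *\<^sub>R b) = (\<Sum>a\<in>B. \<Sum>b\<in>B. c a * c b * (a \<bullet> b))"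
    by (simp add: inner_sum_left inner_sum_right sum_distrib_left mult_ac inner_commute)
  also have "\<dots> = (\<Sum>a\<in>B. \<Sum>b\<in>B. if a = b then c a * c b else 0)"
    by (intro sum.cong refl) (simp add: inner_orthonormal_basis[OF B])
  also have "\<dots> = (\<Sum>b\<in>B. (c b)\<^sup>2)"
    using fin by (simp add: power2_eq_square)
  finally show ?thesis by (simp add: norm_eq_sqrt_inner)
qed

lemma measurable_orthonormal_sum [measurable]:
  "(\<lambda>c. \<Sum>b\<in>B. c b *\<^sub>R b) \<in> borel_measurable (\<Pi>\<^sub>M b\<in>B. lborel)" for B :: "(real ^ 'n) set"
  by measurable

interpretation lborel_product: product_sigma_finite "\<lambda>_. lborel :: real measure" ..

text \<open>A bijection between the standard basis and \<open>B\<close> induces an orthogonal map, under which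
  Lebesgue measure is invariant; the coordinates with respect to \<open>B\<close> are the standard
  coordinates permuted by that bijection.\<close>

lemma distr_orthonormal_coordinates:
  fixes B :: "(real ^ 'n) set"
  assumes B: "orthonormal_basis_of UNIV B"
  shows "distr (\<Pi>\<^sub>M b\<in>B. lborel) borel (\<lambda>c. \<Sum>b\<in>B. c b *\<^sub>R b) = lborel"
proof -
  note fin = finite_orthonormal_basis[OF B]
  have "card (Basis :: (real ^ 'n) set) = card B"
    using card_orthonormal_basis[OF B] by simp
  then obtain \<sigma> where \<sigma>: "bij_betw \<sigma> (Basis :: (real ^ 'n) set) B"
    using fin by (metis finite_Basis finite_same_card_bij)
  define \<tau> where "\<tau> = inv_into Basis \<sigma>"
  have \<tau>: "bij_betw \<tau> B Basis" unfolding \<tau>_def by (rule bij_betw_inv_into[OF \<sigma>])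
  have \<tau>\<sigma>: "\<tau> (\<sigma> e) = e" if "e \<in> Basis" for e
    using \<sigma> that by (simp add: \<tau>_def bij_betw_inv_into_left)
  have \<tau>_in: "b \<in> B \<Longrightarrow> \<tau> b \<in> Basis" for b using \<tau> by (auto dest: bij_betwE)
  define R where "R = (\<lambda>f :: real ^ 'n \<Rightarrow> real. \<lambda>b\<in>B. f (\<tau> b))"
  have R[measurable]: "R \<in> (\<Pi>\<^sub>M b\<in>Basis. lborel) \<rightarrow>\<^sub>M (\<Pi>\<^sub>M b\<in>B. lborel)"
    unfolding R_def using \<tau>_in by (intro measurable_restrict) measurable
  have PB: "distr (\<Pi>\<^sub>M b\<in>Basis. lborel) (\<Pi>\<^sub>M b\<in>B. lborel) R = (\<Pi>\<^sub>M b\<in>B. lborel)"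
  proof (rule lborel_product.PiM_eqI[OF fin])
    fix A :: "real ^ 'n \<Rightarrow> real set" assume A: "\<And>i. i \<in> B \<Longrightarrow> A i \<in> sets lborel"
    have "R -` Pi\<^sub>E B A \<inter> space (\<Pi>\<^sub>M b\<in>Basis. lborel) = Pi\<^sub>E Basis (\<lambda>e. A (\<sigma> e))"
    proof (intro equalityI subsetI)
      fix f assume f: "f \<in> R -` Pi\<^sub>E B A \<inter> space (\<Pi>\<^sub>M b\<in>Basis. lborel)"
      then have "\<And>b. b \<in> B \<Longrightarrow> f (\<tau> b) \<in> A b" by (auto simp: R_def PiE_iff)
      then have "\<And>e. e \<in> Basis \<Longrightarrow> f e \<in> A (\<sigma> e)"
        by (metis \<sigma> \<tau>\<sigma> bij_betwE)
      with f show "f \<in> Pi\<^sub>E Basis (\<lambda>e. A (\<sigma> e))" by (auto simp: space_PiM PiE_iff)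
    next
      fix f assume f: "f \<in> Pi\<^sub>E Basis (\<lambda>e. A (\<sigma> e))"
      have "f (\<tau> b) \<in> A b" if "b \<in> B" for b
        using f \<tau>_in[OF that] \<sigma> that
        by (metis PiE_mem \<tau>_def bij_betw_inv_into_right)
      with f show "f \<in> R -` Pi\<^sub>E B A \<inter> space (\<Pi>\<^sub>M b\<in>Basis. lborel)"
        by (auto simp: R_def PiE_iff space_PiM)
    qed
    then have "emeasure (distr (\<Pi>\<^sub>M b\<in>Basis. lborel) (\<Pi>\<^sub>M b\<in>B. lborel) R) (Pi\<^sub>E B A) =
        emeasure (\<Pi>\<^sub>M b\<in>Basis. lborel) (Pi\<^sub>E Basis (\<lambda>e. A (\<sigma> e)))"
      using A fin by (subst emeasure_distr) (auto intro!: sets_PiM_I_finite)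
    also have "\<dots> = (\<Prod>e\<in>Basis. emeasure lborel (A (\<sigma> e)))"
      using A \<sigma> by (intro lborel_product.emeasure_PiM) (auto dest: bij_betwE)
    also have "\<dots> = (\<Prod>b\<in>B. emeasure lborel (A b))"
      by (rule prod.reindex_bij_betw[OF \<sigma>])
    finally show "emeasure (distr (\<Pi>\<^sub>M b\<in>Basis. lborel) (\<Pi>\<^sub>M b\<in>B. lborel) R) (Pi\<^sub>E B A) =
      (\<Prod>b\<in>B. emeasure lborel (A b))" .
  qed simp
  define L where "L = (\<lambda>x :: real ^ 'n. \<Sum>e\<in>Basis. (x \<bullet> e) *\<^sub>R \<sigma> e)"
  have linL: "linear L"
    unfolding L_def by (rule linearI)
      (simp_all add: inner_add_left scaleR_add_left sum.distrib scaleR_sum_right)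
  have normL: "norm (L x) = norm x" for x
  proof -
    have "L x = (\<Sum>b\<in>B. (x \<bullet> \<tau> b) *\<^sub>R b)"
      unfolding L_def using \<tau>\<sigma> by (subst sum.reindex_bij_betw[OF \<sigma>, symmetric]) simp
    then have "norm (L x) = sqrt (\<Sum>b\<in>B. (x \<bullet> \<tau> b)\<^sup>2)"
      by (simp add: norm_orthonormal_sum[OF B])
    also have "(\<Sum>b\<in>B. (x \<bullet> \<tau> b)\<^sup>2) = (\<Sum>e\<in>Basis. (x \<bullet> e)\<^sup>2)"
      by (rule sum.reindex_bij_betw[OF \<tau>])
    also have "sqrt \<dots> = norm x"
      using euclidean_dist_l2[of x 0] by (simp add: L2_set_def)
    finally show ?thesis .
  qed
  have "orthogonal_transformation L"
    by (simp add: orthogonal_transformation linL normL)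
  then have "orthogonal_matrix (matrix L)" by (simp add: orthogonal_transformation_matrix)
  from distr_lborel_rotation[OF this] linL
  have dL: "distr lborel borel L = lborel" by simp
  have [measurable]: "L \<in> borel_measurable borel"
    unfolding L_def by measurable
  let ?S = "\<lambda>c. \<Sum>b\<in>B. c b *\<^sub>R b"
  let ?E = "\<lambda>f. \<Sum>b\<in>Basis. f b *\<^sub>R b :: real ^ 'n"
  have "distr (\<Pi>\<^sub>M b\<in>B. lborel) borel ?S = distr (\<Pi>\<^sub>M b\<in>Basis. lborel) borel (?S \<circ> R)"
    by (subst PB[symmetric], rule distr_distr) auto
  also have "?S \<circ> R = L \<circ> ?E"
  proof
    fix f
    have "(?S \<circ> R) f = (\<Sum>b\<in>B. f (\<tau> b) *\<^sub>R b)" by (simp add: R_def)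
    also have "\<dots> = (\<Sum>e\<in>Basis. f e *\<^sub>R \<sigma> e)"
      using \<tau>\<sigma> by (subst sum.reindex_bij_betw[OF \<sigma>, symmetric]) simp
    also have "\<dots> = (L \<circ> ?E) f"
      by (simp add: L_def inner_sum_left inner_Basis if_distrib cong: if_cong)
    finally show "(?S \<circ> R) f = (L \<circ> ?E) f" .
  qed
  also have "distr (\<Pi>\<^sub>M b\<in>Basis. lborel) borel (L \<circ> ?E) =
      distr (distr (\<Pi>\<^sub>M b\<in>Basis. lborel) borel ?E) borel L"
    by (rule distr_distr[symmetric]) auto
  also have "\<dots> = lborel" by (simp add: lborel_eq[symmetric] dL)
  finally show ?thesis .
qed

text \<open>An orthonormal basis of the whole space that is adapted to the decomposition into a
  subspace and its complement.\<close>

lemma orthonormal_basis_Un: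
  assumes V: "subspace V" and B: "orthonormal_basis_of V B" and C: "orthonormal_basis_of (V\<^sup>\<bottom>) C"
  shows "orthonormal_basis_of UNIV (B \<union> C)" "B \<inter> C = {}"
proof -
  have BV: "B \<subseteq> V" and CV: "C \<subseteq> V\<^sup>\<bottom>"
    using B C span_superset[of B] span_superset[of C] by (simp_all add: orthonormal_basis_of_def)
  have o: "orthogonal b c" if "b \<in> B" "c \<in> C" for b c
    using BV CV that by (auto simp: orthogonal_comp_def)
  have n: "norm x = 1" if "x \<in> B \<union> C" for x
    using B C that by (auto simp: orthonormal_basis_of_def)
  show disj: "B \<inter> C = {}"
    using o n by (metis Un_iff disjoint_iff norm_zero orthogonal_self zero_neq_one)
  have p: "pairwise orthogonal (B \<union> C)"
    using B C o o[THEN orthogonal_commute[THEN iffD1]]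
    by (auto simp: orthonormal_basis_of_def pairwise_def)
  have i: "independent (B \<union> C)"
    using p n by (metis norm_zero pairwise_orthogonal_independent zero_neq_one)
  have "x \<in> span (B \<union> C)" for x
  proof -
    obtain y z where y: "y \<in> span V" and z: "\<And>w. w \<in> span V \<Longrightarrow> orthogonal z w" and x: "x = y + z"
      using orthogonal_subspace_decomp_exists[of V x] by blast
    have "z \<in> V\<^sup>\<bottom>" using z by (auto simp: orthogonal_comp_def span_base orthogonal_commute)
    then have "z \<in> span C" using C by (simp add: orthonormal_basis_of_def)
    moreover have "y \<in> span B" using y B V by (simp add: orthonormal_basis_of_def span_eq_iff[THEN iffD2])
    ultimately show ?thesis unfolding x
      by (meson span_add span_mono subsetD sup_ge1 sup_ge2)
  qed
  then show "orthonormal_basis_of UNIV (B \<union> C)"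
    using p n i by (auto simp: orthonormal_basis_of_def)
qed

lemma AE_borel_subspace_mem:
  fixes V :: "(real ^ 'n) set"
  assumes V: "subspace V"
  shows "AE x in borel_subspace V. x \<in> V"
proof -
  define B where "B = (SOME B. orthonormal_basis_of V B)"
  have B: "orthonormal_basis_of V B" unfolding B_def by (rule orthonormal_basis_some[OF V])
  have "(\<Sum>b\<in>B. c b *\<^sub>R b) \<in> span B" for c
    by (intro span_sum span_scale span_base)
  then have "(\<Sum>b\<in>B. c b *\<^sub>R b) \<in> V" for c
    using B by (simp add: orthonormal_basis_of_def)
  moreover have "closed V" by (rule closed_subspace[OF V])
  ultimately show ?thesis
    unfolding borel_subspace_def Let_def B_def[symmetric]
    by (subst AE_distr_iff) (auto simp: )
qed

lemma emeasure_borel_subspace_cball: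
  fixes V :: "(real ^ 'n) set"
  assumes V: "subspace V" and r: "0 < r"
  shows "emeasure (borel_subspace V) (cball 0 r) = ennreal (unit_ball_vol (real (dim V)) * r ^ dim V)"
proof -
  define B where "B = (SOME B. orthonormal_basis_of V B)"
  have B: "orthonormal_basis_of V B" unfolding B_def by (rule orthonormal_basis_some[OF V])
  let ?P = "\<Pi>\<^sub>M b\<in>B. lborel :: (real ^ 'n \<Rightarrow> real) measure"
  have "emeasure (borel_subspace V) (cball 0 r) =
      emeasure ?P ((\<lambda>c. \<Sum>b\<in>B. c b *\<^sub>R b) -` cball 0 r \<inter> space ?P)"
    unfolding borel_subspace_def Let_def B_def[symmetric] by (rule emeasure_distr) auto
  also have "(\<lambda>c. \<Sum>b\<in>B. c b *\<^sub>R b) -` cball 0 r \<inter> space ?P =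
      {f. sqrt (\<Sum>b\<in>B. (f b)\<^sup>2) \<le> r} \<inter> space ?P"
    by (auto simp: norm_orthonormal_sum[OF B])
  also have "emeasure ?P \<dots> = ennreal (unit_ball_vol (real (card B)) * r ^ card B)"
    by (rule emeasure_cball_aux[OF finite_orthonormal_basis[OF B] r])
  finally show ?thesis by (simp add: card_orthonormal_basis[OF B])
qed

lemma sigma_finite_borel_subspace:
  fixes V :: "(real ^ 'n) set"
  assumes V: "subspace V"
  shows "sigma_finite_measure (borel_subspace V)"
proof
  show "\<exists>A. countable A \<and> A \<subseteq> sets (borel_subspace V) \<and> \<Union> A = space (borel_subspace V) \<and>
      (\<forall>a\<in>A. emeasure (borel_subspace V) a \<noteq> \<infinity>)"
  proof (intro exI conjI)
    show "\<Union> (range (\<lambda>i::nat. cball (0 :: real ^ 'n) (real (Suc i)))) = space (borel_subspace V)"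
    proof (intro equalityI subsetI)
      fix x :: "real ^ 'n"
      obtain i :: nat where "norm x < real i" using reals_Archimedean2 by blast
      then have "x \<in> cball 0 (real (Suc i))" by simp
      then show "x \<in> \<Union> (range (\<lambda>i::nat. cball 0 (real (Suc i))))" by blast
    qed simp
    show "\<forall>a\<in>range (\<lambda>i::nat. cball (0 :: real ^ 'n) (real (Suc i))).
        emeasure (borel_subspace V) a \<noteq> \<infinity>"
      using emeasure_borel_subspace_cball[OF V] by (auto simp del: of_nat_Suc)
  qed auto
qed

text \<open>The coordinates with respect to the union of two orthonormal bases are pairs of
  coordinates, so this is Tonelli in disguise. Both orders of integration occur below.\<close>

lemma nn_integral_lborel_subspace_split:
  fixes V :: "(real ^ 'n) set"
  assumes V: "subspace V" and f[measurable]: "f \<in> borel_measurable borel"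
  shows "(\<integral>\<^sup>+x. f x \<partial>lborel) = (\<integral>\<^sup>+z. (\<integral>\<^sup>+y. f (y + z) \<partial>borel_subspace V) \<partial>borel_subspace (V\<^sup>\<bottom>))"
    (is ?A)
    and "(\<integral>\<^sup>+x. f x \<partial>lborel) = (\<integral>\<^sup>+y. (\<integral>\<^sup>+z. f (y + z) \<partial>borel_subspace (V\<^sup>\<bottom>)) \<partial>borel_subspace V)"
    (is ?B)
proof -
  define B where "B = (SOME B. orthonormal_basis_of V B)"
  define C where "C = (SOME B. orthonormal_basis_of (V\<^sup>\<bottom>) B)"
  have B: "orthonormal_basis_of V B" unfolding B_def by (rule orthonormal_basis_some[OF V])
  have C: "orthonormal_basis_of (V\<^sup>\<bottom>) C"
    unfolding C_def by (rule orthonormal_basis_some[OF subspace_orthogonal_comp])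
  note BC = orthonormal_basis_Un[OF V B C]
  note fin = finite_orthonormal_basis[OF B] finite_orthonormal_basis[OF C]
  interpret pB: finite_product_sigma_finite "\<lambda>_. lborel" B by standard (rule fin)
  interpret pC: finite_product_sigma_finite "\<lambda>_. lborel" C by standard (rule fin)
  interpret P: pair_sigma_finite "\<Pi>\<^sub>M b\<in>B. lborel" "\<Pi>\<^sub>M b\<in>C. lborel" by standard
  let ?S = "\<lambda>B c. \<Sum>b\<in>B. c b *\<^sub>R (b :: real ^ 'n)"
  let ?f = "\<lambda>c d. f (?S B c + ?S C d)"
  have m: "?S (B \<union> C) (merge B C (c, d)) = ?S B c + ?S C d" for c d
  proof -
    have "?S (B \<union> C) (merge B C (c, d)) = ?S B (merge B C (c, d)) + ?S C (merge B C (c, d))"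
      using fin BC(2) by (rule sum.union_disjoint)
    also have "?S B (merge B C (c, d)) = ?S B c" using BC(2) by (intro sum.cong) auto
    also have "?S C (merge B C (c, d)) = ?S C d" using BC(2) by (intro sum.cong) auto
    finally show ?thesis .
  qed
  have "(\<integral>\<^sup>+x. f x \<partial>lborel) = (\<integral>\<^sup>+c. f (?S (B \<union> C) c) \<partial>(\<Pi>\<^sub>M b\<in>B \<union> C. lborel))"
    unfolding distr_orthonormal_coordinates[OF BC(1), symmetric]
    by (subst nn_integral_distr) auto
  also have "\<dots> = (\<integral>\<^sup>+c. (\<integral>\<^sup>+d. ?f c d \<partial>(\<Pi>\<^sub>M b\<in>C. lborel)) \<partial>(\<Pi>\<^sub>M b\<in>B. lborel))"
    by (subst lborel_product.product_nn_integral_fold[OF BC(2) fin])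
      (auto simp: m)
  finally have 1: "(\<integral>\<^sup>+x. f x \<partial>lborel) = \<dots>" .
  also have "\<dots> = (\<integral>\<^sup>+d. (\<integral>\<^sup>+c. ?f c d \<partial>(\<Pi>\<^sub>M b\<in>B. lborel)) \<partial>(\<Pi>\<^sub>M b\<in>C. lborel))"
    by (rule P.Fubini'[symmetric]) simp
  finally have 2: "(\<integral>\<^sup>+x. f x \<partial>lborel) = \<dots>" .
  have bs: "borel_subspace V = distr (\<Pi>\<^sub>M b\<in>B. lborel) borel (?S B)"
    "borel_subspace (V\<^sup>\<bottom>) = distr (\<Pi>\<^sub>M b\<in>C. lborel) borel (?S C)"
    by (simp_all add: borel_subspace_def B_def C_def Let_def)
  interpret V: sigma_finite_measure "borel_subspace V" by (rule sigma_finite_borel_subspace[OF V])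
  interpret W: sigma_finite_measure "borel_subspace (V\<^sup>\<bottom>)"
    by (rule sigma_finite_borel_subspace[OF subspace_orthogonal_comp])
  have m1: "(\<lambda>y. \<integral>\<^sup>+z. f (y + z) \<partial>borel_subspace (V\<^sup>\<bottom>)) \<in> borel_measurable borel"
    by measurable
  have m2: "(\<lambda>z. \<integral>\<^sup>+y. f (y + z) \<partial>borel_subspace V) \<in> borel_measurable borel"
    by measurable
  have "(\<integral>\<^sup>+y. (\<integral>\<^sup>+z. f (y + z) \<partial>borel_subspace (V\<^sup>\<bottom>)) \<partial>borel_subspace V) =
      (\<integral>\<^sup>+c. (\<integral>\<^sup>+z. f (?S B c + z) \<partial>borel_subspace (V\<^sup>\<bottom>)) \<partial>(\<Pi>\<^sub>M b\<in>B. lborel))"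
    by (subst bs(1), rule nn_integral_distr) (use m1 in auto)
  also have "\<dots> = (\<integral>\<^sup>+c. (\<integral>\<^sup>+d. ?f c d \<partial>(\<Pi>\<^sub>M b\<in>C. lborel)) \<partial>(\<Pi>\<^sub>M b\<in>B. lborel))"
    by (intro nn_integral_cong, subst bs(2), rule nn_integral_distr) auto
  finally show ?B by (simp add: 1)
  have "(\<integral>\<^sup>+z. (\<integral>\<^sup>+y. f (y + z) \<partial>borel_subspace V) \<partial>borel_subspace (V\<^sup>\<bottom>)) =
      (\<integral>\<^sup>+d. (\<integral>\<^sup>+y. f (y + ?S C d) \<partial>borel_subspace V) \<partial>(\<Pi>\<^sub>M b\<in>C. lborel))"
    by (subst bs(2), rule nn_integral_distr) (use m2 in auto)
  also have "\<dots> = (\<integral>\<^sup>+d. (\<integral>\<^sup>+c. ?f c d \<partial>(\<Pi>\<^sub>M b\<in>B. lborel)) \<partial>(\<Pi>\<^sub>M b\<in>C. lborel))"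
    by (intro nn_integral_cong, subst bs(1), rule nn_integral_distr) auto
  finally show ?A by (simp add: 2)
qed

section \<open>Orthogonal projections and subspace measures\<close>

lemma dim_orthogonal_comp_add:
  fixes V :: "(real ^ 'n) set"
  assumes V: "subspace V"
  shows "dim V + dim (V\<^sup>\<bottom>) = CARD('n)"
proof -
  define B where "B = (SOME B. orthonormal_basis_of V B)"
  define C where "C = (SOME B. orthonormal_basis_of (V\<^sup>\<bottom>) B)"
  have B: "orthonormal_basis_of V B" unfolding B_def by (rule orthonormal_basis_some[OF V])
  have C: "orthonormal_basis_of (V\<^sup>\<bottom>) C"
    unfolding C_def by (rule orthonormal_basis_some[OF subspace_orthogonal_comp])
  note BC = orthonormal_basis_Un[OF V B C]
  have "card (B \<union> C) = card B + card C"
    using finite_orthonormal_basis[OF B] finite_orthonormal_basis[OF C] BC(2)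
    by (rule card_Un_disjoint)
  then show ?thesis
    using card_orthonormal_basis[OF B] card_orthonormal_basis[OF C] card_orthonormal_basis[OF BC(1)]
    by simp
qed

text \<open>The nearest point of a subspace is the orthogonal projection, by Pythagoras.\<close>

lemma closest_point_subspace_add:
  fixes V :: "(real ^ 'n) set"
  assumes V: "subspace V" and y: "y \<in> V" and z: "z \<in> V\<^sup>\<bottom>"
  shows "closest_point V (y + z) = y"
proof (rule sym, rule closest_point_unique)
  show "convex V" by (rule subspace_imp_convex[OF V])
  show "closed V" by (rule closed_subspace[OF V])
  show "\<forall>v\<in>V. dist (y + z) y \<le> dist (y + z) v"
  proof
    fix v assume v: "v \<in> V"
    have "y - v \<in> V" by (rule subspace_diff[OF V y v])
    then have o: "orthogonal z (y - v)" using z by (auto simp: orthogonal_comp_def intro: orthogonal_commute[THEN iffD1])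
    have "(norm (z + (y - v)))\<^sup>2 = (norm z)\<^sup>2 + (norm (y - v))\<^sup>2"
      by (rule norm_add_Pythagorean[OF o])
    then have "(norm z)\<^sup>2 \<le> (norm (z + (y - v)))\<^sup>2" by simp
    then have "norm z \<le> norm (z + (y - v))" by (rule power2_le_imp_le) simp
    then show "dist (y + z) y \<le> dist (y + z) v" by (simp add: dist_norm algebra_simps)
  qed
qed (rule y)

lemma closest_point_subspace:
  fixes V :: "(real ^ 'n) set"
  assumes V: "subspace V"
  shows "closest_point V x \<in> V" "x - closest_point V x \<in> V\<^sup>\<bottom>"
proof -
  obtain y z where y: "y \<in> span V" and z: "\<And>w. w \<in> span V \<Longrightarrow> orthogonal z w" and x: "x = y + z"
    using orthogonal_subspace_decomp_exists[of V x] by blast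
  have yV: "y \<in> V" using y V by (simp add: span_eq_iff[THEN iffD2])
  have zV: "z \<in> V\<^sup>\<bottom>" using z by (auto simp: orthogonal_comp_def span_base orthogonal_commute)
  show "closest_point V x \<in> V" "x - closest_point V x \<in> V\<^sup>\<bottom>"
    using yV zV by (simp_all add: x closest_point_subspace_add[OF V])
qed

lemma linear_closest_point:
  fixes V :: "(real ^ 'n) set"
  assumes V: "subspace V"
  shows "linear (closest_point V)"
proof (rule linearI)
  note W = subspace_orthogonal_comp[of V]
  note c = closest_point_subspace[OF V]
  fix x y :: "real ^ 'n" and r :: real
  show "closest_point V (x + y) = closest_point V x + closest_point V y"
    using closest_point_subspace_add[OF V subspace_add[OF V c(1) c(1)] subspace_add[OF W c(2) c(2)],
      of x y x y] by simp
  show "closest_point V (r *\<^sub>R x) = r *\<^sub>R closest_point V x"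
    using closest_point_subspace_add[OF V subspace_scale[OF V c(1)] subspace_scale[OF W c(2)],
      of r x r x] by (simp add: algebra_simps)
qed

lemma measurable_closest_point_subspace:
  fixes V :: "(real ^ 'n) set"
  assumes V: "subspace V"
  shows "closest_point V \<in> borel_measurable borel"
  by (intro borel_measurable_continuous_onI linear_continuous_on linear_closest_point V
      linear_linear[THEN iffD2])

lemma emeasure_distr_density:
  assumes [measurable]: "d \<in> borel_measurable M" "f \<in> M \<rightarrow>\<^sub>M N" "A \<in> sets N"
  shows "emeasure (distr (density M d) N f) A = (\<integral>\<^sup>+x. d x * indicator A (f x) \<partial>M)"
proof -
  have "emeasure (distr (density M d) N f) A = (\<integral>\<^sup>+y. indicator A y \<partial>distr (density M d) N f)"
    by simp
  also have "\<dots> = (\<integral>\<^sup>+x. indicator A (f x) \<partial>density M d)"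
    by (rule nn_integral_distr) auto
  also have "\<dots> = (\<integral>\<^sup>+x. d x * indicator A (f x) \<partial>M)"
    by (rule nn_integral_density) auto
  finally show ?thesis .
qed

text \<open>The factor that normalises a slab or tube of radius 1.\<close>

lemma nn_integral_unit_ball_average:
  fixes V :: "(real ^ 'n) set"
  assumes V: "subspace V"
  shows "(\<integral>\<^sup>+z. a * (ennreal (1 / unit_ball_vol (real (dim V))) * indicator (cball 0 1) z) \<partial>borel_subspace V) = a"
proof -
  have "ennreal (1 / unit_ball_vol (real (dim V))) * ennreal (unit_ball_vol (real (dim V))) = 1"
    by (subst ennreal_mult[symmetric]) (auto simp: less_imp_neq[symmetric])
  then have "(a * ennreal (1 / unit_ball_vol (real (dim V)))) * emeasure (borel_subspace V) (cball 0 1) = a"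
    by (simp add: emeasure_borel_subspace_cball[OF V] mult.assoc)
  then show ?thesis
    by (subst mult.assoc[symmetric], subst nn_integral_cmult_indicator) auto
qed

text \<open>The measure on a subspace is obtained from Lebesgue measure of the whole space, restricted
  to a tube around the subspace, by projection. The point is that this formula does not mention
  a basis: the bases in the definition are arbitrary choices that depend on the subspace in no
  measurable way, whereas the projection depends measurably on it.\<close>

lemma borel_subspace_eq_distr_projection:
  fixes V :: "(real ^ 'n) set"
  assumes V: "subspace V"
  defines "m \<equiv> unit_ball_vol (real (dim (V\<^sup>\<bottom>)))"
  shows "borel_subspace V = distr (density lborel (\<lambda>x. ennreal (indicator {..1} (norm (x - closest_point V x)) / m)))
    borel (closest_point V)"
proof (rule measure_eqI)
  note [measurable] = measurable_closest_point_subspace[OF V]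
  interpret V: sigma_finite_measure "borel_subspace V" by (rule sigma_finite_borel_subspace[OF V])
  have m: "m > 0" by (simp add: m_def)
  fix A assume "A \<in> sets (borel_subspace V)"
  then have A[measurable]: "A \<in> sets borel" by simp
  have "emeasure (distr (density lborel (\<lambda>x. ennreal (indicator {..1} (norm (x - closest_point V x)) / m)))
      borel (closest_point V)) A =
      (\<integral>\<^sup>+x. ennreal (indicator {..1} (norm (x - closest_point V x)) / m) * indicator A (closest_point V x) \<partial>lborel)"
    by (subst emeasure_distr_density) auto
  also have "\<dots> = (\<integral>\<^sup>+y. (\<integral>\<^sup>+z. ennreal (indicator {..1} (norm (y + z - closest_point V (y + z))) / m)
      * indicator A (closest_point V (y + z)) \<partial>borel_subspace (V\<^sup>\<bottom>)) \<partial>borel_subspace V)"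
    by (rule nn_integral_lborel_subspace_split(2)[OF V]) measurable
  also have "\<dots> = (\<integral>\<^sup>+y. (\<integral>\<^sup>+z. indicator A y * (ennreal (1 / m) * indicator (cball 0 1) z)
       \<partial>borel_subspace (V\<^sup>\<bottom>)) \<partial>borel_subspace V)"
  proof (rule nn_integral_cong_AE, rule AE_mp[OF AE_borel_subspace_mem[OF V]], intro AE_I2 impI)
    fix y assume y: "y \<in> V"
    show "(\<integral>\<^sup>+z. ennreal (indicator {..1} (norm (y + z - closest_point V (y + z))) / m)
      * indicator A (closest_point V (y + z)) \<partial>borel_subspace (V\<^sup>\<bottom>)) =
      (\<integral>\<^sup>+z. indicator A y * (ennreal (1 / m) * indicator (cball 0 1) z) \<partial>borel_subspace (V\<^sup>\<bottom>))"
      by (rule nn_integral_cong_AE,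
        rule AE_mp[OF AE_borel_subspace_mem[OF subspace_orthogonal_comp[of V]]], intro AE_I2 impI)
        (auto simp: closest_point_subspace_add[OF V y] indicator_def)
  qed
  also have "\<dots> = (\<integral>\<^sup>+y. indicator A y \<partial>borel_subspace V)"
    unfolding m_def by (simp only: nn_integral_unit_ball_average[OF subspace_orthogonal_comp])
  finally show "emeasure (borel_subspace V) A = emeasure (distr (density lborel
      (\<lambda>x. ennreal (indicator {..1} (norm (x - closest_point V x)) / m))) borel (closest_point V)) A"
    by simp
qed simp

lemma closest_point_orthogonal_comp:
  fixes V :: "(real ^ 'n) set"
  assumes V: "subspace V"
  shows "closest_point (V\<^sup>\<bottom>) = (\<lambda>x. x - closest_point V x)"
proof
  fix x
  note c = closest_point_subspace[OF V, of x]
  have "closest_point V x \<in> (V\<^sup>\<bottom>)\<^sup>\<bottom>" using c(1) orthogonal_comp_subset by blast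
  from closest_point_subspace_add[OF subspace_orthogonal_comp c(2) this]
  show "closest_point (V\<^sup>\<bottom>) x = x - closest_point V x" by simp
qed

lemma borel_subspace_perp_eq_distr_projection:
  fixes V :: "(real ^ 'n) set"
  assumes V: "subspace V"
  defines "m \<equiv> unit_ball_vol (real (dim V))"
  shows "borel_subspace (V\<^sup>\<bottom>) = distr (density lborel (\<lambda>x. ennreal (indicator {..1} (norm (closest_point V x)) / m)))
    borel (\<lambda>x. x - closest_point V x)"
  using borel_subspace_eq_distr_projection[OF subspace_orthogonal_comp[of V]]
  by (simp add: closest_point_orthogonal_comp[OF V] orthogonal_comp_self[OF V] m_def)

lemma space_grassmann_algebra [simp]: "space (grassmann_algebra k) = grassmannian k"
  by (simp add: grassmann_algebra_def)

text \<open>The algebra on the Grassmannian is generated by the matrices of the projections, so the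
  projection of a point is jointly measurable in subspace and point.\<close>

lemma measurable_grassmann_projection [measurable]:
  "(\<lambda>p. closest_point (fst p) (snd p)) \<in>
     borel_measurable (grassmann_algebra k \<Otimes>\<^sub>M (borel :: (real ^ 'n) measure))"
proof -
  have 1: "(\<lambda>\<zeta>. matrix (closest_point \<zeta>) :: real ^ 'n ^ 'n) \<in> borel_measurable (grassmann_algebra k)"
    unfolding grassmann_algebra_def by (rule measurable_vimage_algebra1) simp
  have 2: "(\<lambda>\<zeta>. matrix (closest_point \<zeta>) $ i $ j :: real) \<in> borel_measurable (grassmann_algebra k)"
    for i j :: 'n
    by (rule measurable_compose[OF 1])
      (auto intro!: borel_measurable_continuous_onI continuous_intros)
  have [measurable]: "(\<lambda>x :: real ^ 'n. x $ j) \<in> borel_measurable borel" for j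
    by (auto intro!: borel_measurable_continuous_onI continuous_intros)
  note [measurable] = 2
  have "(\<lambda>p. (matrix (closest_point (fst p)) :: real ^ 'n ^ 'n) *v snd p) \<in>
      borel_measurable (grassmann_algebra k \<Otimes>\<^sub>M (borel :: (real ^ 'n) measure))"
    unfolding matrix_vector_mult_def
    by (subst borel_measurable_euclidean_space) (auto simp: Basis_vec_def inner_axis)
  also have "?this \<longleftrightarrow> ?thesis"
    by (intro measurable_cong)
      (auto simp: space_pair_measure grassmannian_def linear_closest_point)
  finally show ?thesis .
qed

section \<open>The measure on affine planes\<close>

definition affine_grassmann_algebra :: "nat \<Rightarrow> ((real ^ 'n) set \<times> (real ^ 'n)) measure" where
  "affine_grassmann_algebra k =
     restrict_space (grassmann_algebra k \<Otimes>\<^sub>M borel) (affine_grassmannian k)"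

text \<open>The measure on affine planes before completion, as an image of a measure on a product
  space: the direction is drawn from \<open>\<mu>\<close>, and the offset is the projection of a point of a slab
  to the orthogonal complement.\<close>

definition borel_affine_grassmann ::
  "nat \<Rightarrow> (real ^ 'n) set measure \<Rightarrow> ((real ^ 'n) set \<times> (real ^ 'n)) measure" where
  "borel_affine_grassmann k \<mu> =
     distr (density (\<mu> \<Otimes>\<^sub>M lborel)
         (\<lambda>(\<zeta>, x). ennreal (indicator {..1} (norm (closest_point \<zeta> x)) / unit_ball_vol (real k))))
       (affine_grassmann_algebra k) (\<lambda>(\<zeta>, x). (\<zeta>, x - closest_point \<zeta> x))"

lemma affine_grassmannian_subset: "affine_grassmannian k \<subseteq> grassmannian k \<times> UNIV"
  by (auto simp: affine_grassmannian_def)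

lemma space_affine_grassmann_algebra [simp]:
  "space (affine_grassmann_algebra k) = affine_grassmannian k"
  using affine_grassmannian_subset[of k]
  by (auto simp: affine_grassmann_algebra_def space_restrict_space space_pair_measure)

lemma space_borel_affine_grassmann [simp]:
  "space (borel_affine_grassmann k \<mu>) = affine_grassmannian k"
  by (simp add: borel_affine_grassmann_def)

lemma sets_borel_affine_grassmann [simp, measurable_cong]:
  "sets (borel_affine_grassmann k \<mu>) = sets (affine_grassmann_algebra k)"
  by (simp add: borel_affine_grassmann_def)

lemma grassmannianD: "\<zeta> \<in> grassmannian k \<Longrightarrow> subspace \<zeta>" "\<zeta> \<in> grassmannian k \<Longrightarrow> dim \<zeta> = k"
  by (simp_all add: grassmannian_def)

locale grassmann_prob = prob_space \<mu> for \<mu> :: "(real ^ 'n) set measure" and k :: nat +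
  assumes sets_\<mu> [measurable_cong]: "sets \<mu> = sets (grassmann_algebra k)"
begin

lemma space_\<mu> [simp]: "space \<mu> = grassmannian k"
  using sets_eq_imp_space_eq[OF sets_\<mu>] by simp

interpretation pair_sigma_finite \<mu> "lborel :: (real ^ 'n) measure" ..

lemma measurable_pair_projection [measurable]:
  "(\<lambda>p. closest_point (fst p) (snd p)) \<in> borel_measurable (\<mu> \<Otimes>\<^sub>M (borel :: (real ^ 'n) measure))"
  "(\<lambda>p. closest_point (fst p) (snd p)) \<in> borel_measurable (\<mu> \<Otimes>\<^sub>M (lborel :: (real ^ 'n) measure))"
  using measurable_grassmann_projection[of k]
  by (simp_all add: measurable_cong_sets[OF sets_pair_measure_cong[OF sets_\<mu> refl] refl]
      measurable_cong_sets[OF sets_pair_measure_cong[OF sets_\<mu> sets_lborel] refl])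

lemma measurable_affine_param [measurable]:
  "(\<lambda>p. (fst p, snd p - closest_point (fst p) (snd p))) \<in> \<mu> \<Otimes>\<^sub>M lborel \<rightarrow>\<^sub>M affine_grassmann_algebra k"
  unfolding affine_grassmann_algebra_def
proof (rule measurable_restrict_space2)
  show "(\<lambda>p. (fst p, snd p - closest_point (fst p) (snd p)))
      \<in> space (\<mu> \<Otimes>\<^sub>M lborel) \<rightarrow> affine_grassmannian k"
    by (auto simp: affine_grassmannian_def space_pair_measure dest: grassmannianD
        intro!: closest_point_subspace)
  show "(\<lambda>p. (fst p, snd p - closest_point (fst p) (snd p)))
      \<in> \<mu> \<Otimes>\<^sub>M lborel \<rightarrow>\<^sub>M grassmann_algebra k \<Otimes>\<^sub>M borel"
    using sets_\<mu> by measurable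
qed

text \<open>In particular the right side is measurable and countably additive in \<open>A\<close>, which is not
  visible from the way in which the measure on affine planes was introduced.\<close>

lemma emeasure_borel_affine_grassmann:
  assumes A: "A \<in> sets (affine_grassmann_algebra k)"
  shows "emeasure (borel_affine_grassmann k \<mu>) A =
    (\<integral>\<^sup>+\<zeta>. emeasure (borel_subspace (\<zeta>\<^sup>\<bottom>)) (Pair \<zeta> -` A) \<partial>\<mu>)"
    and "\<And>\<zeta>. \<zeta> \<in> grassmannian k \<Longrightarrow> Pair \<zeta> -` A \<in> sets borel"
proof -
  note [measurable] = A
  obtain A' where A': "A' \<in> sets (grassmann_algebra k \<Otimes>\<^sub>M borel)" "A = A' \<inter> affine_grassmannian k"
    using A by (auto simp: affine_grassmann_algebra_def sets_restrict_space)
  show B: "Pair \<zeta> -` A \<in> sets borel" if "\<zeta> \<in> grassmannian k" for \<zeta>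
  proof -
    have "Pair \<zeta> -` A = (Pair \<zeta> -` A') \<inter> \<zeta>\<^sup>\<bottom>"
      using that by (auto simp: A' affine_grassmannian_def)
    moreover have "Pair \<zeta> -` A' \<in> sets borel" by (rule sets_Pair1[OF A'(1)])
    moreover have "closed (\<zeta>\<^sup>\<bottom>)" by (rule closed_subspace[OF subspace_orthogonal_comp])
    ultimately show ?thesis by auto
  qed
  let ?d = "\<lambda>p. ennreal (indicator {..1} (norm (closest_point (fst p) (snd p))) / unit_ball_vol (real k))"
  let ?t = "\<lambda>p. (fst p, snd p - closest_point (fst p) (snd p))"
  have "emeasure (borel_affine_grassmann k \<mu>) A = (\<integral>\<^sup>+p. ?d p * indicator A (?t p) \<partial>(\<mu> \<Otimes>\<^sub>M lborel))"
    unfolding borel_affine_grassmann_def split_def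
    by (subst emeasure_distr_density) auto
  also have "\<dots> = (\<integral>\<^sup>+\<zeta>. (\<integral>\<^sup>+x. ?d (\<zeta>, x) * indicator A (?t (\<zeta>, x)) \<partial>lborel) \<partial>\<mu>)"
    by (rule lborel.nn_integral_fst[symmetric]) measurable
  also have "\<dots> = (\<integral>\<^sup>+\<zeta>. emeasure (borel_subspace (\<zeta>\<^sup>\<bottom>)) (Pair \<zeta> -` A) \<partial>\<mu>)"
  proof (intro nn_integral_cong)
    fix \<zeta> assume "\<zeta> \<in> space \<mu>"
    then have \<zeta>: "\<zeta> \<in> grassmannian k" by simp
    note s = grassmannianD[OF \<zeta>]
    note [measurable] = measurable_closest_point_subspace[OF s(1)] B[OF \<zeta>]
    have "emeasure (borel_subspace (\<zeta>\<^sup>\<bottom>)) (Pair \<zeta> -` A) =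
        (\<integral>\<^sup>+x. ?d (\<zeta>, x) * indicator (Pair \<zeta> -` A) (x - closest_point \<zeta> x) \<partial>lborel)"
      unfolding borel_subspace_perp_eq_distr_projection[OF s(1)] s(2)
      by (subst emeasure_distr_density) auto
    also have "\<dots> = (\<integral>\<^sup>+x. ?d (\<zeta>, x) * indicator A (?t (\<zeta>, x)) \<partial>lborel)"
      by (intro nn_integral_cong) (auto simp: indicator_def)
    finally show "(\<integral>\<^sup>+x. ?d (\<zeta>, x) * indicator A (?t (\<zeta>, x)) \<partial>lborel) =
      emeasure (borel_subspace (\<zeta>\<^sup>\<bottom>)) (Pair \<zeta> -` A)" ..
  qed
  finally show "emeasure (borel_affine_grassmann k \<mu>) A =
    (\<integral>\<^sup>+\<zeta>. emeasure (borel_subspace (\<zeta>\<^sup>\<bottom>)) (Pair \<zeta> -` A) \<partial>\<mu>)" .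
qed

lemma borel_affine_grassmann_eq_measure_of:
  "measure_of (affine_grassmannian k)
       (sets (restrict_space (grassmann_algebra k \<Otimes>\<^sub>M borel) (affine_grassmannian k)))
       (\<lambda>A. \<integral>\<^sup>+\<zeta>. emeasure (lebesgue_subspace (\<zeta>\<^sup>\<bottom>)) (Pair \<zeta> -` A) \<partial>\<mu>) =
   borel_affine_grassmann k \<mu>"
proof -
  let ?M = "borel_affine_grassmann k \<mu>"
  have "measure_of (space ?M) (sets ?M) (\<lambda>A. \<integral>\<^sup>+\<zeta>. emeasure (lebesgue_subspace (\<zeta>\<^sup>\<bottom>)) (Pair \<zeta> -` A) \<partial>\<mu>) =
      measure_of (space ?M) (sets ?M) (emeasure ?M)"
  proof (rule measure_of_eq[OF sets.space_closed])
    fix A assume "A \<in> sigma_sets (space ?M) (sets ?M)"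
    then have A: "A \<in> sets (affine_grassmann_algebra k)"
      by (metis sets.sigma_sets_eq sets_borel_affine_grassmann)
    show "(\<integral>\<^sup>+\<zeta>. emeasure (lebesgue_subspace (\<zeta>\<^sup>\<bottom>)) (Pair \<zeta> -` A) \<partial>\<mu>) = emeasure ?M A"
      unfolding emeasure_borel_affine_grassmann(1)[OF A]
      by (intro nn_integral_cong)
        (simp add: lebesgue_subspace_eq_completion emeasure_borel_affine_grassmann(2)[OF A])
  qed
  also have "\<dots> = ?M" by (rule measure_of_of_measure)
  finally show ?thesis by (simp add: affine_grassmann_algebra_def)
qed

text \<open>Densities that turn Lebesgue measure into the measure on the complement (\<open>slab\<close>) and on
  the subspace itself (\<open>tube\<close>) after projection.\<close>

definition slab :: "(real ^ 'n) set \<Rightarrow> (real ^ 'n) \<Rightarrow> real" where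
  "slab \<zeta> x = indicator {..1} (norm (closest_point \<zeta> x)) / unit_ball_vol (real k)"

definition tube :: "(real ^ 'n) set \<Rightarrow> (real ^ 'n) \<Rightarrow> real" where
  "tube \<zeta> x = indicator {..1} (norm (x - closest_point \<zeta> x)) / unit_ball_vol (real (CARD('n) - k))"

lemma slab_nonneg [simp]: "0 \<le> slab \<zeta> x" and tube_nonneg [simp]: "0 \<le> tube \<zeta> x"
  by (simp_all add: slab_def tube_def)

lemma measurable_triple_projections [measurable]:
  "(\<lambda>q. closest_point (fst (fst q)) (snd q)) \<in>
     borel_measurable ((\<mu> \<Otimes>\<^sub>M lborel) \<Otimes>\<^sub>M (lborel :: (real ^ 'n) measure))"
  "(\<lambda>q. closest_point (fst (fst q)) (snd (fst q))) \<in>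
     borel_measurable ((\<mu> \<Otimes>\<^sub>M lborel) \<Otimes>\<^sub>M (lborel :: (real ^ 'n) measure))"
proof -
  show "(\<lambda>q. closest_point (fst (fst q)) (snd q)) \<in>
     borel_measurable ((\<mu> \<Otimes>\<^sub>M lborel) \<Otimes>\<^sub>M (lborel :: (real ^ 'n) measure))"
    by (rule measurable_compose[OF _ measurable_pair_projection(1),
        of "\<lambda>q. (fst (fst q), snd q)", simplified]) measurable
  show "(\<lambda>q. closest_point (fst (fst q)) (snd (fst q))) \<in>
     borel_measurable ((\<mu> \<Otimes>\<^sub>M lborel) \<Otimes>\<^sub>M (lborel :: (real ^ 'n) measure))"
    by (rule measurable_compose[OF _ measurable_pair_projection(1), of "\<lambda>q. fst q", simplified]) measurable
qed

lemma measurable_slab [measurable]: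
    "(\<lambda>p. slab (fst p) (snd p)) \<in> borel_measurable (\<mu> \<Otimes>\<^sub>M (lborel :: (real ^ 'n) measure))"
    "(\<lambda>q. slab (fst (fst q)) (snd (fst q))) \<in> borel_measurable ((\<mu> \<Otimes>\<^sub>M lborel) \<Otimes>\<^sub>M (lborel :: (real ^ 'n) measure))"
  and measurable_tube [measurable]:
    "(\<lambda>q. tube (fst (fst q)) (snd q)) \<in> borel_measurable ((\<mu> \<Otimes>\<^sub>M lborel) \<Otimes>\<^sub>M (lborel :: (real ^ 'n) measure))"
  unfolding slab_def tube_def by measurable

text \<open>For a direction, a point of the slab and a point of the tube: the point whose two
  orthogonal components are the projections of the given ones.\<close>

definition split_point :: "((real ^ 'n) set \<times> (real ^ 'n)) \<times> (real ^ 'n) \<Rightarrow> (real ^ 'n) set \<times> (real ^ 'n)" where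
  "split_point = (\<lambda>q. (fst (fst q),
     closest_point (fst (fst q)) (snd q) + (snd (fst q) - closest_point (fst (fst q)) (snd (fst q)))))"

lemma measurable_split_point [measurable]:
  "split_point \<in> (\<mu> \<Otimes>\<^sub>M lborel) \<Otimes>\<^sub>M lborel \<rightarrow>\<^sub>M \<mu> \<Otimes>\<^sub>M lborel"
proof -
  have "(\<lambda>q. closest_point (fst (fst q)) (snd q) + (snd (fst q) - closest_point (fst (fst q)) (snd (fst q))))
    \<in> borel_measurable ((\<mu> \<Otimes>\<^sub>M lborel) \<Otimes>\<^sub>M (lborel :: (real ^ 'n) measure))"
    by measurable
  then show ?thesis
    unfolding split_point_def by (intro measurable_Pair) simp_all
qed

lemma nn_integral_tube:
  assumes \<zeta>: "\<zeta> \<in> grassmannian k" and [measurable]: "g \<in> borel_measurable borel"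
  shows "(\<integral>\<^sup>+y. ennreal (tube \<zeta> y) * g (closest_point \<zeta> y) \<partial>lborel) = (\<integral>\<^sup>+y. g y \<partial>borel_subspace \<zeta>)"
proof -
  note s = grassmannianD[OF \<zeta>]
  note [measurable] = measurable_closest_point_subspace[OF s(1)]
  have d: "dim (\<zeta>\<^sup>\<bottom>) = CARD('n) - k" using dim_orthogonal_comp_add[OF s(1)] s(2) by simp
  show ?thesis
    unfolding borel_subspace_eq_distr_projection[OF s(1)] d
    by (subst nn_integral_distr, simp, simp, subst nn_integral_density) (simp_all add: tube_def)
qed

lemma nn_integral_slab:
  assumes \<zeta>: "\<zeta> \<in> grassmannian k" and [measurable]: "g \<in> borel_measurable borel"
  shows "(\<integral>\<^sup>+x. ennreal (slab \<zeta> x) * g (x - closest_point \<zeta> x) \<partial>lborel) = (\<integral>\<^sup>+z. g z \<partial>borel_subspace (\<zeta>\<^sup>\<bottom>))"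
proof -
  note s = grassmannianD[OF \<zeta>]
  note [measurable] = measurable_closest_point_subspace[OF s(1)]
  show ?thesis
    unfolding borel_subspace_perp_eq_distr_projection[OF s(1)] s(2)
    by (subst nn_integral_distr, simp, simp, subst nn_integral_density) (simp_all add: slab_def)
qed

lemma integral_tube:
  fixes g :: "real ^ 'n \<Rightarrow> 'b :: {banach, second_countable_topology}"
  assumes \<zeta>: "\<zeta> \<in> grassmannian k" and [measurable]: "g \<in> borel_measurable borel"
  shows "(\<integral>y. tube \<zeta> y *\<^sub>R g (closest_point \<zeta> y) \<partial>lborel) = (\<integral>y. g y \<partial>borel_subspace \<zeta>)"
proof -
  note s = grassmannianD[OF \<zeta>]
  note [measurable] = measurable_closest_point_subspace[OF s(1)]
  have d: "dim (\<zeta>\<^sup>\<bottom>) = CARD('n) - k" using dim_orthogonal_comp_add[OF s(1)] s(2) by simp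
  show ?thesis
    unfolding borel_subspace_eq_distr_projection[OF s(1)] d
    by (subst integral_distr, simp, simp, subst integral_density) (simp_all add: tube_def)
qed

text \<open>This is the decomposition of Lebesgue measure along a subspace, written as an identity of
  image measures that holds jointly with the direction. In this form the Bochner version of
  Fubini for product measures applies to it directly.\<close>

lemma distr_split_point:
  "distr (density ((\<mu> \<Otimes>\<^sub>M lborel) \<Otimes>\<^sub>M lborel)
      (\<lambda>q. ennreal (slab (fst (fst q)) (snd (fst q)) * tube (fst (fst q)) (snd q))))
    (\<mu> \<Otimes>\<^sub>M lborel) split_point = \<mu> \<Otimes>\<^sub>M (lborel :: (real ^ 'n) measure)" (is "?D = _")
proof (rule measure_eqI)
  fix A assume "A \<in> sets ?D"
  then have A[measurable]: "A \<in> sets (\<mu> \<Otimes>\<^sub>M lborel)" by simp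
  interpret Q: pair_sigma_finite "\<mu> \<Otimes>\<^sub>M (lborel :: (real ^ 'n) measure)" "lborel :: (real ^ 'n) measure" ..
  let ?F = "\<lambda>q. ennreal (slab (fst (fst q)) (snd (fst q)) * tube (fst (fst q)) (snd q)) * indicator A (split_point q)"
  have "emeasure ?D A = (\<integral>\<^sup>+q. ?F q \<partial>((\<mu> \<Otimes>\<^sub>M lborel) \<Otimes>\<^sub>M lborel))"
    by (rule emeasure_distr_density) measurable
  also have "\<dots> = (\<integral>\<^sup>+p. (\<integral>\<^sup>+y. ?F (p, y) \<partial>lborel) \<partial>(\<mu> \<Otimes>\<^sub>M lborel))"
    by (rule lborel.nn_integral_fst[symmetric]) measurable
  also have "\<dots> = (\<integral>\<^sup>+\<zeta>. (\<integral>\<^sup>+x. (\<integral>\<^sup>+y. ?F ((\<zeta>, x), y) \<partial>lborel) \<partial>lborel) \<partial>\<mu>)"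
    by (rule lborel.nn_integral_fst[symmetric]) measurable
  also have "\<dots> = (\<integral>\<^sup>+\<zeta>. (\<integral>\<^sup>+x. indicator A (\<zeta>, x) \<partial>lborel) \<partial>\<mu>)"
  proof (rule nn_integral_cong)
    fix \<zeta> assume "\<zeta> \<in> space \<mu>"
    then have \<zeta>: "\<zeta> \<in> grassmannian k" by simp
    note s = grassmannianD[OF \<zeta>]
    interpret S: sigma_finite_measure "borel_subspace \<zeta>" by (rule sigma_finite_borel_subspace[OF s(1)])
    have [measurable]: "(\<lambda>x. indicator A (\<zeta>, x) :: ennreal) \<in> borel_measurable borel"
      using measurable_Pair1'[of \<zeta> \<mu> "lborel :: (real ^ 'n) measure"] \<zeta>
        borel_measurable_indicator[OF A] by (simp add: measurable_compose)
    have "(\<integral>\<^sup>+x. (\<integral>\<^sup>+y. ?F ((\<zeta>, x), y) \<partial>lborel) \<partial>lborel) =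
      (\<integral>\<^sup>+x. ennreal (slab \<zeta> x) * (\<integral>\<^sup>+y. indicator A (\<zeta>, y + (x - closest_point \<zeta> x)) \<partial>borel_subspace \<zeta>) \<partial>lborel)"
    proof (rule nn_integral_cong)
      fix x
      have [measurable]: "closest_point \<zeta> \<in> borel_measurable borel"
        by (rule measurable_closest_point_subspace[OF s(1)])
      have "(\<integral>\<^sup>+y. ?F ((\<zeta>, x), y) \<partial>lborel) = (\<integral>\<^sup>+y. ennreal (slab \<zeta> x) *
          (ennreal (tube \<zeta> y) * indicator A (\<zeta>, closest_point \<zeta> y + (x - closest_point \<zeta> x))) \<partial>lborel)"
        by (simp add: ennreal_mult mult.assoc split_point_def)
      also have "\<dots> = ennreal (slab \<zeta> x) * (\<integral>\<^sup>+y. ennreal (tube \<zeta> y) *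
          indicator A (\<zeta>, closest_point \<zeta> y + (x - closest_point \<zeta> x)) \<partial>lborel)"
        by (rule nn_integral_cmult) (simp add: tube_def)
      also have "(\<integral>\<^sup>+y. ennreal (tube \<zeta> y) *
          indicator A (\<zeta>, closest_point \<zeta> y + (x - closest_point \<zeta> x)) \<partial>lborel) =
          (\<integral>\<^sup>+y. indicator A (\<zeta>, y + (x - closest_point \<zeta> x)) \<partial>borel_subspace \<zeta>)"
        by (rule nn_integral_tube[OF \<zeta>]) measurable
      finally show "(\<integral>\<^sup>+y. ?F ((\<zeta>, x), y) \<partial>lborel) = ennreal (slab \<zeta> x) *
         (\<integral>\<^sup>+y. indicator A (\<zeta>, y + (x - closest_point \<zeta> x)) \<partial>borel_subspace \<zeta>)" .
    qed
    also have "\<dots> = (\<integral>\<^sup>+z. (\<integral>\<^sup>+y. indicator A (\<zeta>, y + z) \<partial>borel_subspace \<zeta>) \<partial>borel_subspace (\<zeta>\<^sup>\<bottom>))"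
      by (rule nn_integral_slab[OF \<zeta>]) measurable
    also have "\<dots> = (\<integral>\<^sup>+x. indicator A (\<zeta>, x) \<partial>lborel)"
      by (rule nn_integral_lborel_subspace_split(1)[OF s(1), symmetric]) measurable
    finally show "(\<integral>\<^sup>+x. (\<integral>\<^sup>+y. ?F ((\<zeta>, x), y) \<partial>lborel) \<partial>lborel) =
      (\<integral>\<^sup>+x. indicator A (\<zeta>, x) \<partial>lborel)" .
  qed
  also have "\<dots> = emeasure (\<mu> \<Otimes>\<^sub>M lborel) A"
    by (rule lborel.emeasure_pair_measure[symmetric]) measurable
  finally show "emeasure ?D A = emeasure (\<mu> \<Otimes>\<^sub>M lborel) A" .
qed simp

lemma measurable_AG_restrict:
  assumes "f \<in> \<mu> \<Otimes>\<^sub>M borel \<rightarrow>\<^sub>M N"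
  shows "f \<in> affine_grassmann_algebra k \<rightarrow>\<^sub>M N"
  unfolding affine_grassmann_algebra_def
  by (rule measurable_restrict_space1)
    (use assms in \<open>simp add: measurable_cong_sets[OF sets_pair_measure_cong[OF sets_\<mu> refl] refl]\<close>)

lemma borel_affine_grassmann_slab:
  "borel_affine_grassmann k \<mu> = distr (density (\<mu> \<Otimes>\<^sub>M lborel) (\<lambda>p. ennreal (slab (fst p) (snd p))))
     (affine_grassmann_algebra k) (\<lambda>p. (fst p, snd p - closest_point (fst p) (snd p)))"
  by (simp add: borel_affine_grassmann_def split_def slab_def)

lemma measurable_fibre_point [measurable]:
  "(\<lambda>q. (fst (fst q), closest_point (fst (fst q)) (snd q) + snd (fst q)))
     \<in> (\<mu> \<Otimes>\<^sub>M lborel) \<Otimes>\<^sub>M lborel \<rightarrow>\<^sub>M \<mu> \<Otimes>\<^sub>M (lborel :: (real ^ 'n) measure)"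
proof -
  have "(\<lambda>q. closest_point (fst (fst q)) (snd q) + snd (fst q))
    \<in> borel_measurable ((\<mu> \<Otimes>\<^sub>M lborel) \<Otimes>\<^sub>M (lborel :: (real ^ 'n) measure))"
    by measurable
  then show ?thesis by (intro measurable_Pair) simp_all
qed

lemma measurable_section:
  assumes "H \<in> \<mu> \<Otimes>\<^sub>M lborel \<rightarrow>\<^sub>M N" "\<zeta> \<in> grassmannian k"
  shows "(\<lambda>y :: real ^ 'n. H (\<zeta>, y)) \<in> borel \<rightarrow>\<^sub>M N"
  using measurable_compose[OF measurable_Pair1'[of \<zeta> \<mu> "lborel :: (real ^ 'n) measure"] assms(1)] assms(2)
  by simp

text \<open>Each point lies on exactly one plane in each direction, so integrating over all planes and
  along each plane amounts to integrating over all pairs of a direction and a point.\<close>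

lemma fibre_nn_integral:
  fixes H :: "(real ^ 'n) set \<times> (real ^ 'n) \<Rightarrow> ennreal"
  assumes [measurable]: "H \<in> borel_measurable (\<mu> \<Otimes>\<^sub>M lborel)"
  defines "G \<equiv> \<lambda>\<tau>. (\<integral>\<^sup>+y. H (fst \<tau>, y + snd \<tau>) \<partial>borel_subspace (fst \<tau>))"
  shows "G \<in> borel_measurable (affine_grassmann_algebra k)"
    and "(\<integral>\<^sup>+\<tau>. G \<tau> \<partial>borel_affine_grassmann k \<mu>) = (\<integral>\<^sup>+p. H p \<partial>(\<mu> \<Otimes>\<^sub>M lborel))"
proof -
  let ?Q = "(\<mu> \<Otimes>\<^sub>M lborel) \<Otimes>\<^sub>M (lborel :: (real ^ 'n) measure)"
  interpret Q: pair_sigma_finite "\<mu> \<Otimes>\<^sub>M (lborel :: (real ^ 'n) measure)" "lborel :: (real ^ 'n) measure" ..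
  let ?F = "\<lambda>q. ennreal (slab (fst (fst q)) (snd (fst q)) * tube (fst (fst q)) (snd q)) * H (split_point q)"
  let ?t = "\<lambda>p. (fst p, snd p - closest_point (fst p) (snd p))"
  have G: "(\<integral>\<^sup>+y. ?F (p, y) \<partial>lborel) = ennreal (slab (fst p) (snd p)) * G (?t p)"
    if "p \<in> space (\<mu> \<Otimes>\<^sub>M lborel)" for p
  proof -
    have \<zeta>: "fst p \<in> grassmannian k" using that by (auto simp: space_pair_measure)
    note [measurable] = measurable_section[OF assms(1) \<zeta>]
      measurable_closest_point_subspace[OF grassmannianD(1)[OF \<zeta>]]
    have "(\<integral>\<^sup>+y. ?F (p, y) \<partial>lborel) = (\<integral>\<^sup>+y. ennreal (slab (fst p) (snd p)) * (ennreal (tube (fst p) y) *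
        H (fst p, closest_point (fst p) y + (snd p - closest_point (fst p) (snd p)))) \<partial>lborel)"
      by (simp add: split_point_def ennreal_mult mult.assoc)
    also have "\<dots> = ennreal (slab (fst p) (snd p)) * (\<integral>\<^sup>+y. ennreal (tube (fst p) y) *
        H (fst p, closest_point (fst p) y + (snd p - closest_point (fst p) (snd p))) \<partial>lborel)"
      by (rule nn_integral_cmult) (simp add: tube_def)
    also have "\<dots> = ennreal (slab (fst p) (snd p)) * G (?t p)"
      unfolding G_def fst_conv snd_conv by (subst nn_integral_tube[OF \<zeta>]) simp_all
    finally show ?thesis .
  qed
  show G_meas: "G \<in> borel_measurable (affine_grassmann_algebra k)"
  proof -
    have "(\<lambda>p. \<integral>\<^sup>+y. ennreal (tube (fst p) y) * H (fst p, closest_point (fst p) y + snd p) \<partial>lborel)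
        \<in> borel_measurable (\<mu> \<Otimes>\<^sub>M lborel)"
      by (rule lborel.borel_measurable_nn_integral) (simp add: split_def)
    then have "(\<lambda>p. \<integral>\<^sup>+y. ennreal (tube (fst p) y) * H (fst p, closest_point (fst p) y + snd p) \<partial>lborel)
        \<in> borel_measurable (affine_grassmann_algebra k)"
      by (intro measurable_AG_restrict) (simp add: measurable_cong_sets[OF sets_pair_measure_cong[OF refl sets_lborel] refl])
    also have "?this \<longleftrightarrow> ?thesis"
    proof (rule measurable_cong)
      fix p :: "(real ^ 'n) set \<times> (real ^ 'n)" assume "p \<in> space (affine_grassmann_algebra k)"
      then have \<zeta>: "fst p \<in> grassmannian k" by (auto simp: affine_grassmannian_def)
      note [measurable] = measurable_section[OF assms(1) \<zeta>]
      show "(\<integral>\<^sup>+y. ennreal (tube (fst p) y) * H (fst p, closest_point (fst p) y + snd p) \<partial>lborel) = G p"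
        unfolding G_def by (subst nn_integral_tube[OF \<zeta>]) simp_all
    qed
    finally show ?thesis .
  qed
  note [measurable] = G_meas
  have "(\<integral>\<^sup>+\<tau>. G \<tau> \<partial>borel_affine_grassmann k \<mu>) =
      (\<integral>\<^sup>+p. ennreal (slab (fst p) (snd p)) * G (?t p) \<partial>(\<mu> \<Otimes>\<^sub>M lborel))"
    unfolding borel_affine_grassmann_slab
    by (subst nn_integral_distr, simp, simp, subst nn_integral_density) simp_all
  also have "\<dots> = (\<integral>\<^sup>+p. (\<integral>\<^sup>+y. ?F (p, y) \<partial>lborel) \<partial>(\<mu> \<Otimes>\<^sub>M lborel))"
    by (intro nn_integral_cong G[symmetric])
  also have "\<dots> = (\<integral>\<^sup>+q. ?F q \<partial>?Q)"
    by (rule lborel.nn_integral_fst) measurable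
  also have "\<dots> = (\<integral>\<^sup>+p. H p \<partial>distr (density ?Q (\<lambda>q. ennreal (slab (fst (fst q)) (snd (fst q)) * tube (fst (fst q)) (snd q))))
      (\<mu> \<Otimes>\<^sub>M lborel) split_point)"
    by (subst nn_integral_distr, simp, simp, subst nn_integral_density) simp_all
  also have "\<dots> = (\<integral>\<^sup>+p. H p \<partial>(\<mu> \<Otimes>\<^sub>M lborel))" by (simp only: distr_split_point)
  finally show "(\<integral>\<^sup>+\<tau>. G \<tau> \<partial>borel_affine_grassmann k \<mu>) = (\<integral>\<^sup>+p. H p \<partial>(\<mu> \<Otimes>\<^sub>M lborel))" .
qed

text \<open>This is what makes the plane transform of a class of functions that agree almost
  everywhere well defined.\<close>

lemma AE_affine_grassmann_null_fibre:
  assumes N: "N \<in> null_sets lborel"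
  shows "AE \<tau> in borel_affine_grassmann k \<mu>. AE y in borel_subspace (fst \<tau>). y + snd \<tau> \<notin> N"
proof -
  have [measurable]: "N \<in> sets borel" using N by auto
  let ?H = "\<lambda>p. indicator N (snd p) :: ennreal"
  let ?G = "\<lambda>\<tau>. \<integral>\<^sup>+y. ?H (fst \<tau>, y + snd \<tau>) \<partial>borel_subspace (fst \<tau>)"
  have H: "?H \<in> borel_measurable (\<mu> \<Otimes>\<^sub>M lborel)" by measurable
  have "(\<integral>\<^sup>+\<tau>. ?G \<tau> \<partial>borel_affine_grassmann k \<mu>) = (\<integral>\<^sup>+p. ?H p \<partial>(\<mu> \<Otimes>\<^sub>M lborel))"
    by (rule fibre_nn_integral(2)[OF H])
  also have "\<dots> = (\<integral>\<^sup>+\<zeta>. (\<integral>\<^sup>+x. ?H (\<zeta>, x) \<partial>lborel) \<partial>\<mu>)"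
    by (rule lborel.nn_integral_fst[OF H, symmetric])
  also have "\<dots> = 0" using N by (simp add: null_setsD1)
  finally have "(\<integral>\<^sup>+\<tau>. ?G \<tau> \<partial>borel_affine_grassmann k \<mu>) = 0" .
  then have ae: "AE \<tau> in borel_affine_grassmann k \<mu>. ?G \<tau> = 0"
    using fibre_nn_integral(1)[OF H] by (subst (asm) nn_integral_0_iff_AE) simp_all
  show ?thesis
  proof (rule AE_mp[OF ae], rule AE_I2, rule impI)
    fix \<tau> :: "(real ^ 'n) set \<times> (real ^ 'n)" assume "?G \<tau> = 0"
    then have "AE y in borel_subspace (fst \<tau>). ?H (fst \<tau>, y + snd \<tau>) = 0"
      by (subst (asm) nn_integral_0_iff_AE) simp_all
    then show "AE y in borel_subspace (fst \<tau>). y + snd \<tau> \<notin> N"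
      by eventually_elim (auto simp: indicator_def)
  qed
qed

text \<open>The analogue of \<open>fibre_nn_integral\<close> for vector valued functions. The integrability of the
  inner integral with respect to the affine planes is part of the assertion.\<close>

lemma fibre_integral:
  fixes H :: "(real ^ 'n) set \<times> (real ^ 'n) \<Rightarrow> 'b :: {banach, second_countable_topology}"
  assumes H: "integrable (\<mu> \<Otimes>\<^sub>M lborel) H"
  defines "G \<equiv> \<lambda>\<tau>. (\<integral>y. H (fst \<tau>, y + snd \<tau>) \<partial>borel_subspace (fst \<tau>))"
  shows "integrable (borel_affine_grassmann k \<mu>) G"
    and "(\<integral>\<tau>. G \<tau> \<partial>borel_affine_grassmann k \<mu>) = (\<integral>p. H p \<partial>(\<mu> \<Otimes>\<^sub>M lborel))"
proof -
  let ?Q = "(\<mu> \<Otimes>\<^sub>M lborel) \<Otimes>\<^sub>M (lborel :: (real ^ 'n) measure)"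
  have [measurable]: "H \<in> borel_measurable (\<mu> \<Otimes>\<^sub>M lborel)" using H by simp
  interpret Q: pair_sigma_finite "\<mu> \<Otimes>\<^sub>M (lborel :: (real ^ 'n) measure)" "lborel :: (real ^ 'n) measure" ..
  let ?d = "\<lambda>q. slab (fst (fst q)) (snd (fst q)) * tube (fst (fst q)) (snd q)"
  let ?F = "\<lambda>q. ?d q *\<^sub>R H (split_point q)"
  let ?D = "distr (density ?Q (\<lambda>q. ennreal (?d q))) (\<mu> \<Otimes>\<^sub>M lborel) split_point"
  have "integrable ?D H" using H by (simp only: distr_split_point)
  then have I: "integrable ?Q ?F"
    by (subst (asm) integrable_distr_eq, simp, simp, subst (asm) integrable_density) simp_all
  have "(\<integral>p. H p \<partial>(\<mu> \<Otimes>\<^sub>M lborel)) = (\<integral>p. H p \<partial>?D)" by (simp only: distr_split_point)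
  also have "\<dots> = (\<integral>q. ?F q \<partial>?Q)"
    by (subst integral_distr, simp, simp, subst integral_density) simp_all
  finally have E: "(\<integral>p. H p \<partial>(\<mu> \<Otimes>\<^sub>M lborel)) = (\<integral>q. ?F q \<partial>?Q)" .
  let ?t = "\<lambda>p. (fst p, snd p - closest_point (fst p) (snd p))"
  have G: "(\<integral>y. ?F (p, y) \<partial>lborel) = slab (fst p) (snd p) *\<^sub>R G (?t p)" if "p \<in> space (\<mu> \<Otimes>\<^sub>M lborel)" for p
  proof -
    have \<zeta>: "fst p \<in> grassmannian k" using that by (auto simp: space_pair_measure)
    note [measurable] = measurable_section[OF borel_measurable_integrable[OF H] \<zeta>]
    have "(\<integral>y. ?F (p, y) \<partial>lborel) = slab (fst p) (snd p) *\<^sub>R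
      (\<integral>y. tube (fst p) y *\<^sub>R H (fst p, closest_point (fst p) y + (snd p - closest_point (fst p) (snd p))) \<partial>lborel)"
      by (simp add: split_point_def integral_scaleR_right[symmetric] del: integral_scaleR_right)
    also have "\<dots> = slab (fst p) (snd p) *\<^sub>R G (?t p)"
      unfolding G_def fst_conv snd_conv by (subst integral_tube[OF \<zeta>]) simp_all
    finally show ?thesis .
  qed
  have G_meas: "G \<in> borel_measurable (affine_grassmann_algebra k)"
  proof -
    have "(\<lambda>p. \<integral>y. tube (fst p) y *\<^sub>R H (fst p, closest_point (fst p) y + snd p) \<partial>lborel)
        \<in> borel_measurable (\<mu> \<Otimes>\<^sub>M lborel)"
      by (rule lborel.borel_measurable_lebesgue_integral) (simp add: split_def)
    then have "(\<lambda>p. \<integral>y. tube (fst p) y *\<^sub>R H (fst p, closest_point (fst p) y + snd p) \<partial>lborel)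
        \<in> borel_measurable (affine_grassmann_algebra k)"
      by (intro measurable_AG_restrict) (simp add: measurable_cong_sets[OF sets_pair_measure_cong[OF refl sets_lborel] refl])
    also have "?this \<longleftrightarrow> ?thesis"
    proof (rule measurable_cong)
      fix p :: "(real ^ 'n) set \<times> (real ^ 'n)" assume "p \<in> space (affine_grassmann_algebra k)"
      then have \<zeta>: "fst p \<in> grassmannian k" by (auto simp: affine_grassmannian_def)
      note [measurable] = measurable_section[OF borel_measurable_integrable[OF H] \<zeta>]
      show "(\<integral>y. tube (fst p) y *\<^sub>R H (fst p, closest_point (fst p) y + snd p) \<partial>lborel) = G p"
        unfolding G_def by (subst integral_tube[OF \<zeta>]) simp_all
    qed
    finally show ?thesis .
  qed
  note [measurable] = G_meas
  have I1: "integrable (\<mu> \<Otimes>\<^sub>M lborel) (\<lambda>p. \<integral>y. ?F (p, y) \<partial>lborel)"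
    using Q.integrable_fst'[OF I] by simp
  also have "?this \<longleftrightarrow> integrable (\<mu> \<Otimes>\<^sub>M lborel) (\<lambda>p. slab (fst p) (snd p) *\<^sub>R G (?t p))"
    by (intro Bochner_Integration.integrable_cong refl G)
  also have "\<dots> \<longleftrightarrow> integrable (borel_affine_grassmann k \<mu>) G"
    unfolding borel_affine_grassmann_slab
    by (subst integrable_distr_eq, simp, simp, subst integrable_density) simp_all
  finally show "integrable (borel_affine_grassmann k \<mu>) G" .
  have "(\<integral>\<tau>. G \<tau> \<partial>borel_affine_grassmann k \<mu>) = (\<integral>p. slab (fst p) (snd p) *\<^sub>R G (?t p) \<partial>(\<mu> \<Otimes>\<^sub>M lborel))"
    unfolding borel_affine_grassmann_slab
    by (subst integral_distr, simp, simp, subst integral_density) simp_all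
  also have "\<dots> = (\<integral>p. (\<integral>y. ?F (p, y) \<partial>lborel) \<partial>(\<mu> \<Otimes>\<^sub>M lborel))"
    by (intro Bochner_Integration.integral_cong refl G[symmetric])
  also have "\<dots> = (\<integral>q. ?F q \<partial>?Q)"
    using Q.integral_fst'[OF I] by simp
  finally show "(\<integral>\<tau>. G \<tau> \<partial>borel_affine_grassmann k \<mu>) = (\<integral>p. H p \<partial>(\<mu> \<Otimes>\<^sub>M lborel))"
    by (simp only: E)
qed

end

section \<open>Polar coordinates\<close>

text \<open>The measures agree on all half-lines ending at \<open>r\<close>, and these generate the Borel sets. The
  growth of the balls also forces \<open>N\<close> to be positive almost everywhere, by letting the radius
  tend to 0.\<close>

lemma distr_eq_power_density:
  fixes N :: "'a \<Rightarrow> real"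
  assumes [measurable]: "N \<in> borel_measurable M" and nonneg: "\<And>x. x \<in> space M \<Longrightarrow> 0 \<le> N x"
    and m: "0 < m" and c: "0 \<le> c"
    and vol: "\<And>r. 0 < r \<Longrightarrow> emeasure M {x \<in> space M. N x \<le> r} = ennreal (c * r ^ m)"
  shows "distr M borel N =
    density lborel (\<lambda>r. ennreal (real m * c * r ^ (m - 1) * indicator {0<..} r))"
proof (rule measure_eqI_generator_eq[where E = "range atMost" and \<Omega> = UNIV and A = "\<lambda>i::nat. {..real i}"])
  let ?d = "\<lambda>r. ennreal (real m * c * r ^ (m - 1) * indicator {0<..} r)"
  have D: "emeasure (distr M borel N) {..r} = emeasure M {x \<in> space M. N x \<le> r}" for r
    by (subst emeasure_distr) (auto intro!: arg_cong[where f = "emeasure M"])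
  \<comment> \<open>The hypothesis on the volumes says nothing about radius 0.\<close>
  have zero: "emeasure M {x \<in> space M. N x \<le> 0} = 0"
  proof -
    have "emeasure M {x \<in> space M. N x \<le> 0} \<le> ennreal (c * (1 / real (Suc j)) ^ m)" for j :: nat
    proof -
      have "emeasure M {x \<in> space M. N x \<le> 0} \<le> emeasure M {x \<in> space M. N x \<le> 1 / real (Suc j)}"
        by (rule emeasure_mono) (auto intro: order_trans simp del: of_nat_Suc)
      also have "\<dots> = ennreal (c * (1 / real (Suc j)) ^ m)" by (rule vol) simp
      finally show ?thesis .
    qed
    moreover have "(\<lambda>j. ennreal (c * (1 / real (Suc j)) ^ m)) \<longlonglongrightarrow> ennreal (c * 0 ^ m)"
      by (intro tendsto_ennrealI tendsto_mult tendsto_const tendsto_power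
          filterlim_compose[OF lim_1_over_n filterlim_Suc])
    ultimately have "emeasure M {x \<in> space M. N x \<le> 0} \<le> ennreal (c * 0 ^ m)"
      by (intro LIMSEQ_le_const) auto
    moreover have "c * 0 ^ m = 0" using m by (simp add: zero_power)
    ultimately show ?thesis by (metis ennreal_0 le_zero_eq)
  qed
  have E: "emeasure (distr M borel N) {..r} = (if 0 < r then ennreal (c * r ^ m) else 0)" for r
  proof (cases "0 < r")
    case False
    then have "emeasure M {x \<in> space M. N x \<le> r} \<le> emeasure M {x \<in> space M. N x \<le> 0}"
      by (intro emeasure_mono) auto
    then show ?thesis using False by (simp add: D zero)
  qed (simp add: D vol)
  have F: "emeasure (density lborel ?d) {..r} = (if 0 < r then ennreal (c * r ^ m) else 0)" for r
  proof (cases "0 < r")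
    case True
    have "emeasure (density lborel ?d) {..r} =
        (\<integral>\<^sup>+x. ennreal (real m * c * x ^ (m - 1)) * indicator {0..r} x \<partial>lborel)"
      by (subst emeasure_density, simp, simp, intro nn_integral_cong_AE AE_I[where N = "{0}"])
        (auto simp: indicator_def)
    also have "\<dots> = ennreal (c * r ^ m - c * 0 ^ m)"
    proof (rule nn_integral_FTC_Icc[where F = "\<lambda>x. c * x ^ m"])
      show "((\<lambda>x. c * x ^ m) has_real_derivative real m * c * x ^ (m - 1)) (at x)"
        if "x \<in> {0..r}" for x
        by (auto intro!: derivative_eq_intros)
    qed (use True c in auto)
    finally show ?thesis using True by (simp add: zero_power[OF m])
  next
    case False
    have "emeasure (density lborel ?d) {..r} = (\<integral>\<^sup>+x. 0 \<partial>(lborel :: real measure))"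
      using False by (subst emeasure_density, simp, simp, intro nn_integral_cong) (auto simp: indicator_def)
    then show ?thesis using False by simp
  qed
  show "emeasure (distr M borel N) X = emeasure (density lborel ?d) X" if "X \<in> range atMost" for X
    using that by (elim rangeE) (simp only: E F)
  show "emeasure (distr M borel N) {..real i} \<noteq> \<infinity>" for i by (simp add: E)
  show "sets (distr M borel N) = sigma_sets UNIV (range atMost)"
    "sets (density lborel ?d) = sigma_sets UNIV (range atMost)"
    by (simp_all add: borel_eq_atMost)
  show "Int_stable (range (atMost :: real \<Rightarrow> real set))" by (auto simp: Int_stable_def)
  show "(\<Union>i. {..real i}) = UNIV" using real_arch_simple by auto
qed auto

lemma distr_norm_lborel:
  "distr (lborel :: (real ^ 'n) measure) borel norm =
    density lborel (\<lambda>r. ennreal (real CARD('n) * unit_ball_vol (real CARD('n)) * r ^ (CARD('n) - 1) * indicator {0<..} r))"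
proof (rule distr_eq_power_density)
  fix r :: real assume r: "0 < r"
  have "{x \<in> space lborel. norm x \<le> r} = cball (0 :: real ^ 'n) r" by auto
  then show "emeasure (lborel :: (real ^ 'n) measure) {x \<in> space lborel. norm x \<le> r} =
      ennreal (unit_ball_vol (real CARD('n)) * r ^ CARD('n))"
    using emeasure_cball[of r "0 :: real ^ 'n"] r by simp
qed auto

lemma distr_norm_borel_subspace:
  fixes V :: "(real ^ 'n) set"
  assumes V: "subspace V" and d: "0 < dim V"
  shows "distr (borel_subspace V) borel norm =
    density lborel (\<lambda>r. ennreal (real (dim V) * unit_ball_vol (real (dim V)) * r ^ (dim V - 1) * indicator {0<..} r))"
proof (rule distr_eq_power_density)
  fix r :: real assume r: "0 < r"
  have "{x \<in> space (borel_subspace V). norm x \<le> r} = cball 0 r" by auto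
  then show "emeasure (borel_subspace V) {x \<in> space (borel_subspace V). norm x \<le> r} =
      ennreal (unit_ball_vol (real (dim V)) * r ^ dim V)"
    using emeasure_borel_subspace_cball[OF V r] by simp
qed (use d in auto)

text \<open>The radius of \<open>(y, z)\<close> with \<open>|y| = t\<close> and \<open>|z| = s\<close> is \<open>sqrt (t\<^sup>2 + s\<^sup>2)\<close>. This change of
  variable produces the Abel kernel. The new variable is \<open>t\<close>, since the inverse map has a
  singular derivative at \<open>r = s\<close>; unbounded intervals are exhausted by bounded ones.\<close>

lemma nn_integral_hypotenuse_substitution:
  fixes g :: "real \<Rightarrow> ennreal"
  assumes [measurable]: "g \<in> borel_measurable borel" and s: "0 < s" and k: "0 < k"
  shows "(\<integral>\<^sup>+t. ennreal (t ^ (k - 1) * indicator {0<..} t) * g (sqrt (t\<^sup>2 + s\<^sup>2)) \<partial>lborel) =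
    (\<integral>\<^sup>+r. ennreal ((r\<^sup>2 - s\<^sup>2) powr (real k / 2 - 1) * r * indicator {s<..} r) * g r \<partial>lborel)"
proof -
  let ?G = "\<lambda>t. sqrt (t\<^sup>2 + s\<^sup>2)"
  let ?f = "\<lambda>r. ennreal ((r\<^sup>2 - s\<^sup>2) powr (real k / 2 - 1) * r * indicator {s<..} r) * g r"
  let ?h = "\<lambda>t. ennreal (t ^ (k - 1) * indicator {0<..} t) * g (?G t)"
  have pos: "0 < t\<^sup>2 + s\<^sup>2" for t using s by (simp add: add_nonneg_pos)
  have part: "(\<integral>\<^sup>+r. ?f r * indicator {..?G (real (Suc i))} r \<partial>lborel) =
      (\<integral>\<^sup>+t. ?h t * indicator {..real (Suc i)} t \<partial>lborel)" for i
  proof -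
    have "(\<integral>\<^sup>+r. ?f r * indicator {..?G (real (Suc i))} r \<partial>lborel) =
        (\<integral>\<^sup>+r. ?f r * indicator {?G 0..?G (real (Suc i))} r \<partial>lborel)"
      using s by (intro nn_integral_cong) (auto simp: indicator_def)
    also have "\<dots> = (\<integral>\<^sup>+t. ?f (?G t) * ennreal (t / ?G t) * indicator {0..real (Suc i)} t \<partial>lborel)"
    proof (rule nn_integral_substitution_aux)
      show "(?G has_real_derivative t / ?G t) (at t)" if "t \<in> {0..real (Suc i)}" for t
        using pos[of t] by (auto intro!: derivative_eq_intros simp: field_simps)
      show "continuous_on {0..real (Suc i)} (\<lambda>t. t / ?G t)"
        using pos by (intro continuous_intros) (auto simp: less_imp_neq[symmetric])
    qed (auto simp del: of_nat_Suc)
    also have "\<dots> = (\<integral>\<^sup>+t. ?h t * indicator {..real (Suc i)} t \<partial>lborel)"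
    proof (rule nn_integral_cong)
      fix t :: real
      show "?f (?G t) * ennreal (t / ?G t) * indicator {0..real (Suc i)} t = ?h t * indicator {..real (Suc i)} t"
      proof (cases "0 < t")
        case True
        have Gt: "s < ?G t" by (rule real_less_rsqrt) (use True in simp)
        then have G0: "0 < ?G t" using s by linarith
        have "(t\<^sup>2) powr (real k / 2 - 1) = t powr (2 * (real k / 2 - 1))"
          using True by (simp add: powr_powr flip: powr_numeral)
        also have "2 * (real k / 2 - 1) = real (k - 1) - 1" using k by (simp add: of_nat_diff)
        also have "t powr (real (k - 1) - 1) * t = t ^ (k - 1)"
          using True by (simp add: powr_diff powr_realpow)
        finally have P: "(t\<^sup>2) powr (real k / 2 - 1) * t = t ^ (k - 1)" by simp
        have "ennreal ((t\<^sup>2) powr (real k / 2 - 1) * ?G t) * ennreal (t / ?G t) = ennreal (t ^ (k - 1))"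
          using True G0 P by (subst ennreal_mult[symmetric]) auto
        then show ?thesis using True Gt pos[of t]
          by (simp add: less_imp_le indicator_def mult.assoc mult.commute[of "g _"])
            (simp add: mult.assoc[symmetric])
      next
        case False
        then show ?thesis by (cases "t = 0") (auto simp: indicator_def)
      qed
    qed
    finally show ?thesis .
  qed
  \<comment> \<open>Exhaustion of the line by the half-lines up to an unbounded increasing sequence.\<close>
  have lim: "(\<integral>\<^sup>+x. f x \<partial>lborel) = (SUP i. \<integral>\<^sup>+x. f x * indicator {..b i} x \<partial>lborel)"
    if [measurable]: "f \<in> borel_measurable borel" and b: "incseq b" "\<And>x. \<exists>i. x \<le> b i"
    for f :: "real \<Rightarrow> ennreal" and b :: "nat \<Rightarrow> real"
  proof -
    have "(SUP i. f x * indicator {..b i} x) = f x" for x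
    proof (rule antisym)
      show "(SUP i. f x * indicator {..b i} x) \<le> f x" by (rule SUP_least) (auto simp: indicator_def)
      obtain i where "x \<le> b i" using b by blast
      then have "f x = f x * indicator {..b i} x" by simp
      also have "\<dots> \<le> (SUP i. f x * indicator {..b i} x)" by (rule SUP_upper) simp
      finally show "f x \<le> (SUP i. f x * indicator {..b i} x)" .
    qed
    then have "(\<integral>\<^sup>+x. f x \<partial>lborel) = (\<integral>\<^sup>+x. (SUP i. f x * indicator {..b i} x) \<partial>lborel)" by simp
    also have "\<dots> = (SUP i. \<integral>\<^sup>+x. f x * indicator {..b i} x \<partial>lborel)"
      using b(1) by (intro nn_integral_monotone_convergence_SUP)
        (auto simp: incseq_def le_fun_def indicator_def intro: order_trans)
    finally show ?thesis .
  qed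
  have "(\<integral>\<^sup>+t. ?h t \<partial>lborel) = (SUP i. \<integral>\<^sup>+t. ?h t * indicator {..real (Suc i)} t \<partial>lborel)"
  proof (rule lim)
    show "\<exists>i. x \<le> real (Suc i)" for x
      using real_arch_simple[of x] by (metis le_SucI of_nat_le_iff order_trans order_refl)
  qed (auto simp: incseq_def)
  also have "\<dots> = (SUP i. \<integral>\<^sup>+r. ?f r * indicator {..?G (real (Suc i))} r \<partial>lborel)"
    by (simp only: part)
  also have "\<dots> = (\<integral>\<^sup>+r. ?f r \<partial>lborel)"
  proof (rule lim[symmetric])
    show "\<exists>i. x \<le> ?G (real (Suc i))" for x
    proof -
      obtain i :: nat where "x \<le> real i" using real_arch_simple by blast
      moreover have "real i \<le> real (Suc i)" by simp
      moreover have "real (Suc i) \<le> ?G (real (Suc i))" by (rule real_le_rsqrt) (simp del: of_nat_Suc)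
      ultimately show ?thesis by (meson order_trans)
    qed
  qed (auto simp: incseq_def intro!: power_mono)
  finally show ?thesis .
qed

section \<open>Mean over the directions as an Abel integral\<close>

lemma unit_ball_vol_sphere_area: "1 \<le> d \<Longrightarrow> real d * unit_ball_vol (real d) = sphere_area (d - 1)"
proof -
  assume d: "1 \<le> d"
  then have G: "Gamma (real d / 2 + 1) = real d / 2 * Gamma (real d / 2)"
    by (intro Gamma_plus1) (auto elim!: nonpos_Ints_cases')
  have "real (d - 1) + 1 = real d" using d by simp
  then show ?thesis using d
    unfolding unit_ball_vol_def sphere_area_def G by simp
qed

lemma sphere_area_pos [simp]: "0 < sphere_area d"
  by (simp add: sphere_area_def)

lemma abel_const_pos [simp]: "0 < abel_const n k"
  by (simp add: abel_const_def)

lemma measurable_abel_weight: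
  "(\<lambda>p. ennreal (abel_kernel n k (fst p) (snd p) * indicator {0<..<fst p} (snd p)))
     \<in> borel_measurable (borel \<Otimes>\<^sub>M borel)"
proof -
  have ind: "(indicator {0<..<fst p} (snd p) :: real) = (if 0 < snd p \<and> snd p < fst p then 1 else 0)"
    for p :: "real \<times> real"
    by (auto simp: indicator_def)
  show ?thesis unfolding abel_kernel_def ind by measurable
qed

text \<open>The left side of the Abel equation for nonnegative \<open>v\<close>, where it may be infinite. Signed
  solutions are treated through their positive and negative parts.\<close>

definition nn_abel_operator :: "nat \<Rightarrow> nat \<Rightarrow> (real \<Rightarrow> ennreal) \<Rightarrow> real \<Rightarrow> ennreal" where
  "nn_abel_operator n k v r = ennreal (abel_const n k * r powr (2 - real n)) *
     (\<integral>\<^sup>+s. ennreal (abel_kernel n k r s * indicator {0<..<r} s) * v s \<partial>lborel)"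

lemma image_orthogonal_comp:
  fixes f :: "real ^ 'n \<Rightarrow> real ^ 'n"
  assumes f: "orthogonal_transformation f" and z: "z \<in> V\<^sup>\<bottom>"
  shows "f z \<in> (f ` V)\<^sup>\<bottom>"
  using z by (auto simp: orthogonal_comp_def orthogonal_def orthogonal_transformation_def[THEN iffD1, OF f, THEN conjunct2, rule_format])

lemma closest_point_orthogonal_image:
  fixes f :: "real ^ 'n \<Rightarrow> real ^ 'n"
  assumes V: "subspace V" and f: "orthogonal_transformation f"
  shows "closest_point (f ` V) (f y) = f (closest_point V y)"
proof -
  have lin: "linear f" using f by (rule orthogonal_transformation_linear)
  have "f y = f (closest_point V y) + f (y - closest_point V y)"
    using linear_add[OF lin, symmetric] by simp
  then show ?thesis
    using closest_point_subspace_add[OF linear_subspace_image[OF lin V], of "f (closest_point V y)" "f (y - closest_point V y)"]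
      closest_point_subspace[OF V, of y] image_orthogonal_comp[OF f] by simp
qed

locale invariant_grassmann = grassmann_prob \<mu> k for \<mu> :: "(real ^ 'n) set measure" and k +
  assumes invariant: "rotation_matrix Q \<Longrightarrow> distr \<mu> \<mu> (\<lambda>\<zeta>. (\<lambda>x. Q *v x) ` \<zeta>) = \<mu>"
begin

text \<open>Without measurability the image measure in the invariance hypothesis would carry no
  information.\<close>

lemma measurable_rotate:
  fixes Q :: "real ^ 'n ^ 'n"
  assumes Q: "orthogonal_matrix Q"
  shows "(\<lambda>\<zeta>. (\<lambda>x. Q *v x) ` \<zeta>) \<in> \<mu> \<rightarrow>\<^sub>M \<mu>"
proof -
  let ?Q = "\<lambda>x. Q *v x"
  have ot: "orthogonal_transformation ?Q"
    using Q by (simp add: orthogonal_transformation_matrix)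
  have QQ: "Q *v (transpose Q *v y) = y" for y
    using Q by (simp add: orthogonal_matrix_def matrix_vector_mul_assoc del: transpose_matrix_vector)
  have "(`) ?Q \<in> grassmann_algebra k \<rightarrow>\<^sub>M
    vimage_algebra (grassmannian k) (\<lambda>\<zeta>. matrix (closest_point \<zeta>) :: real ^ 'n ^ 'n) borel"
  proof (rule measurable_vimage_algebra2)
    show "(`) ?Q \<in> space (grassmann_algebra k) \<rightarrow> grassmannian k"
      using linear_subspace_image[OF orthogonal_transformation_linear[OF ot]]
        dim_image_eq[OF orthogonal_transformation_linear[OF ot]] orthogonal_transformation_inj[OF ot]
      by (auto simp: grassmannian_def inj_on_def)
    have "(\<lambda>\<zeta>. matrix (closest_point \<zeta>) :: real ^ 'n ^ 'n) \<in> borel_measurable (grassmann_algebra k)"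
      unfolding grassmann_algebra_def by (rule measurable_vimage_algebra1) simp
    moreover have "(\<lambda>P. Q ** P ** transpose Q) \<in> borel_measurable borel"
      by (intro borel_measurable_continuous_onI)
        (auto simp: matrix_matrix_mult_def intro!: continuous_intros)
    ultimately have "(\<lambda>\<zeta>. Q ** matrix (closest_point \<zeta>) ** transpose Q) \<in> borel_measurable (grassmann_algebra k)"
      by (rule measurable_compose)
    moreover have "matrix (closest_point (?Q ` \<zeta>)) = Q ** matrix (closest_point \<zeta>) ** transpose Q"
      if "\<zeta> \<in> space (grassmann_algebra k)" for \<zeta>
    proof -
      have V: "subspace \<zeta>" using that by (simp add: grassmannianD)
      have "closest_point (?Q ` \<zeta>) y = Q *v (closest_point \<zeta> (transpose Q *v y))" for y
        using closest_point_orthogonal_image[OF V ot, of "transpose Q *v y"] by (simp only: QQ)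
      then have "closest_point (?Q ` \<zeta>) = (\<lambda>y. Q *v y) \<circ> (closest_point \<zeta> \<circ> (\<lambda>y. transpose Q *v y))"
        by auto
      then show ?thesis
        using linear_closest_point[OF V]
        by (simp add: matrix_compose linear_compose matrix_mul_assoc matrix_vector_mul_linear
            del: transpose_matrix_vector)
    qed
    ultimately show "(\<lambda>\<zeta>. matrix (closest_point (?Q ` \<zeta>))) \<in> borel_measurable (grassmann_algebra k)"
      by (subst measurable_cong) auto
  qed
  then have "(`) ?Q \<in> grassmann_algebra k \<rightarrow>\<^sub>M grassmann_algebra k" by (simp add: grassmann_algebra_def)
  then show ?thesis by (simp add: measurable_cong_sets[OF sets_\<mu> sets_\<mu>])
qed

text \<open>The function \<open>\<Phi>\<close> of the introduction for nonnegative \<open>v\<close>: the norm is the distance of \<open>y\<close>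
  from \<open>\<zeta>\<close>.\<close>

definition mean_distance :: "(real \<Rightarrow> ennreal) \<Rightarrow> real ^ 'n \<Rightarrow> ennreal" where
  "mean_distance v y = (\<integral>\<^sup>+\<zeta>. v (norm (y - closest_point \<zeta> y)) \<partial>\<mu>)"

interpretation pair_sigma_finite \<mu> "lborel :: (real ^ 'n) measure" ..

lemma measurable_distance_pair:
  "v \<in> borel \<rightarrow>\<^sub>M N \<Longrightarrow>
    (\<lambda>p. v (norm (snd p - closest_point (fst p) (snd p)))) \<in> \<mu> \<Otimes>\<^sub>M (lborel :: (real ^ 'n) measure) \<rightarrow>\<^sub>M N"
  by (rule measurable_compose[rotated]) (assumption, measurable)

lemma measurable_distance:
  assumes [measurable]: "v \<in> borel \<rightarrow>\<^sub>M N"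
  shows "(\<lambda>\<zeta>. v (norm (y - closest_point \<zeta> (y :: real ^ 'n)))) \<in> \<mu> \<rightarrow>\<^sub>M N"
  using measurable_compose[OF measurable_Pair2'[of y "lborel :: (real ^ 'n) measure" \<mu>] measurable_distance_pair[OF assms]]
  by simp

lemma measurable_mean_distance [measurable]:
  assumes [measurable]: "v \<in> borel_measurable borel"
  shows "mean_distance v \<in> borel_measurable borel"
proof -
  have "(\<lambda>y. \<integral>\<^sup>+\<zeta>. v (norm (y - closest_point \<zeta> y)) \<partial>\<mu>) \<in> borel_measurable (lborel :: (real ^ 'n) measure)"
    using measurable_pair_swap[OF measurable_distance_pair[OF assms]]
    by (intro sigma_finite_measure.borel_measurable_nn_integral[OF
        prob_space_imp_sigma_finite[OF prob_space_axioms]]) (simp add: split_def)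
  then show ?thesis unfolding mean_distance_def by simp
qed

text \<open>The rotations act transitively on spheres, and \<open>\<mu>\<close> is invariant under them.\<close>

lemma mean_distance_radial:
  assumes n: "2 \<le> CARD('n)" and v: "v \<in> borel_measurable borel" and eq: "norm x = norm (y :: real ^ 'n)"
  shows "mean_distance v x = mean_distance v y"
proof -
  obtain f where f: "orthogonal_transformation f" "det (matrix f) = 1" "f x = y"
    using rotation_exists[OF n eq] by blast
  have om: "orthogonal_matrix (matrix f)" and lin: "linear f"
    using f(1) by (simp_all add: orthogonal_transformation_matrix)
  have fm: "matrix f *v z = f z" for z using lin by simp
  have inv: "distr \<mu> \<mu> ((`) f) = \<mu>"
    using invariant[of "matrix f"] om f(2) by (simp add: rotation_matrix_def fm)
  have mf: "(`) f \<in> \<mu> \<rightarrow>\<^sub>M \<mu>" using measurable_rotate[OF om] unfolding fm .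
  have "mean_distance v y = (\<integral>\<^sup>+\<zeta>. v (norm (y - closest_point \<zeta> y)) \<partial>distr \<mu> \<mu> ((`) f))"
    by (simp only: mean_distance_def inv)
  also have "\<dots> = (\<integral>\<^sup>+\<zeta>. v (norm (f x - closest_point (f ` \<zeta>) (f x))) \<partial>\<mu>)"
    using measurable_distance[OF v, of y] by (subst nn_integral_distr[OF mf]) (simp_all add: f(3))
  also have "\<dots> = mean_distance v x"
    unfolding mean_distance_def
  proof (rule nn_integral_cong)
    fix \<zeta> assume "\<zeta> \<in> space \<mu>"
    then have V: "subspace \<zeta>" by (simp add: grassmannianD)
    have "f x - closest_point (f ` \<zeta>) (f x) = f (x - closest_point \<zeta> x)"
      by (simp add: closest_point_orthogonal_image[OF V f(1)] linear_diff[OF lin])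
    then show "v (norm (f x - closest_point (f ` \<zeta>) (f x))) = v (norm (x - closest_point \<zeta> x))"
      by (simp add: orthogonal_transformation_norm[OF f(1)])
  qed
  finally show ?thesis ..
qed

text \<open>For a fixed direction the left integrand depends only on the lengths of the two orthogonal
  components of \<open>y\<close>. Polar coordinates in both components give a double integral that does not
  depend on the direction any more, so that the integral over the directions disappears.\<close>

lemma nn_integral_mean_distance_radial:
  assumes kn: "0 < k" "k < CARD('n)"
    and [measurable]: "v \<in> borel_measurable borel" "g \<in> borel_measurable borel"
  shows "(\<integral>\<^sup>+y. mean_distance v y * g (norm y) \<partial>lborel) =
    (\<integral>\<^sup>+r. ennreal (sphere_area (k - 1) * sphere_area (CARD('n) - k - 1) * r * indicator {0<..} r) *
       (\<integral>\<^sup>+s. ennreal (abel_kernel CARD('n) k r s * indicator {0<..<r} s) * v s \<partial>lborel) * g r \<partial>lborel)"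
proof -
  let ?n = "CARD('n)"
  let ?a = "sphere_area (k - 1)" and ?b = "sphere_area (?n - k - 1)"
  note [measurable] = measurable_distance_pair[OF assms(3)]
  let ?p = "\<lambda>t. ennreal (?a * t ^ (k - 1) * indicator {0<..} t)"
  let ?q = "\<lambda>s. ennreal (?b * s ^ (?n - k - 1) * indicator {0<..} s)"
  have "(\<integral>\<^sup>+y. mean_distance v y * g (norm y) \<partial>lborel) =
      (\<integral>\<^sup>+y. (\<integral>\<^sup>+\<zeta>. v (norm (y - closest_point \<zeta> y)) * g (norm y) \<partial>\<mu>) \<partial>lborel)"
    unfolding mean_distance_def
    by (intro nn_integral_cong nn_integral_multc[symmetric] measurable_distance) simp
  also have "\<dots> = (\<integral>\<^sup>+\<zeta>. (\<integral>\<^sup>+y. v (norm (y - closest_point \<zeta> y)) * g (norm y) \<partial>lborel) \<partial>\<mu>)"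
    using Fubini[of "\<lambda>p. v (norm (snd p - closest_point (fst p) (snd p))) * g (norm (snd p))"] by simp
  also have "\<dots> = (\<integral>\<^sup>+\<zeta>. (\<integral>\<^sup>+s. ?q s * (\<integral>\<^sup>+t. ?p t * (v s * g (sqrt (t\<^sup>2 + s\<^sup>2))) \<partial>lborel) \<partial>lborel) \<partial>\<mu>)"
  proof (rule nn_integral_cong)
    fix \<zeta> assume "\<zeta> \<in> space \<mu>"
    then have \<zeta>: "\<zeta> \<in> grassmannian k" by simp
    note V = grassmannianD[OF \<zeta>]
    note W = subspace_orthogonal_comp[of \<zeta>]
    have dW: "dim (\<zeta>\<^sup>\<bottom>) = ?n - k" using dim_orthogonal_comp_add[OF V(1)] V(2) by simp
    have [measurable]: "closest_point \<zeta> \<in> borel_measurable borel"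
      by (rule measurable_closest_point_subspace[OF V(1)])
    interpret V: sigma_finite_measure "borel_subspace \<zeta>" by (rule sigma_finite_borel_subspace[OF V(1)])
    have p: "distr (borel_subspace \<zeta>) borel norm = density lborel ?p"
      using distr_norm_borel_subspace[OF V(1)] V(2) kn unit_ball_vol_sphere_area[of k] by simp
    have q: "distr (borel_subspace (\<zeta>\<^sup>\<bottom>)) borel norm = density lborel ?q"
      using distr_norm_borel_subspace[OF W] dW kn unit_ball_vol_sphere_area[of "?n - k"] by simp
    have "(\<integral>\<^sup>+y. v (norm (y - closest_point \<zeta> y)) * g (norm y) \<partial>lborel) =
        (\<integral>\<^sup>+z. (\<integral>\<^sup>+y. v (norm (y + z - closest_point \<zeta> (y + z))) * g (norm (y + z))
           \<partial>borel_subspace \<zeta>) \<partial>borel_subspace (\<zeta>\<^sup>\<bottom>))"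
      by (rule nn_integral_lborel_subspace_split(1)[OF V(1)]) measurable
    also have "\<dots> = (\<integral>\<^sup>+z. (\<integral>\<^sup>+y. v (norm z) * g (sqrt ((norm y)\<^sup>2 + (norm z)\<^sup>2))
           \<partial>borel_subspace \<zeta>) \<partial>borel_subspace (\<zeta>\<^sup>\<bottom>))"
    proof (rule nn_integral_cong_AE, rule AE_mp[OF AE_borel_subspace_mem[OF W]], rule AE_I2, rule impI)
      fix z assume z: "z \<in> \<zeta>\<^sup>\<bottom>"
      show "(\<integral>\<^sup>+y. v (norm (y + z - closest_point \<zeta> (y + z))) * g (norm (y + z)) \<partial>borel_subspace \<zeta>) =
          (\<integral>\<^sup>+y. v (norm z) * g (sqrt ((norm y)\<^sup>2 + (norm z)\<^sup>2)) \<partial>borel_subspace \<zeta>)"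
      proof (rule nn_integral_cong_AE, rule AE_mp[OF AE_borel_subspace_mem[OF V(1)]], rule AE_I2, rule impI)
        fix y assume y: "y \<in> \<zeta>"
        then have "orthogonal y z" using z by (simp add: orthogonal_comp_def)
        then have "norm (y + z) = sqrt ((norm y)\<^sup>2 + (norm z)\<^sup>2)"
          by (metis norm_add_Pythagorean norm_ge_zero real_sqrt_unique)
        then show "v (norm (y + z - closest_point \<zeta> (y + z))) * g (norm (y + z)) =
            v (norm z) * g (sqrt ((norm y)\<^sup>2 + (norm z)\<^sup>2))"
          by (simp add: closest_point_subspace_add[OF V(1) y z])
      qed
    qed
    also have "\<dots> = (\<integral>\<^sup>+z. (\<integral>\<^sup>+t. v (norm z) * g (sqrt (t\<^sup>2 + (norm z)\<^sup>2))
           \<partial>distr (borel_subspace \<zeta>) borel norm) \<partial>borel_subspace (\<zeta>\<^sup>\<bottom>))"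
      by (intro nn_integral_cong nn_integral_distr[symmetric]) measurable
    also have "\<dots> = (\<integral>\<^sup>+s. (\<integral>\<^sup>+t. v s * g (sqrt (t\<^sup>2 + s\<^sup>2))
           \<partial>density lborel ?p) \<partial>distr (borel_subspace (\<zeta>\<^sup>\<bottom>)) borel norm)"
      unfolding p by (intro nn_integral_distr[symmetric]) (simp_all add: nn_integral_density)
    also have "\<dots> = (\<integral>\<^sup>+s. ?q s * (\<integral>\<^sup>+t. ?p t * (v s * g (sqrt (t\<^sup>2 + s\<^sup>2))) \<partial>lborel) \<partial>lborel)"
      unfolding q by (simp add: nn_integral_density)
    finally show "(\<integral>\<^sup>+y. v (norm (y - closest_point \<zeta> y)) * g (norm y) \<partial>lborel) =
       (\<integral>\<^sup>+s. ?q s * (\<integral>\<^sup>+t. ?p t * (v s * g (sqrt (t\<^sup>2 + s\<^sup>2))) \<partial>lborel) \<partial>lborel)" .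
  qed
  also have "\<dots> = (\<integral>\<^sup>+s. ?q s * (\<integral>\<^sup>+t. ?p t * (v s * g (sqrt (t\<^sup>2 + s\<^sup>2))) \<partial>lborel) \<partial>lborel)"
    using emeasure_space_1 by simp
  also have "\<dots> = (\<integral>\<^sup>+s. (\<integral>\<^sup>+r. ennreal (?a * ?b * r * indicator {0<..} r) *
      (ennreal (abel_kernel ?n k r s * indicator {0<..<r} s) * v s) * g r \<partial>lborel) \<partial>lborel)"
  proof (rule nn_integral_cong)
    fix s :: real
    show "?q s * (\<integral>\<^sup>+t. ?p t * (v s * g (sqrt (t\<^sup>2 + s\<^sup>2))) \<partial>lborel) =
      (\<integral>\<^sup>+r. ennreal (?a * ?b * r * indicator {0<..} r) *
      (ennreal (abel_kernel ?n k r s * indicator {0<..<r} s) * v s) * g r \<partial>lborel)"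
    proof (cases "0 < s")
      case True
      have "(\<integral>\<^sup>+t. ?p t * (v s * g (sqrt (t\<^sup>2 + s\<^sup>2))) \<partial>lborel) =
          (\<integral>\<^sup>+t. (ennreal ?a * v s) * (ennreal (t ^ (k - 1) * indicator {0<..} t) * g (sqrt (t\<^sup>2 + s\<^sup>2))) \<partial>lborel)"
        by (intro nn_integral_cong) (simp add: ennreal_mult' less_imp_le mult_ac)
      also have "\<dots> = (ennreal ?a * v s) * (\<integral>\<^sup>+r. ennreal ((r\<^sup>2 - s\<^sup>2) powr (real k / 2 - 1) * r * indicator {s<..} r) * g r \<partial>lborel)"
        by (subst nn_integral_cmult, simp)
          (simp only: nn_integral_hypotenuse_substitution[OF assms(4) True kn(1)])
      finally have "?q s * (\<integral>\<^sup>+t. ?p t * (v s * g (sqrt (t\<^sup>2 + s\<^sup>2))) \<partial>lborel) =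
        (\<integral>\<^sup>+r. ?q s * (ennreal ?a * v s) * (ennreal ((r\<^sup>2 - s\<^sup>2) powr (real k / 2 - 1) * r * indicator {s<..} r) * g r) \<partial>lborel)"
        by (simp add: nn_integral_cmult mult.assoc)
      also have "\<dots> = (\<integral>\<^sup>+r. ennreal (?a * ?b * r * indicator {0<..} r) *
         (ennreal (abel_kernel ?n k r s * indicator {0<..<r} s) * v s) * g r \<partial>lborel)"
      proof (rule nn_integral_cong)
        fix r :: real
        show "?q s * (ennreal ?a * v s) * (ennreal ((r\<^sup>2 - s\<^sup>2) powr (real k / 2 - 1) * r * indicator {s<..} r) * g r) =
         ennreal (?a * ?b * r * indicator {0<..} r) *
         (ennreal (abel_kernel ?n k r s * indicator {0<..<r} s) * v s) * g r"
        proof (cases "s < r")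
          case sr: True
          then have r: "0 < r" using True by simp
          have "ennreal (?b * s ^ (?n - k - 1)) * ennreal ?a * ennreal ((r\<^sup>2 - s\<^sup>2) powr (real k / 2 - 1) * r) =
            ennreal (?a * ?b * r) * ennreal (s ^ (?n - k - 1) * (r\<^sup>2 - s\<^sup>2) powr (real k / 2 - 1))"
            using True r by (simp add: less_imp_le mult_ac flip: ennreal_mult)
          then show ?thesis using True sr r by (simp add: abel_kernel_def mult_ac)
        qed simp
      qed
      finally show ?thesis .
    qed simp
  qed
  also have "\<dots> = (\<integral>\<^sup>+r. (\<integral>\<^sup>+s. ennreal (?a * ?b * r * indicator {0<..} r) *
      (ennreal (abel_kernel ?n k r s * indicator {0<..<r} s) * v s) * g r \<partial>lborel) \<partial>lborel)"
  proof (rule lborel_pair.Fubini')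
    have [measurable]: "(\<lambda>p. ennreal (abel_kernel ?n k (fst p) (snd p) * indicator {0<..<fst p} (snd p)))
        \<in> borel_measurable (lborel \<Otimes>\<^sub>M lborel)"
      using measurable_abel_weight[of ?n k]
      by (simp add: measurable_cong_sets[OF sets_pair_measure_cong[OF sets_lborel sets_lborel] refl])
    show "(\<lambda>(r, s). ennreal (?a * ?b * r * indicator {0<..} r) *
        (ennreal (abel_kernel ?n k r s * indicator {0<..<r} s) * v s) * g r)
        \<in> borel_measurable (lborel \<Otimes>\<^sub>M lborel)"
      unfolding split_def by measurable
  qed
  also have "\<dots> = (\<integral>\<^sup>+r. ennreal (?a * ?b * r * indicator {0<..} r) *
      (\<integral>\<^sup>+s. ennreal (abel_kernel ?n k r s * indicator {0<..<r} s) * v s \<partial>lborel) * g r \<partial>lborel)"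
    by (intro nn_integral_cong) (simp add: nn_integral_cmult nn_integral_multc abel_kernel_def)
  finally show ?thesis .
qed

text \<open>Both sides are radial and have the same integral against every radial function. This
  determines them only almost everywhere, which suffices because the mean is used only under an
  integral.\<close>

theorem AE_mean_distance_eq_abel:
  assumes n: "2 \<le> CARD('n)" and kn: "0 < k" "k < CARD('n)"
    and v[measurable]: "v \<in> borel_measurable borel"
  shows "AE y in lborel. mean_distance v (y :: real ^ 'n) = nn_abel_operator CARD('n) k v (norm y)"
proof -
  let ?n = "CARD('n)"
  define e :: "real ^ 'n" where "e = axis undefined 1"
  have e: "norm e = 1" by (simp add: e_def)
  have [measurable]: "(\<lambda>r::real. r *\<^sub>R e) \<in> borel_measurable borel" by measurable
  define \<phi> where "\<phi> r = mean_distance v (r *\<^sub>R e)" for r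
  have \<phi>[measurable]: "\<phi> \<in> borel_measurable borel"
    unfolding \<phi>_def by (rule measurable_compose[OF _ measurable_mean_distance[OF v]]) measurable
  \<comment> \<open>The profile of the radial function, taken along the axis \<open>e\<close>.\<close>
  have \<phi>_norm: "mean_distance v y = \<phi> (norm y)" for y :: "real ^ 'n"
    unfolding \<phi>_def by (rule mean_distance_radial[OF n v]) (simp add: e)
  define W where "W r = (\<integral>\<^sup>+s. ennreal (abel_kernel ?n k r s * indicator {0<..<r} s) * v s \<partial>lborel)" for r
  have [measurable]: "W \<in> borel_measurable borel"
    unfolding W_def using measurable_abel_weight[of ?n k]
    by (intro lborel.borel_measurable_nn_integral) (simp add: split_def)
  let ?d = "\<lambda>r. ennreal (sphere_area (?n - 1) * r ^ (?n - 1) * indicator {0<..} r)"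
  have d: "distr (lborel :: (real ^ 'n) measure) borel norm = density lborel ?d"
    using distr_norm_lborel[where 'n = 'n] n unit_ball_vol_sphere_area[of ?n] by simp
  let ?c = "sphere_area (k - 1) * sphere_area (?n - k - 1)"
  have "density lborel (\<lambda>r. ?d r * \<phi> r) = density lborel (\<lambda>r. ennreal (?c * r * indicator {0<..} r) * W r)"
  proof (rule measure_eqI)
    fix A assume "A \<in> sets (density lborel (\<lambda>r. ?d r * \<phi> r))"
    then have [measurable]: "A \<in> sets borel" by simp
    have "emeasure (density lborel (\<lambda>r. ?d r * \<phi> r)) A = (\<integral>\<^sup>+r. ?d r * (\<phi> r * indicator A r) \<partial>lborel)"
      by (simp add: emeasure_density mult.assoc)
    also have "\<dots> = (\<integral>\<^sup>+r. \<phi> r * indicator A r \<partial>distr (lborel :: (real ^ 'n) measure) borel norm)"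
      unfolding d by (simp add: nn_integral_density)
    also have "\<dots> = (\<integral>\<^sup>+y. mean_distance v y * indicator A (norm y) \<partial>(lborel :: (real ^ 'n) measure))"
      by (subst nn_integral_distr) (simp_all add: \<phi>_norm)
    also have "\<dots> = (\<integral>\<^sup>+r. ennreal (?c * r * indicator {0<..} r) * W r * indicator A r \<partial>lborel)"
      unfolding W_def by (rule nn_integral_mean_distance_radial[OF kn v]) measurable
    also have "\<dots> = emeasure (density lborel (\<lambda>r. ennreal (?c * r * indicator {0<..} r) * W r)) A"
      by (simp add: emeasure_density)
    finally show "emeasure (density lborel (\<lambda>r. ?d r * \<phi> r)) A = \<dots>" .
  qed simp
  then have "AE r in lborel. ?d r * \<phi> r = ennreal (?c * r * indicator {0<..} r) * W r"
    by (subst (asm) sigma_finite_measure.density_unique_iff[OF lborel.sigma_finite_measure_axioms]) simp_all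
  then have "AE r in lborel. 0 < ?d r \<longrightarrow> \<phi> r = nn_abel_operator ?n k v r"
  proof eventually_elim
    case (elim r)
    show ?case
    proof
      assume "0 < ?d r"
      then have r: "0 < r" by (cases "0 < r") auto
      define D where "D = sphere_area (?n - 1) * r ^ (?n - 1)"
      have D: "0 < D" using r by (simp add: D_def)
      have "r powr (2 - real ?n) * r ^ (?n - 1) = r powr (2 - real ?n) * r powr (real (?n - 1))"
        by (simp only: powr_realpow[OF r])
      also have "\<dots> = r" using r n by (simp flip: powr_add add: of_nat_diff)
      finally have pw: "r powr (2 - real ?n) * r ^ (?n - 1) = r" .
      have "D * (abel_const ?n k * r powr (2 - real ?n)) =
          ?c * (r powr (2 - real ?n) * r ^ (?n - 1))"
        by (simp add: D_def abel_const_def less_imp_neq[symmetric])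
      then have c: "D * (abel_const ?n k * r powr (2 - real ?n)) = ?c * r" by (simp only: pw)
      have "ennreal D * \<phi> r = ennreal (?c * r) * W r" using elim r by (simp add: D_def)
      also have "ennreal (?c * r) = ennreal D * ennreal (abel_const ?n k * r powr (2 - real ?n))"
        using D by (subst ennreal_mult[symmetric]) (simp_all add: c less_imp_le)
      finally have "ennreal D * \<phi> r = ennreal D * nn_abel_operator ?n k v r"
        by (simp add: nn_abel_operator_def W_def mult.assoc)
      then show "\<phi> r = nn_abel_operator ?n k v r"
        using D by (subst (asm) ennreal_mult_cancel_left) auto
    qed
  qed
  then have "AE r in density lborel ?d. \<phi> r = nn_abel_operator ?n k v r"
    by (subst AE_density) simp_all
  then have "AE y in (lborel :: (real ^ 'n) measure). \<phi> (norm y) = nn_abel_operator ?n k v (norm y)"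
    unfolding d[symmetric] by (rule AE_distrD[rotated]) simp
  then show ?thesis by (simp add: \<phi>_norm)
qed

end

section \<open>Elementary integrals\<close>

text \<open>A form of the fundamental theorem for integrands that are singular at the end points.\<close>

lemma nn_integral_FTC_Ioo:
  fixes f F :: "real \<Rightarrow> real"
  assumes ab: "a < b"
    and F: "\<And>x. a < x \<Longrightarrow> x < b \<Longrightarrow> DERIV F x :> f x"
    and f: "\<And>x. a < x \<Longrightarrow> x < b \<Longrightarrow> isCont f x"
    and nonneg: "\<And>x. a < x \<Longrightarrow> x < b \<Longrightarrow> 0 \<le> f x"
    and A: "(F \<longlongrightarrow> A) (at_right a)" and B: "(F \<longlongrightarrow> B) (at_left b)"
  shows "(\<integral>\<^sup>+x. ennreal (f x) * indicator {a<..<b} x \<partial>lborel) = ennreal (B - A)"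
proof -
  have 1: "set_integrable lborel (einterval a b) f" "(LBINT x=a..b. f x) = B - A"
    by (rule interval_integral_FTC_nonneg[where F = F];
      (use assms in \<open>simp add: ereal_tendsto_simps\<close>))+
  have e: "einterval (ereal a) (ereal b) = {a<..<b}" by (auto simp: einterval_def)
  have I: "integrable lborel (\<lambda>x. f x * indicator {a<..<b} x)"
    using 1(1) by (simp add: e set_integrable_def mult.commute)
  have "(\<integral>\<^sup>+x. ennreal (f x) * indicator {a<..<b} x \<partial>lborel) =
      (\<integral>\<^sup>+x. ennreal (f x * indicator {a<..<b} x) \<partial>lborel)"
    by (intro nn_integral_cong) (auto simp: indicator_def)
  also have "\<dots> = ennreal (\<integral>x. f x * indicator {a<..<b} x \<partial>lborel)"
    by (rule nn_integral_eq_integral[OF I]) (auto simp: indicator_def nonneg)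
  also have "(\<integral>x. f x * indicator {a<..<b} x \<partial>lborel) = B - A"
    using 1(2) ab by (simp add: interval_lebesgue_integral_def e set_lebesgue_integral_def mult.commute)
  finally show ?thesis .
qed

text \<open>An antiderivative is \<open>- sqrt ((r\<^sup>2 - s\<^sup>2) / (s\<^sup>2 - v)) / (r\<^sup>2 - v)\<close>; it vanishes at \<open>s =
  r\<close>.\<close>

lemma nn_integral_abel_transform_of_pole:
  fixes v r :: real
  assumes v: "v < 1" and r: "1 < r"
  shows "(\<integral>\<^sup>+s. ennreal (s / ((s\<^sup>2 - v) * sqrt (s\<^sup>2 - v) * sqrt (r\<^sup>2 - s\<^sup>2))) * indicator {1<..<r} s \<partial>lborel) =
    ennreal (sqrt (r\<^sup>2 - 1) / ((r\<^sup>2 - v) * sqrt (1 - v)))"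
proof -
  let ?F = "\<lambda>s. - (sqrt ((r\<^sup>2 - s\<^sup>2) / (s\<^sup>2 - v)) / (r\<^sup>2 - v))"
  have sq: "1 \<le> s\<^sup>2" if "1 \<le> s" for s :: real using that by simp
  have sr: "s\<^sup>2 < r\<^sup>2" if "1 \<le> s" "s < r" for s using that by (intro power_strict_mono) auto
  have r2: "1 < r\<^sup>2" using r by simp
  have "(\<integral>\<^sup>+s. ennreal (s / ((s\<^sup>2 - v) * sqrt (s\<^sup>2 - v) * sqrt (r\<^sup>2 - s\<^sup>2))) * indicator {1<..<r} s \<partial>lborel) =
    ennreal (0 - (- (sqrt ((r\<^sup>2 - 1) / (1 - v)) / (r\<^sup>2 - v))))"
  proof (rule nn_integral_FTC_Ioo[OF r])
    fix s assume s: "1 < s" "s < r"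
    have p: "0 < s\<^sup>2 - v" "0 < r\<^sup>2 - s\<^sup>2" "0 < r\<^sup>2 - v" using sq[of s] sr[of s] s v r2 by linarith+
    define X Y Z where "X = sqrt (s\<^sup>2 - v)" and "Y = sqrt (r\<^sup>2 - s\<^sup>2)" and "Z = r\<^sup>2 - v"
    have XY: "0 < X" "0 < Y" "0 < Z" "s\<^sup>2 - v = X\<^sup>2" "r\<^sup>2 - s\<^sup>2 = Y\<^sup>2" "Z = X\<^sup>2 + Y\<^sup>2"
      using p by (simp_all add: X_def Y_def Z_def)
    have dq: "((\<lambda>s. (r\<^sup>2 - s\<^sup>2) / (s\<^sup>2 - v)) has_real_derivative
        ((- (2 * s)) * (s\<^sup>2 - v) - (r\<^sup>2 - s\<^sup>2) * (2 * s)) / ((s\<^sup>2 - v) * (s\<^sup>2 - v))) (at s)"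
      using p by (auto intro!: derivative_eq_intros)
    have q: "0 < (r\<^sup>2 - s\<^sup>2) / (s\<^sup>2 - v)" using p by simp
    note DERIV_minus[OF DERIV_cdivide[OF DERIV_chain2[OF DERIV_real_sqrt[OF q] dq], of "r\<^sup>2 - v"]]
    also have "- (inverse (sqrt ((r\<^sup>2 - s\<^sup>2) / (s\<^sup>2 - v))) / 2 *
        (((- (2 * s)) * (s\<^sup>2 - v) - (r\<^sup>2 - s\<^sup>2) * (2 * s)) / ((s\<^sup>2 - v) * (s\<^sup>2 - v))) / (r\<^sup>2 - v)) =
        s / ((s\<^sup>2 - v) * sqrt (s\<^sup>2 - v) * sqrt (r\<^sup>2 - s\<^sup>2))"
    proof -
      have "- (inverse (Y / X) / 2 * ((- (2 * s) * X\<^sup>2 - Y\<^sup>2 * (2 * s)) / (X\<^sup>2 * X\<^sup>2)) / Z) =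
          (X * s * (X\<^sup>2 + Y\<^sup>2)) / (Y * (X\<^sup>2 * X\<^sup>2) * Z)"
        using XY(1-3) by (simp add: field_simps)
      also have "\<dots> = s / (X\<^sup>2 * X * Y)"
        using XY(1-3) unfolding XY(6)[symmetric] by (simp add: field_simps power2_eq_square)
      finally have "- (inverse (Y / X) / 2 * ((- (2 * s) * X\<^sup>2 - Y\<^sup>2 * (2 * s)) / (X\<^sup>2 * X\<^sup>2)) / Z) =
        s / (X\<^sup>2 * X * Y)" .
      then show ?thesis unfolding real_sqrt_divide X_def[symmetric] Y_def[symmetric] Z_def[symmetric]
        unfolding XY(4,5) .
    qed
    finally show "(?F has_real_derivative s / ((s\<^sup>2 - v) * sqrt (s\<^sup>2 - v) * sqrt (r\<^sup>2 - s\<^sup>2))) (at s)" .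
    show "isCont (\<lambda>s. s / ((s\<^sup>2 - v) * sqrt (s\<^sup>2 - v) * sqrt (r\<^sup>2 - s\<^sup>2))) s"
      using p by (intro continuous_intros) auto
    show "0 \<le> s / ((s\<^sup>2 - v) * sqrt (s\<^sup>2 - v) * sqrt (r\<^sup>2 - s\<^sup>2))" using s p by simp
  next
    have "isCont ?F 1" using v r2 by (intro continuous_intros) auto
    then show "(?F \<longlongrightarrow> - (sqrt ((r\<^sup>2 - 1) / (1 - v)) / (r\<^sup>2 - v))) (at_right 1)"
      by (auto simp: isCont_def intro: tendsto_within_subset[of _ _ _ UNIV])
    have "isCont ?F r" using v r2 by (intro continuous_intros) auto
    then show "(?F \<longlongrightarrow> 0) (at_left r)"
      by (auto simp: isCont_def intro: tendsto_within_subset[of _ _ _ UNIV])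
  qed
  then show ?thesis by (simp add: real_sqrt_divide mult.commute)
qed

text \<open>The substitution \<open>tan\<^sup>2 t = (R - 1) (v - u) / ((R - u) (1 - v))\<close> turns the integrand into
  a constant, with \<open>t\<close> running from 0 to \<open>pi / 2\<close>.\<close>

lemma nn_integral_arcsine_pole:
  fixes u R :: real
  assumes u: "u < 1" and R: "1 < R"
  shows "(\<integral>\<^sup>+v. ennreal (1 / (sqrt (v - u) * sqrt (1 - v) * (R - v))) * indicator {u<..<1} v \<partial>lborel) =
    ennreal (pi / (sqrt (R - 1) * sqrt (R - u)))"
proof -
  define \<kappa> where "\<kappa> = (R - 1) / (R - u)"
  define c where "c = 2 / (sqrt (R - 1) * sqrt (R - u))"
  have \<kappa>: "0 < \<kappa>" using assms by (simp add: \<kappa>_def)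
  let ?q = "\<lambda>v. \<kappa> * (v - u) / (1 - v)"
  let ?F = "\<lambda>v. c * arctan (sqrt (?q v))"
  have "(\<integral>\<^sup>+v. ennreal (1 / (sqrt (v - u) * sqrt (1 - v) * (R - v))) * indicator {u<..<1} v \<partial>lborel) =
    ennreal (c * (pi / 2) - c * arctan (sqrt (?q u)))"
  proof (rule nn_integral_FTC_Ioo[OF u])
    fix v assume v: "u < v" "v < 1"
    have q: "0 < ?q v" using v \<kappa> by simp
    define X Y where "X = sqrt (v - u)" and "Y = sqrt (1 - v)"
    have XY: "0 < X" "0 < Y" "v - u = X\<^sup>2" "1 - v = Y\<^sup>2" using v by (simp_all add: X_def Y_def)
    define S T where "S = sqrt (R - 1)" and "T = sqrt (R - u)"
    have ST: "0 < S" "0 < T" "R - 1 = S\<^sup>2" "R - u = T\<^sup>2" using assms by (simp_all add: S_def T_def)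
    have id1: "(R - v) * (1 - u) = T\<^sup>2 * Y\<^sup>2 + S\<^sup>2 * X\<^sup>2"
      unfolding ST(3,4)[symmetric] XY(3,4)[symmetric] by (simp add: algebra_simps)
    have id2: "1 - u = X\<^sup>2 + Y\<^sup>2" unfolding XY(3,4)[symmetric] by simp
    have u1: "0 < 1 - u" and Rv: "0 < R - v" using u v R by auto
    have sq: "sqrt (?q v) = S * X / (T * Y)"
      by (simp add: \<kappa>_def real_sqrt_divide real_sqrt_mult S_def T_def X_def Y_def)
    have "(?F has_real_derivative c * (1 / (1 + (sqrt (?q v))\<^sup>2) * (inverse (sqrt (?q v)) / 2 *
        ((\<kappa> * (1 - v) + \<kappa> * (v - u)) / (1 - v)\<^sup>2)))) (at v)"
      using q v by (auto intro!: derivative_eq_intros simp: power2_eq_square inverse_eq_divide)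
    also have "c * (1 / (1 + (sqrt (?q v))\<^sup>2) * (inverse (sqrt (?q v)) / 2 *
        ((\<kappa> * (1 - v) + \<kappa> * (v - u)) / (1 - v)\<^sup>2))) = 1 / (X * Y * (R - v))"
    proof -
      have a: "1 + (S * X / (T * Y))\<^sup>2 = (R - v) * (1 - u) / (T\<^sup>2 * Y\<^sup>2)"
        unfolding id1 using XY(1,2) ST(1,2) by (simp add: field_simps power2_eq_square)
      have b: "\<kappa> * (1 - v) + \<kappa> * (v - u) = S\<^sup>2 / T\<^sup>2 * (1 - u)"
        by (simp add: \<kappa>_def ST(3,4) diff_divide_distrib algebra_simps)
      have c: "c = 2 / (S * T)" by (simp add: c_def S_def T_def)
      show ?thesis unfolding sq b c unfolding a XY(4) using XY(1,2) ST(1,2) u1 Rv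
        by (simp add: divide_simps power2_eq_square)
    qed
    finally show "(?F has_real_derivative 1 / (sqrt (v - u) * sqrt (1 - v) * (R - v))) (at v)"
      by (simp add: X_def Y_def)
    show "isCont (\<lambda>v. 1 / (sqrt (v - u) * sqrt (1 - v) * (R - v))) v"
      using v R by (intro continuous_intros) auto
    show "0 \<le> 1 / (sqrt (v - u) * sqrt (1 - v) * (R - v))" using v R by simp
  next
    have "isCont ?F u" using u by (intro continuous_intros) auto
    then show "(?F \<longlongrightarrow> c * arctan (sqrt (?q u))) (at_right u)"
      by (auto simp: isCont_def intro: tendsto_within_subset[of _ _ _ UNIV])
    have t: "((\<lambda>v. \<kappa> * (v - u)) \<longlongrightarrow> \<kappa> * (1 - u)) (at_left 1)" by (intro tendsto_intros)
    have "LIM v at_left (1::real). inverse (1 - v) :> at_top"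
    proof (rule filterlim_inverse_at_top)
      have "((\<lambda>v::real. 1 - v) \<longlongrightarrow> 1 - 1) (at_left 1)" by (intro tendsto_intros)
      then show "((\<lambda>v::real. 1 - v) \<longlongrightarrow> 0) (at_left 1)" by simp
      show "\<forall>\<^sub>F v in at_left (1::real). 0 < 1 - v" by (simp add: eventually_at_filter)
    qed
    then have "LIM v at_left 1. \<kappa> * (v - u) * inverse (1 - v) :> at_top"
      using \<kappa> u by (intro filterlim_tendsto_pos_mult_at_top[OF t]) auto
    then have "LIM v at_left 1. sqrt (?q v) :> at_top"
      unfolding divide_inverse by (rule filterlim_compose[OF sqrt_at_top])
    then show "(?F \<longlongrightarrow> c * (pi / 2)) (at_left 1)"
      by (intro tendsto_mult tendsto_const filterlim_compose[OF tendsto_arctan_at_top])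
  qed
  then show ?thesis by (simp add: c_def)
qed

lemma nn_integral_Beta_scaled:
  fixes a b v :: real
  assumes a: "0 < a" and b: "0 < b" and v: "0 < v"
  shows "(\<integral>\<^sup>+u. ennreal (u powr (a - 1) * (v - u) powr (b - 1)) * indicator {0<..<v} u \<partial>lborel) =
    ennreal (Beta a b * v powr (a + b - 1))"
proof -
  have "ennreal (Beta a b) = (\<integral>\<^sup>+t. ennreal (t powr (a - 1) * (1 - t) powr (b - 1)) * indicator {0..1} t \<partial>lborel)"
    using nn_integral_has_integral_lebesgue[OF _ has_integral_Beta_real[OF a b]]
    by (simp add: ennreal_mult' ennreal_indicator mult_ac)
  also have "\<dots> = (\<integral>\<^sup>+t. ennreal (t powr (a - 1) * (1 - t) powr (b - 1)) * indicator {0<..<1} t \<partial>lborel)"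
    by (intro nn_integral_cong_AE AE_I[where N = "{0, 1}"])
      (auto simp: indicator_def intro!: emeasure_lborel_countable)
  finally have B: "ennreal (Beta a b) = \<dots>" .
  have "(\<integral>\<^sup>+u. ennreal (u powr (a - 1) * (v - u) powr (b - 1)) * indicator {0<..<v} u \<partial>lborel) =
      ennreal v * (\<integral>\<^sup>+t. ennreal ((v * t) powr (a - 1) * (v - v * t) powr (b - 1)) * indicator {0<..<v} (v * t) \<partial>lborel)"
    using v by (subst nn_integral_real_affine[where c = v and t = 0]) simp_all
  also have "(\<integral>\<^sup>+t. ennreal ((v * t) powr (a - 1) * (v - v * t) powr (b - 1)) * indicator {0<..<v} (v * t) \<partial>lborel) =
      (\<integral>\<^sup>+t. ennreal (v powr (a + b - 2)) * (ennreal (t powr (a - 1) * (1 - t) powr (b - 1)) * indicator {0<..<1} t) \<partial>lborel)"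
  proof (rule nn_integral_cong)
    fix t :: real
    show "ennreal ((v * t) powr (a - 1) * (v - v * t) powr (b - 1)) * indicator {0<..<v} (v * t) =
      ennreal (v powr (a + b - 2)) * (ennreal (t powr (a - 1) * (1 - t) powr (b - 1)) * indicator {0<..<1} t)"
    proof (cases "0 < t \<and> t < 1")
      case True
      have "v - v * t = v * (1 - t)" by (simp add: algebra_simps)
      moreover have "v powr (a - 1) * v powr (b - 1) = v powr (a + b - 2)" by (simp flip: powr_add)
      ultimately have "(v * t) powr (a - 1) * (v - v * t) powr (b - 1) =
          v powr (a + b - 2) * (t powr (a - 1) * (1 - t) powr (b - 1))"
        using True v by (simp add: powr_mult mult_ac)
      then show ?thesis using True v by (simp add: ennreal_mult)
    qed (use v in \<open>auto simp: indicator_def zero_less_mult_iff\<close>)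
  qed
  also have "\<dots> = ennreal (v powr (a + b - 2)) * ennreal (Beta a b)"
    by (subst nn_integral_cmult) (simp_all add: B)
  also have "ennreal v * \<dots> = ennreal (Beta a b * v powr (a + b - 1))"
  proof -
    have "v * v powr (a + b - 2) = v powr (1 + (a + b - 2))" using v by (subst powr_add) simp
    then have "v * v powr (a + b - 2) = v powr (a + b - 1)" by (simp add: algebra_simps)
    then show ?thesis using v
      by (simp add: mult.assoc[symmetric] flip: ennreal_mult) (simp add: mult.commute ennreal_mult'')
  qed
  finally show ?thesis .
qed

section \<open>The Abel transform of the tail\<close>

lemma abel_const_1:
  assumes n: "2 \<le> n"
  shows "abel_const n 1 = 2 / Beta ((real n - 1) / 2) (1 / 2)"
proof -
  have r: "real (n - 2) + 1 = real n - 1" "real (n - 1) + 1 = real n" using n by (simp_all add: of_nat_diff)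
  have p: "pi powr (real n / 2) = pi powr ((real n - 1) / 2) * sqrt pi"
    by (simp add: powr_half_sqrt[symmetric] diff_divide_distrib flip: powr_add)
  have G: "Gamma (real n / 2) \<noteq> 0" "Gamma ((real n - 1) / 2) \<noteq> 0"
    using n by (auto simp: less_imp_neq[OF Gamma_real_pos, symmetric])
  have e: "(real n - 1) / 2 + 1 / 2 = real n / 2" by (simp add: field_simps)
  have s: "sphere_area 0 = 2"
    by (simp add: sphere_area_def Gamma_one_half_real powr_half_sqrt)
  show ?thesis
    using n G by (simp add: abel_const_def s sphere_area_def r p Beta_def e Gamma_one_half_real numeral_2_eq_2[symmetric]
        diff_diff_left powr_half_sqrt field_simps)
qed

lemma Beta_half_pos:
  assumes "2 \<le> n"
  shows "0 < Beta ((real n - 1) / 2) (1 / 2 :: real)"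
proof -
  have p: "0 < (real n - 1) / 2" using assms by simp
  then have q: "0 < (real n - 1) / 2 + 1 / 2" by linarith
  show ?thesis
    unfolding Beta_def Gamma_one_half_real using Gamma_real_pos[OF p] Gamma_real_pos[OF q] by simp
qed

lemma abel_kernel_1: "abel_kernel n 1 r s = s ^ (n - 2) * (r\<^sup>2 - s\<^sup>2) powr (- 1 / 2)"
  by (simp add: abel_kernel_def numeral_2_eq_2)

text \<open>The substitution \<open>u = s\<^sup>2\<close>, which brings the Abel integral into the form of a Beta
  integral.\<close>

lemma nn_integral_abel_kernel_square:
  assumes n: "2 \<le> n" and b: "0 < b"
  shows "(\<integral>\<^sup>+s. ennreal (abel_kernel n 1 r s) * indicator {0<..<b} s \<partial>lborel) =
    (\<integral>\<^sup>+u. ennreal (1 / 2 * (u powr ((real n - 1) / 2 - 1) * (r\<^sup>2 - u) powr (1 / 2 - 1))) * indicator {0<..<b\<^sup>2} u \<partial>lborel)"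
proof -
  let ?f = "\<lambda>u. ennreal (1 / 2 * (u powr ((real n - 1) / 2 - 1) * (r\<^sup>2 - u) powr (1 / 2 - 1)))"
  have "(\<integral>\<^sup>+u. ?f u * indicator {0<..<b\<^sup>2} u \<partial>lborel) = (\<integral>\<^sup>+u. ?f u * indicator {0\<^sup>2..b\<^sup>2} u \<partial>lborel)"
    by (intro nn_integral_cong_AE AE_I[where N = "{0, b\<^sup>2}"])
      (auto simp: indicator_def intro!: emeasure_lborel_countable)
  also have "\<dots> = (\<integral>\<^sup>+s. ?f (s\<^sup>2) * ennreal (2 * s) * indicator {0..b} s \<partial>lborel)"
    by (rule nn_integral_substitution_aux)
      (use b in \<open>auto intro!: derivative_eq_intros continuous_intros\<close>)
  also have "\<dots> = (\<integral>\<^sup>+s. ennreal (abel_kernel n 1 r s) * indicator {0<..<b} s \<partial>lborel)"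
  proof (rule nn_integral_cong_AE, rule AE_I[where N = "{0, b}"])
    show "{s \<in> space lborel. ?f (s\<^sup>2) * ennreal (2 * s) * indicator {0..b} s \<noteq>
        ennreal (abel_kernel n 1 r s) * indicator {0<..<b} s} \<subseteq> {0, b}"
    proof (safe, rule ccontr)
      fix s assume ne: "?f (s\<^sup>2) * ennreal (2 * s) * indicator {0..b} s \<noteq>
        ennreal (abel_kernel n 1 r s) * indicator {0<..<b} s" and "s \<noteq> b" "s \<noteq> 0"
      have "s \<in> {0..b}"
      proof (rule ccontr)
        assume "s \<notin> {0..b}"
        moreover from this have "s \<notin> {0<..<b}" by auto
        ultimately show False using ne by simp
      qed
      with \<open>s \<noteq> b\<close> \<open>s \<noteq> 0\<close> have s: "0 < s" "s < b" by auto
      have "(s\<^sup>2) powr ((real n - 1) / 2 - 1) * s = s powr (real n - 3) * s powr 1"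
        using s by (simp add: powr_powr diff_divide_distrib algebra_simps flip: powr_numeral)
      also have "\<dots> = s powr (real n - 3 + 1)" by (simp only: powr_add)
      also have "real n - 3 + 1 = real (n - 2)" using n by (simp add: of_nat_diff)
      also have "s powr real (n - 2) = s ^ (n - 2)" by (rule powr_realpow[OF s(1)])
      finally have e: "(s\<^sup>2) powr ((real n - 1) / 2 - 1) * s = s ^ (n - 2)" .
      have "1 / 2 * ((s\<^sup>2) powr ((real n - 1) / 2 - 1) * (r\<^sup>2 - s\<^sup>2) powr (1 / 2 - 1)) * (2 * s) =
          ((s\<^sup>2) powr ((real n - 1) / 2 - 1) * s) * (r\<^sup>2 - s\<^sup>2) powr (- 1 / 2)"
        by simp
      also have "\<dots> = abel_kernel n 1 r s" by (simp only: e abel_kernel_1)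
      finally have "?f (s\<^sup>2) * ennreal (2 * s) = ennreal (abel_kernel n 1 r s)"
        using s by (subst ennreal_mult[symmetric]) auto
      with ne s show False by simp
    qed
  qed (auto intro!: emeasure_lborel_countable)
  finally show ?thesis ..
qed

lemma nn_integral_abel_kernel:
  assumes n: "2 \<le> n" and r: "0 < r"
  shows "(\<integral>\<^sup>+s. ennreal (abel_kernel n 1 r s) * indicator {0<..<r} s \<partial>lborel) =
    ennreal (r ^ (n - 2) / abel_const n 1)"
proof -
  let ?a = "(real n - 1) / 2"
  let ?B = "Beta ?a (1 / 2)"
  have half: "ennreal (1 / 2 * x) = ennreal (1 / 2) * ennreal x" for x
    by (rule ennreal_mult') simp
  have "(\<integral>\<^sup>+s. ennreal (abel_kernel n 1 r s) * indicator {0<..<r} s \<partial>lborel) =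
    (\<integral>\<^sup>+u. ennreal (1 / 2) * (ennreal (u powr (?a - 1) * (r\<^sup>2 - u) powr (1 / 2 - 1)) * indicator {0<..<r\<^sup>2} u) \<partial>lborel)"
    unfolding nn_integral_abel_kernel_square[OF n r]
    by (intro nn_integral_cong) (simp only: half mult.assoc)
  also have "\<dots> = ennreal (1 / 2) * ennreal (?B * (r\<^sup>2) powr (?a + 1 / 2 - 1))"
  proof -
    have "(\<integral>\<^sup>+u. ennreal (u powr (?a - 1) * (r\<^sup>2 - u) powr (1 / 2 - 1)) * indicator {0<..<r\<^sup>2} u \<partial>lborel) =
        ennreal (?B * (r\<^sup>2) powr (?a + 1 / 2 - 1))"
      by (rule nn_integral_Beta_scaled) (use n r in auto)
    then show ?thesis by (subst nn_integral_cmult, simp, simp only:)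
  qed
  also have "\<dots> = ennreal (r ^ (n - 2) / abel_const n 1)"
  proof -
    have "2 * (?a + 1 / 2 - 1) = real (n - 2)" using n by (simp add: of_nat_diff field_simps)
    then have "(r\<^sup>2) powr (?a + 1 / 2 - 1) = r powr (real (n - 2))"
      using r powr_powr[of r 2 "?a + 1 / 2 - 1"] by simp
    also have "\<dots> = r ^ (n - 2)" by (rule powr_realpow[OF r])
    finally have "ennreal (1 / 2) * ennreal (?B * (r\<^sup>2) powr (?a + 1 / 2 - 1)) =
        ennreal (1 / 2 * (?B * r ^ (n - 2)))"
      by (simp only: half)
    also have "1 / 2 * (?B * r ^ (n - 2)) = r ^ (n - 2) / abel_const n 1"
      unfolding abel_const_1[OF n] by simp
    finally show ?thesis .
  qed
  finally show ?thesis .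
qed

text \<open>The integral in the definition of \<open>abel_w\<close>. It is infinite at \<open>s = 1\<close>.\<close>

definition tail_integral :: "nat \<Rightarrow> real \<Rightarrow> ennreal" where
  "tail_integral n s = (\<integral>\<^sup>+v. ennreal (v powr (real n / 2 - 1) * (s\<^sup>2 - v) powr (- (3 / 2))) * indicator {0<..<1} v \<partial>lborel)"

lemma measurable_tail_integral [measurable]: "tail_integral n \<in> borel_measurable borel"
  unfolding tail_integral_def by measurable

lemma tail_integral_finite:
  assumes n: "2 \<le> n" and s: "1 < s"
  shows "tail_integral n s < \<infinity>"
proof -
  have "tail_integral n s \<le> (\<integral>\<^sup>+v. ennreal ((s\<^sup>2 - 1) powr (- (3 / 2))) * indicator {0<..<1::real} v \<partial>lborel)"
    unfolding tail_integral_def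
  proof (rule nn_integral_mono)
    fix v :: real
    have s2: "1 < s\<^sup>2" using s by simp
    show "ennreal (v powr (real n / 2 - 1) * (s\<^sup>2 - v) powr (- (3 / 2))) * indicator {0<..<1} v \<le>
      ennreal ((s\<^sup>2 - 1) powr (- (3 / 2))) * indicator {0<..<1} v"
    proof (cases "0 < v \<and> v < 1")
      case True
      have "v powr (real n / 2 - 1) \<le> 1" using True n by (intro powr_le1) auto
      moreover have "(s\<^sup>2 - v) powr (- (3 / 2)) \<le> (s\<^sup>2 - 1) powr (- (3 / 2))"
        using True s2 by (intro powr_mono2') auto
      ultimately have "v powr (real n / 2 - 1) * (s\<^sup>2 - v) powr (- (3 / 2)) \<le> 1 * (s\<^sup>2 - 1) powr (- (3 / 2))"
        by (intro mult_mono) auto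
      then show ?thesis using True by (simp add: ennreal_leI)
    qed (auto simp: indicator_def)
  qed
  also have "\<dots> < \<infinity>" by (simp add: nn_integral_cmult_indicator ennreal_mult_less_top)
  finally show ?thesis .
qed

lemma abel_w_tail:
  assumes s: "1 < s"
  shows "abel_w n s = - (Beta ((real n - 1) / 2) (1 / 2) / (2 * pi) * s powr (3 - real n) * enn2real (tail_integral n s))"
proof -
  let ?g = "\<lambda>v. v powr (real n / 2 - 1) * (s\<^sup>2 - v) powr (- (3 / 2))"
  have "(LINT v:{0..1}|lebesgue. ?g v) = (\<integral>v. indicator {0..1} v * ?g v \<partial>lborel)"
    unfolding set_lebesgue_integral_def real_scaleR_def by (rule integral_completion) simp
  also have "\<dots> = enn2real (\<integral>\<^sup>+v. ennreal (indicator {0..1} v * ?g v) \<partial>lborel)"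
    by (rule integral_eq_nn_integral) auto
  also have "(\<integral>\<^sup>+v. ennreal (indicator {0..1} v * ?g v) \<partial>lborel) = tail_integral n s"
    unfolding tail_integral_def
    by (intro nn_integral_cong_AE AE_I[where N = "{0, 1}"])
      (auto simp: indicator_def intro!: emeasure_lborel_countable)
  finally have L: "(LINT v:{0..1}|lebesgue. ?g v) = enn2real (tail_integral n s)" .
  have e: "(real n - 1) / 2 + 1 / 2 = real n / 2" by (simp add: field_simps)
  have "Beta ((real n - 1) / 2) (1 / 2) / (2 * pi) = Gamma ((real n - 1) / 2) / (2 * sqrt pi * Gamma (real n / 2))"
  proof -
    have "Gamma ((real n - 1) / 2) * sqrt pi / Gamma (real n / 2) / (2 * pi) =
        Gamma ((real n - 1) / 2) / (2 * Gamma (real n / 2)) * (sqrt pi / pi)"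
      by simp
    also have "sqrt pi / pi = 1 / sqrt pi" by (simp add: field_simps)
    finally show ?thesis unfolding Beta_def e Gamma_one_half_real by (simp add: mult_ac)
  qed
  then show ?thesis using s unfolding abel_w_def L by simp
qed

lemma abel_w_le_1: "s \<le> 1 \<Longrightarrow> abel_w n s = 1"
  by (simp add: abel_w_def)

lemma measurable_abel_w [measurable]: "abel_w n \<in> borel_measurable borel"
proof -
  have "abel_w n = (\<lambda>s. if s \<le> 1 then 1 else - (Beta ((real n - 1) / 2) (1 / 2) / (2 * pi) * s powr (3 - real n) * enn2real (tail_integral n s)))"
    by (auto simp: fun_eq_iff abel_w_le_1 abel_w_tail)
  then show ?thesis by simp
qed

lemma abel_w_nonpos: "2 \<le> n \<Longrightarrow> 1 < s \<Longrightarrow> abel_w n s \<le> 0"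
  using Beta_half_pos[of n] by (simp add: abel_w_tail)

lemma abel_w_tail_ennreal:
  assumes n: "2 \<le> n" and s: "1 < s"
  shows "ennreal (- abel_w n s) = ennreal (Beta ((real n - 1) / 2) (1 / 2) / (2 * pi) * s powr (3 - real n)) * tail_integral n s"
  unfolding abel_w_tail[OF s] minus_minus
  using tail_integral_finite[OF n s] Beta_half_pos[OF n]
  by (subst ennreal_mult') (simp_all add: ennreal_enn2real)

text \<open>This cancellation makes \<open>abel_w\<close> a solution for \<open>r > 1\<close>. In terms of hypergeometric
  functions it is an Euler transformation; here it is obtained by writing \<open>v powr (n/2 - 1)\<close> as
  a Beta integral in a new variable \<open>u\<close> and changing the order of integration twice, so that
  both sides become integrals of the same function of \<open>u\<close>.\<close>

lemma nn_integral_abel_w_tail: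
  assumes n: "2 \<le> n" and r: "1 < r"
  shows "(\<integral>\<^sup>+s. ennreal (abel_kernel n 1 r s) * ennreal (- abel_w n s) * indicator {1<..<r} s \<partial>lborel) =
    (\<integral>\<^sup>+s. ennreal (abel_kernel n 1 r s) * indicator {0<..<1} s \<partial>lborel)"
proof -
  let ?a = "(real n - 1) / 2"
  define B where "B = Beta ?a (1 / 2)"
  have B: "0 < B" using Beta_half_pos[OF n] by (simp add: B_def)
  have r2: "1 < r\<^sup>2" using r by simp
  let ?h = "\<lambda>s v. s / ((s\<^sup>2 - v) * sqrt (s\<^sup>2 - v) * sqrt (r\<^sup>2 - s\<^sup>2))"
  let ?q = "\<lambda>v. v powr (real n / 2 - 1)"
  let ?F = "\<lambda>s v. ennreal (B / (2 * pi) * ?q v) * indicator {0<..<1} v * (ennreal (?h s v) * indicator {1<..<r} s)"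
  have ph: "x powr (- (3 / 2)) = 1 / (x * sqrt x)" "x powr (- 1 / 2) = 1 / sqrt x" "x powr (1 / 2 - 1) = 1 / sqrt x"
    if "0 < x" for x :: real
  proof -
    show 1: "x powr (- 1 / 2) = 1 / sqrt x" using that by (simp add: powr_minus_divide powr_half_sqrt)
    then show "x powr (1 / 2 - 1) = 1 / sqrt x" by simp
    have "x powr (- (3 / 2)) = x powr (- 1) * x powr (- 1 / 2)"
      by (subst powr_add[symmetric]) simp
    then show "x powr (- (3 / 2)) = 1 / (x * sqrt x)" using that 1 by (simp add: powr_minus_divide)
  qed
  have "(\<integral>\<^sup>+s. ennreal (abel_kernel n 1 r s) * ennreal (- abel_w n s) * indicator {1<..<r} s \<partial>lborel) =
      (\<integral>\<^sup>+s. (\<integral>\<^sup>+v. ?F s v \<partial>lborel) \<partial>lborel)"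
  proof (rule nn_integral_cong)
    fix s :: real
    show "ennreal (abel_kernel n 1 r s) * ennreal (- abel_w n s) * indicator {1<..<r} s = (\<integral>\<^sup>+v. ?F s v \<partial>lborel)"
    proof (cases "1 < s \<and> s < r")
      case True
      then have s: "1 < s" "s < r" "1 < s\<^sup>2" "s\<^sup>2 < r\<^sup>2" by (auto intro: power_strict_mono)
      \<comment> \<open>The powers of \<open>s\<close> in the kernel and in front of the tail integral combine to \<open>s\<close>.\<close>
      define c where "c = abel_kernel n 1 r s * (B / (2 * pi) * s powr (3 - real n))"
      have c0: "0 \<le> c" using B s by (simp add: c_def abel_kernel_def)
      have "s ^ (n - 2) * s powr (3 - real n) = s powr (real (n - 2)) * s powr (3 - real n)"
        using s powr_realpow[of s "n - 2"] by simp
      also have "\<dots> = s" using n s by (simp add: of_nat_diff flip: powr_add)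
      finally have ss: "s ^ (n - 2) * s powr (3 - real n) = s" .
      have c: "c = B / (2 * pi) * (s / sqrt (r\<^sup>2 - s\<^sup>2))"
      proof -
        have "c = B / (2 * pi) * (s ^ (n - 2) * s powr (3 - real n)) * (r\<^sup>2 - s\<^sup>2) powr (- 1 / 2)"
          unfolding c_def abel_kernel_1 by (simp add: mult_ac)
        then show ?thesis unfolding ss using ph(2)[of "r\<^sup>2 - s\<^sup>2"] s by simp
      qed
      have "ennreal (abel_kernel n 1 r s) * ennreal (- abel_w n s) = ennreal c * tail_integral n s"
        using B s by (simp add: abel_w_tail_ennreal[OF n s(1)] c_def B_def abel_kernel_def mult.assoc[symmetric] flip: ennreal_mult)
      also have "\<dots> = (\<integral>\<^sup>+v. ennreal c * (ennreal (?q v * (s\<^sup>2 - v) powr (- (3 / 2))) * indicator {0<..<1} v) \<partial>lborel)"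
        unfolding tail_integral_def by (subst nn_integral_cmult) simp_all
      also have "\<dots> = (\<integral>\<^sup>+v. ?F s v \<partial>lborel)"
      proof (rule nn_integral_cong)
        fix v :: real
        show "ennreal c * (ennreal (?q v * (s\<^sup>2 - v) powr (- (3 / 2))) * indicator {0<..<1} v) = ?F s v"
        proof (cases "0 < v \<and> v < 1")
          case v: True
          then have p: "0 < s\<^sup>2 - v" using s(3) by linarith
          have "c * (?q v * (s\<^sup>2 - v) powr (- (3 / 2))) = B / (2 * pi) * ?q v * ?h s v"
            unfolding c ph(1)[OF p] by (simp add: mult_ac)
          then show ?thesis using v s B p c0
            by (simp flip: ennreal_mult)
        qed auto
      qed
      finally show ?thesis using s by simp
    qed auto
  qed
  also have "\<dots> = (\<integral>\<^sup>+v. (\<integral>\<^sup>+s. ?F s v \<partial>lborel) \<partial>lborel)"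
    by (rule lborel_pair.Fubini'[symmetric]) measurable
  also have "\<dots> = (\<integral>\<^sup>+v. (\<integral>\<^sup>+u. ennreal (sqrt (r\<^sup>2 - 1) / (2 * pi)) *
      (ennreal (u powr (?a - 1)) * indicator {0<..<1} u) *
      (ennreal (1 / (sqrt (v - u) * sqrt (1 - v) * (r\<^sup>2 - v))) * indicator {u<..<1} v) \<partial>lborel) \<partial>lborel)"
  proof (rule nn_integral_cong)
    fix v :: real
    show "(\<integral>\<^sup>+s. ?F s v \<partial>lborel) = (\<integral>\<^sup>+u. ennreal (sqrt (r\<^sup>2 - 1) / (2 * pi)) *
      (ennreal (u powr (?a - 1)) * indicator {0<..<1} u) *
      (ennreal (1 / (sqrt (v - u) * sqrt (1 - v) * (r\<^sup>2 - v))) * indicator {u<..<1} v) \<partial>lborel)"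
    proof (cases "0 < v \<and> v < 1")
      case True
      define m where "m = sqrt (r\<^sup>2 - 1) / ((r\<^sup>2 - v) * sqrt (1 - v))"
      have m: "0 \<le> m" using True r2 by (simp add: m_def)
      have Bq: "ennreal (B * ?q v) = (\<integral>\<^sup>+u. ennreal (u powr (?a - 1) * (v - u) powr (1 / 2 - 1)) * indicator {0<..<v} u \<partial>lborel)"
      proof -
        have "?a + 1 / 2 - 1 = real n / 2 - 1" by (simp add: field_simps)
        moreover have "0 < ?a" using n by simp
        ultimately show ?thesis using nn_integral_Beta_scaled[of ?a "1 / 2" v] True by (simp add: B_def)
      qed
      have "(\<integral>\<^sup>+s. ?F s v \<partial>lborel) = ennreal (B / (2 * pi) * ?q v) * ennreal m"
        using True by (subst nn_integral_cmult) (simp, simp add: nn_integral_abel_transform_of_pole[OF _ r] m_def)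
      also have "\<dots> = ennreal (m / (2 * pi)) * ennreal (B * ?q v)"
        using B m by (simp flip: ennreal_mult)
      also have "\<dots> = (\<integral>\<^sup>+u. ennreal (m / (2 * pi)) * (ennreal (u powr (?a - 1) * (v - u) powr (1 / 2 - 1)) * indicator {0<..<v} u) \<partial>lborel)"
        unfolding Bq by (subst nn_integral_cmult) simp_all
      also have "\<dots> = (\<integral>\<^sup>+u. ennreal (sqrt (r\<^sup>2 - 1) / (2 * pi)) *
          (ennreal (u powr (?a - 1)) * indicator {0<..<1} u) *
          (ennreal (1 / (sqrt (v - u) * sqrt (1 - v) * (r\<^sup>2 - v))) * indicator {u<..<1} v) \<partial>lborel)"
      proof (rule nn_integral_cong)
        fix u :: real
        show "ennreal (m / (2 * pi)) * (ennreal (u powr (?a - 1) * (v - u) powr (1 / 2 - 1)) * indicator {0<..<v} u) =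
          ennreal (sqrt (r\<^sup>2 - 1) / (2 * pi)) * (ennreal (u powr (?a - 1)) * indicator {0<..<1} u) *
          (ennreal (1 / (sqrt (v - u) * sqrt (1 - v) * (r\<^sup>2 - v))) * indicator {u<..<1} v)"
        proof (cases "0 < u \<and> u < v")
          case u: True
          have "m / (2 * pi) * (u powr (?a - 1) * (v - u) powr (1 / 2 - 1)) =
            sqrt (r\<^sup>2 - 1) / (2 * pi) * u powr (?a - 1) * (1 / (sqrt (v - u) * sqrt (1 - v) * (r\<^sup>2 - v)))"
            using ph(3)[of "v - u"] u by (simp add: m_def mult_ac)
          then show ?thesis using u True r2 m by (simp flip: ennreal_mult)
        qed (auto simp: indicator_def)
      qed
      finally show ?thesis .
    next
      case False
      then have "ennreal (sqrt (r\<^sup>2 - 1) / (2 * pi)) * (ennreal (u powr (?a - 1)) * indicator {0<..<1} u) *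
        (ennreal (1 / (sqrt (v - u) * sqrt (1 - v) * (r\<^sup>2 - v))) * indicator {u<..<1} v) = 0" for u
        by (auto simp: indicator_def)
      moreover have "?F s v = 0" for s using False by (auto simp: indicator_def)
      ultimately show ?thesis by (simp only: nn_integral_const mult_zero_left)
    qed
  qed
  also have "\<dots> = (\<integral>\<^sup>+u. (\<integral>\<^sup>+v. ennreal (sqrt (r\<^sup>2 - 1) / (2 * pi)) *
      (ennreal (u powr (?a - 1)) * indicator {0<..<1} u) *
      (ennreal (1 / (sqrt (v - u) * sqrt (1 - v) * (r\<^sup>2 - v))) * indicator {u<..<1} v) \<partial>lborel) \<partial>lborel)"
  proof (rule lborel_pair.Fubini')
    have ind: "(indicator {u<..<1} v :: ennreal) = (if u < v \<and> v < 1 then 1 else 0)" for u v :: real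
      by (auto simp: indicator_def)
    show "(\<lambda>(u, v). ennreal (sqrt (r\<^sup>2 - 1) / (2 * pi)) * (ennreal (u powr (?a - 1)) * indicator {0<..<1} u) *
      (ennreal (1 / (sqrt (v - u) * sqrt (1 - v) * (r\<^sup>2 - v))) * indicator {u<..<1} v))
      \<in> borel_measurable (lborel \<Otimes>\<^sub>M lborel)"
      unfolding ind by measurable
  qed
  also have "\<dots> = (\<integral>\<^sup>+u. ennreal (1 / 2 * (u powr (?a - 1) * (r\<^sup>2 - u) powr (1 / 2 - 1))) * indicator {0<..<1\<^sup>2} u \<partial>lborel)"
  proof (rule nn_integral_cong)
    fix u :: real
    show "(\<integral>\<^sup>+v. ennreal (sqrt (r\<^sup>2 - 1) / (2 * pi)) * (ennreal (u powr (?a - 1)) * indicator {0<..<1} u) *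
      (ennreal (1 / (sqrt (v - u) * sqrt (1 - v) * (r\<^sup>2 - v))) * indicator {u<..<1} v) \<partial>lborel) =
      ennreal (1 / 2 * (u powr (?a - 1) * (r\<^sup>2 - u) powr (1 / 2 - 1))) * indicator {0<..<1\<^sup>2} u"
    proof (cases "0 < u \<and> u < 1")
      case True
      have "(\<integral>\<^sup>+v. ennreal (sqrt (r\<^sup>2 - 1) / (2 * pi)) * (ennreal (u powr (?a - 1)) * indicator {0<..<1} u) *
        (ennreal (1 / (sqrt (v - u) * sqrt (1 - v) * (r\<^sup>2 - v))) * indicator {u<..<1} v) \<partial>lborel) =
        ennreal (sqrt (r\<^sup>2 - 1) / (2 * pi)) * ennreal (u powr (?a - 1)) * ennreal (pi / (sqrt (r\<^sup>2 - 1) * sqrt (r\<^sup>2 - u)))"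
        using True r2 by (subst nn_integral_cmult) (simp, simp add: nn_integral_arcsine_pole)
      also have "\<dots> = ennreal (1 / 2 * (u powr (?a - 1) * (r\<^sup>2 - u) powr (1 / 2 - 1)))"
      proof -
        have "sqrt (r\<^sup>2 - 1) \<noteq> 0" using r2 by simp
        then have "sqrt (r\<^sup>2 - 1) / (2 * pi) * u powr (?a - 1) * (pi / (sqrt (r\<^sup>2 - 1) * sqrt (r\<^sup>2 - u))) =
          1 / 2 * (u powr (?a - 1) * (r\<^sup>2 - u) powr (1 / 2 - 1))"
          using ph(3)[of "r\<^sup>2 - u"] True r2 by (simp add: field_simps)
        then show ?thesis using True r2 by (simp flip: ennreal_mult)
      qed
      finally show ?thesis using True by simp
    qed (auto simp: indicator_def)
  qed
  also have "\<dots> = (\<integral>\<^sup>+s. ennreal (abel_kernel n 1 r s) * indicator {0<..<1} s \<partial>lborel)"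
    by (rule nn_integral_abel_kernel_square[OF n, symmetric]) simp
  finally show ?thesis .
qed

section \<open>Solvability of the Abel equation\<close>

text \<open>The Abel integral of the positive part of \<open>abel_w\<close>, without the factor in front of the
  integral.\<close>

definition head_integral :: "nat \<Rightarrow> real \<Rightarrow> ennreal" where
  "head_integral n r = (\<integral>\<^sup>+s. ennreal (abel_kernel n 1 r s) * indicator {0<..<min 1 r} s \<partial>lborel)"

lemma abel_kernel_nonneg: "0 < s \<Longrightarrow> 0 \<le> abel_kernel n k r s"
  by (simp add: abel_kernel_def)

lemma measurable_abel_kernel [measurable]: "abel_kernel n k r \<in> borel_measurable borel"
  unfolding abel_kernel_def by measurable

lemma nn_integral_abel_w_pos:
  assumes n: "2 \<le> n" and r: "0 < r"
  shows "(\<integral>\<^sup>+s. ennreal (abel_kernel n 1 r s * indicator {0<..<r} s) * ennreal (abel_w n s) \<partial>lborel) = head_integral n r"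
  unfolding head_integral_def
proof (rule nn_integral_cong_AE, rule AE_I[where N = "{1}"])
  show "{s \<in> space lborel. ennreal (abel_kernel n 1 r s * indicator {0<..<r} s) * ennreal (abel_w n s) \<noteq>
      ennreal (abel_kernel n 1 r s) * indicator {0<..<min 1 r} s} \<subseteq> {1}"
  proof (safe, rule ccontr)
    fix s assume ne: "ennreal (abel_kernel n 1 r s * indicator {0<..<r} s) * ennreal (abel_w n s) \<noteq>
      ennreal (abel_kernel n 1 r s) * indicator {0<..<min 1 r} s" and "s \<noteq> 1"
    then consider "s < 1" | "1 < s" by linarith
    then show False
    proof cases
      case 1
      then show False using ne by (cases "0 < s \<and> s < r") (auto simp: abel_w_le_1)
    next
      case 2
      then have "ennreal (abel_w n s) = 0" using abel_w_nonpos[OF n] by (simp add: ennreal_neg)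
      then show False using ne 2 by simp
    qed
  qed
qed auto

lemma nn_integral_abel_w_neg:
  assumes n: "2 \<le> n" and r: "0 < r"
  shows "(\<integral>\<^sup>+s. ennreal (abel_kernel n 1 r s * indicator {0<..<r} s) * ennreal (- abel_w n s) \<partial>lborel) =
    (if r \<le> 1 then 0 else head_integral n r)"
proof -
  have *: "(\<integral>\<^sup>+s. ennreal (abel_kernel n 1 r s * indicator {0<..<r} s) * ennreal (- abel_w n s) \<partial>lborel) =
    (\<integral>\<^sup>+s. ennreal (abel_kernel n 1 r s) * ennreal (- abel_w n s) * indicator {1<..<r} s \<partial>lborel)"
    by (rule nn_integral_cong) (auto simp: indicator_def abel_w_le_1 ennreal_neg)
  show ?thesis
  proof (cases "r \<le> 1")
    case True
    then have "{1<..<r} = {}" by auto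
    then show ?thesis unfolding * using True by simp
  next
    case False
    then show ?thesis unfolding * head_integral_def using nn_integral_abel_w_tail[OF n, of r] by simp
  qed
qed

lemma head_integral_le:
  assumes n: "2 \<le> n" and r: "0 < r"
  shows "head_integral n r \<le> ennreal (r ^ (n - 2) / abel_const n 1)"
  unfolding head_integral_def nn_integral_abel_kernel[OF n r, symmetric]
  by (rule nn_integral_mono) (auto simp: indicator_def)

lemma head_integral_eq:
  assumes n: "2 \<le> n" and r: "0 < r" "r \<le> 1"
  shows "head_integral n r = ennreal (r ^ (n - 2) / abel_const n 1)"
  using nn_integral_abel_kernel[OF n r(1)] r(2) by (simp add: head_integral_def)

text \<open>For \<open>r \<ge> 2\<close> and \<open>s < 1\<close> the kernel \<open>(r\<^sup>2 - s\<^sup>2) powr (- 1/2)\<close> is at most \<open>2 / r\<close>.\<close>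

lemma head_integral_decay:
  assumes n: "2 \<le> n" and r: "2 \<le> r"
  shows "head_integral n r \<le> ennreal (2 / r)"
proof -
  have "head_integral n r \<le> (\<integral>\<^sup>+s. ennreal (2 / r) * indicator {0<..<1::real} s \<partial>lborel)"
    unfolding head_integral_def
  proof (rule nn_integral_mono)
    fix s :: real
    show "ennreal (abel_kernel n 1 r s) * indicator {0<..<min 1 r} s \<le> ennreal (2 / r) * indicator {0<..<1} s"
    proof (cases "0 < s \<and> s < 1")
      case True
      have "(r / 2)\<^sup>2 \<le> r\<^sup>2 - s\<^sup>2"
      proof -
        have "s\<^sup>2 \<le> 1" using True by (simp add: power_le_one)
        moreover have "4 \<le> r\<^sup>2" using power_mono[OF r, of 2] by simp
        ultimately show ?thesis by (simp add: power_divide)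
      qed
      then have "(r\<^sup>2 - s\<^sup>2) powr (- 1 / 2) \<le> ((r / 2)\<^sup>2) powr (- 1 / 2)"
        using r by (intro powr_mono2') auto
      also have "\<dots> = 2 / r"
        using r powr_powr[of "r / 2" 2 "- 1 / 2"] by (simp add: powr_minus_divide)
      finally have "(r\<^sup>2 - s\<^sup>2) powr (- 1 / 2) \<le> 2 / r" .
      moreover have "s ^ (n - 2) \<le> 1" using True by (simp add: power_le_one)
      ultimately have "abel_kernel n 1 r s \<le> 1 * (2 / r)"
        unfolding abel_kernel_1 using True by (intro mult_mono) auto
      then show ?thesis using True r by (simp add: ennreal_leI)
    qed (auto simp: indicator_def)
  qed
  also have "\<dots> = ennreal (2 / r)" by (simp add: nn_integral_cmult_indicator)
  finally show ?thesis .
qed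

lemma nn_abel_operator_head:
  assumes n: "2 \<le> n" and r: "0 < r"
  shows "nn_abel_operator n 1 (\<lambda>s. ennreal (abel_w n s)) r = ennreal (abel_const n 1 * r powr (2 - real n)) * head_integral n r"
    and "nn_abel_operator n 1 (\<lambda>s. ennreal (- abel_w n s)) r =
      (if r \<le> 1 then 0 else ennreal (abel_const n 1 * r powr (2 - real n)) * head_integral n r)"
  by (simp_all add: nn_abel_operator_def nn_integral_abel_w_pos[OF n r, simplified] nn_integral_abel_w_neg[OF n r, simplified])

lemma powr_two_minus:
  assumes n: "2 \<le> n" and r: "0 < r"
  shows "r powr (2 - real n) * r ^ (n - 2) = 1"
proof -
  have "r ^ (n - 2) = r powr (real (n - 2))" by (rule powr_realpow[OF r, symmetric])
  then show ?thesis using n r by (simp add: of_nat_diff flip: powr_add)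
qed

text \<open>The positive part of \<open>abel_w\<close> is at most 1, and the constant 1 has Abel transform 1.\<close>

lemma nn_abel_operator_pos_le_1:
  assumes n: "2 \<le> n" and r: "0 < r"
  shows "nn_abel_operator n 1 (\<lambda>s. ennreal (abel_w n s)) r \<le> 1"
    and "r \<le> 1 \<Longrightarrow> nn_abel_operator n 1 (\<lambda>s. ennreal (abel_w n s)) r = 1"
proof -
  have c: "abel_const n 1 \<noteq> 0" using abel_const_pos[of n 1] by linarith
  have e: "ennreal (abel_const n 1 * r powr (2 - real n)) * ennreal (r ^ (n - 2) / abel_const n 1) = 1"
    using c powr_two_minus[OF n r] by (subst ennreal_mult'[symmetric]) (simp_all add: less_imp_le)
  show "nn_abel_operator n 1 (\<lambda>s. ennreal (abel_w n s)) r \<le> 1"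
    unfolding nn_abel_operator_head(1)[OF n r] e[symmetric]
    by (rule mult_left_mono[OF head_integral_le[OF n r]]) simp
  show "nn_abel_operator n 1 (\<lambda>s. ennreal (abel_w n s)) r = 1" if "r \<le> 1"
    unfolding nn_abel_operator_head(1)[OF n r] head_integral_eq[OF n r that] by (rule e)
qed

text \<open>The exponent \<open>1 - n\<close> is what limits the admissible \<open>p\<close> to \<open>p < n\<close> in the end.\<close>

lemma nn_abel_operator_pos_decay:
  assumes n: "2 \<le> n" and r: "2 \<le> r"
  shows "nn_abel_operator n 1 (\<lambda>s. ennreal (abel_w n s)) r \<le> ennreal (2 * abel_const n 1 * r powr (1 - real n))"
proof -
  have r0: "0 < r" using r by simp
  have "r powr (1 - real n) * r powr 1 = r powr (2 - real n)" by (simp only: powr_add[symmetric]) simp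
  then have p: "r powr (2 - real n) = r powr (1 - real n) * r" using r0 by simp
  have "nn_abel_operator n 1 (\<lambda>s. ennreal (abel_w n s)) r \<le> ennreal (abel_const n 1 * r powr (2 - real n)) * ennreal (2 / r)"
    unfolding nn_abel_operator_head(1)[OF n r0]
    by (rule mult_left_mono[OF head_integral_decay[OF n r]]) simp
  also have "\<dots> = ennreal (2 * abel_const n 1 * r powr (1 - real n))"
    using r0 abel_const_pos[of n 1] by (subst ennreal_mult[symmetric]) (simp_all add: p less_imp_le mult_ac)
  finally show ?thesis .
qed

lemma abel_kernel_times_w:
  assumes n: "2 \<le> n" and r: "0 < r"
  shows "integrable lborel (\<lambda>s. indicator {0<..<r} s * (abel_kernel n 1 r s * abel_w n s))"
    and "abel_const n 1 * r powr (2 - real n) *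
      (\<integral>s. indicator {0<..<r} s * (abel_kernel n 1 r s * abel_w n s) \<partial>lborel) = psi r"
proof -
  let ?f = "\<lambda>s. indicator {0<..<r} s * (abel_kernel n 1 r s * abel_w n s)"
  have k: "0 \<le> abel_kernel n 1 r s * indicator {0<..<r} s" for s
    by (auto simp: indicator_def abel_kernel_nonneg)
  have P: "(\<integral>\<^sup>+s. ennreal (?f s) \<partial>lborel) = head_integral n r"
    unfolding nn_integral_abel_w_pos[OF n r, symmetric]
    by (intro nn_integral_cong, subst ennreal_mult'[OF k, symmetric]) (simp add: mult_ac)
  have N: "(\<integral>\<^sup>+s. ennreal (- ?f s) \<partial>lborel) = (if r \<le> 1 then 0 else head_integral n r)"
    unfolding nn_integral_abel_w_neg[OF n r, symmetric]
    by (intro nn_integral_cong, subst ennreal_mult'[OF k, symmetric]) (simp add: mult_ac)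
  have H: "head_integral n r < \<infinity>"
    using head_integral_le[OF n r] by (simp add: order_le_less_trans)
  show I: "integrable lborel ?f"
    unfolding real_integrable_def P N using H by auto
  have "(\<integral>s. ?f s \<partial>lborel) = enn2real (head_integral n r) - enn2real (if r \<le> 1 then 0 else head_integral n r)"
    by (subst real_lebesgue_integral_def[OF I]) (simp only: P N)
  also have "abel_const n 1 * r powr (2 - real n) * \<dots> = psi r"
  proof (cases "r \<le> 1")
    case True
    have "abel_const n 1 \<noteq> 0" using abel_const_pos[of n 1] by linarith
    then have "abel_const n 1 * r powr (2 - real n) * (r ^ (n - 2) / abel_const n 1) = 1"
      using powr_two_minus[OF n r] by simp
    then show ?thesis using True r abel_const_pos[of n 1]
      by (simp add: head_integral_eq[OF n r True] psi_def less_imp_le)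
  qed (simp add: psi_def)
  finally show "abel_const n 1 * r powr (2 - real n) * (\<integral>s. ?f s \<partial>lborel) = psi r" .
qed

lemma abel_solution_abel_w:
  assumes n: "2 \<le> n"
  shows "abel_solution n 1 psi (\<lambda>r. of_real (abel_w n r))"
  unfolding abel_solution_def
proof (intro conjI allI impI)
  have wm: "(\<lambda>r. complex_of_real (abel_w n r)) \<in> borel_measurable borel" by measurable
  then show "(\<lambda>r. complex_of_real (abel_w n r)) \<in> borel_measurable (lebesgue_on {0<..})"
    by (intro measurable_restrict_space1 measurable_completion) simp
  fix r :: real assume r: "0 < r"
  let ?f = "\<lambda>s. indicator {0<..<r} s * (abel_kernel n 1 r s * abel_w n s)"
  note f = abel_kernel_times_w[OF n r]
  have e: "indicator {0<..<r} s *\<^sub>R (complex_of_real (abel_kernel n 1 r s) * complex_of_real (abel_w n s)) =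
      complex_of_real (?f s)" for s
    by (simp add: scaleR_conv_of_real)
  have I: "integrable lebesgue ?f"
    by (rule integrable_completion[THEN iffD2, OF borel_measurable_integrable[OF f(1)] f(1)])
  show "set_integrable lebesgue {0<..<r} (\<lambda>s. complex_of_real (abel_kernel n 1 r s) * complex_of_real (abel_w n s))"
    unfolding set_integrable_def e by (intro integrable_of_real I)
  have "(LINT s:{0<..<r}|lebesgue. complex_of_real (abel_kernel n 1 r s) * complex_of_real (abel_w n s)) =
      complex_of_real (\<integral>s. ?f s \<partial>lebesgue)"
    unfolding set_lebesgue_integral_def e by (rule integral_of_real[OF I])
  also have "(\<integral>s. ?f s \<partial>lebesgue) = (\<integral>s. ?f s \<partial>lborel)"
    by (rule integral_completion) measurable
  finally show "complex_of_real (abel_const n 1 * r powr (2 - real n)) *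
      (LINT s:{0<..<r}|lebesgue. complex_of_real (abel_kernel n 1 r s) * complex_of_real (abel_w n s)) =
      complex_of_real (psi r)"
    using f(2) by (simp flip: of_real_mult)
  show "set_integrable lebesgue {0<..<r} (\<lambda>s. complex_of_real (s ^ (n - 1 - 1)) * complex_of_real (abel_w n s))"
    unfolding set_integrable_def
  proof (rule Bochner_Integration.integrable_bound)
    show "integrable lebesgue (\<lambda>s. r * ?f s)" using I by simp
    show "(\<lambda>s. indicator {0<..<r} s *\<^sub>R (complex_of_real (s ^ (n - 1 - 1)) * complex_of_real (abel_w n s)))
        \<in> borel_measurable lebesgue"
      by (intro measurable_completion) measurable
    show "AE s in lebesgue. norm (indicator {0<..<r} s *\<^sub>R (complex_of_real (s ^ (n - 1 - 1)) * complex_of_real (abel_w n s)))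
        \<le> norm (r * ?f s)"
    proof (rule AE_I2)
      fix s :: real
      show "norm (indicator {0<..<r} s *\<^sub>R (complex_of_real (s ^ (n - 1 - 1)) * complex_of_real (abel_w n s)))
        \<le> norm (r * ?f s)"
      proof (cases "0 < s \<and> s < r")
        case True
        then have "s\<^sup>2 < r\<^sup>2" by (intro power_strict_mono) auto
        have "1 = r * (r\<^sup>2) powr (- 1 / 2)"
          using r powr_powr[of r 2 "- 1 / 2"] by (simp add: powr_minus_divide)
        also have "\<dots> \<le> r * (r\<^sup>2 - s\<^sup>2) powr (- 1 / 2)"
          using r \<open>s\<^sup>2 < r\<^sup>2\<close> by (intro mult_left_mono powr_mono2') auto
        finally have "s ^ (n - 2) * 1 \<le> s ^ (n - 2) * (r * (r\<^sup>2 - s\<^sup>2) powr (- 1 / 2))"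
          using True by (intro mult_left_mono) auto
        then have "s ^ (n - 2) \<le> r * abel_kernel n 1 r s" by (simp add: abel_kernel_1[simplified] mult_ac)
        then have "s ^ (n - 2) * \<bar>abel_w n s\<bar> \<le> r * abel_kernel n 1 r s * \<bar>abel_w n s\<bar>"
          by (rule mult_right_mono) simp
        then show ?thesis using True r abel_kernel_nonneg[of s n 1 r]
          by (simp add: norm_mult norm_power abs_mult numeral_2_eq_2 mult_ac)
      qed auto
    qed
  qed
qed

text \<open>The integrals tend to the one for \<open>r = 1\<close> as \<open>r\<close> decreases to 1, because for \<open>k > 1\<close> they
  have the common majorant \<open>4 powr (k/2 - 1)\<close> times the integrable function \<open>s\<^sup>(n-k-1) |v(s)|\<close>.
  But they vanish for \<open>r > 1\<close> and not for \<open>r = 1\<close>.\<close>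

lemma no_abel_solution:
  assumes k: "1 < k" "k < n"
  shows "\<not> abel_solution n k psi v"
proof
  assume sol: "abel_solution n k psi v"
  let ?F = "\<lambda>r s. indicator {0<..<r} s *\<^sub>R (complex_of_real (abel_kernel n k r s) * v s)"
  let ?g = "\<lambda>s. indicator {0<..<2} s *\<^sub>R (complex_of_real (s ^ (n - k - 1)) * v s)"
  define \<rho> where "\<rho> j = 1 + 1 / real (Suc j)" for j
  have \<rho>: "1 < \<rho> j" "\<rho> j \<le> 2" for j by (simp_all add: \<rho>_def)
  have lim\<rho>: "\<rho> \<longlonglongrightarrow> 1"
  proof -
    have "(\<lambda>j. 1 + 1 / real (Suc j)) \<longlonglongrightarrow> 1 + 0"
      by (intro tendsto_add tendsto_const filterlim_compose[OF lim_1_over_n filterlim_Suc])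
    then show ?thesis by (simp add: \<rho>_def[abs_def])
  qed
  have I: "integrable lebesgue (?F r)" if "0 < r" for r
    using sol that by (simp add: abel_solution_def set_integrable_def)
  have G: "integrable lebesgue ?g"
    using sol unfolding abel_solution_def set_integrable_def by (metis zero_less_numeral)
  have eq: "complex_of_real (abel_const n k * r powr (2 - real n)) * (\<integral>s. ?F r s \<partial>lebesgue) = of_real (psi r)"
    if "0 < r" for r
    using sol that by (simp add: abel_solution_def set_lebesgue_integral_def)
  have zero: "(\<integral>s. ?F (\<rho> j) s \<partial>lebesgue) = 0" for j
    using eq[of "\<rho> j"] \<rho>[of j] abel_const_pos[of n k] by (auto simp: psi_def)
  have "(\<lambda>j. \<integral>s. ?F (\<rho> j) s \<partial>lebesgue) \<longlonglongrightarrow> (\<integral>s. ?F 1 s \<partial>lebesgue)"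
  proof (rule integral_dominated_convergence)
    show "?F 1 \<in> borel_measurable lebesgue" using I[of 1] by auto
    show "?F (\<rho> j) \<in> borel_measurable lebesgue" for j using I[of "\<rho> j"] \<rho>(1)[of j] by auto
    show "integrable lebesgue (\<lambda>s. 4 powr (real k / 2 - 1) * norm (?g s))"
      by (rule integrable_mult_right[OF integrable_norm[OF G]])
    show "AE s in lebesgue. norm (?F (\<rho> j) s) \<le> 4 powr (real k / 2 - 1) * norm (?g s)" for j
    proof (rule AE_I2)
      fix s :: real
      show "norm (?F (\<rho> j) s) \<le> 4 powr (real k / 2 - 1) * norm (?g s)"
      proof (cases "0 < s \<and> s < \<rho> j")
        case True
        then have s: "0 < s" "s < \<rho> j" "s < 2" using \<rho>[of j] by auto
        have "s\<^sup>2 < (\<rho> j)\<^sup>2" using s by (intro power_strict_mono) auto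
        moreover have "(\<rho> j)\<^sup>2 \<le> 4" using power_mono[of "\<rho> j" 2 2] \<rho>[of j] by simp
        moreover have "0 \<le> s\<^sup>2" by simp
        ultimately have "0 \<le> (\<rho> j)\<^sup>2 - s\<^sup>2" "(\<rho> j)\<^sup>2 - s\<^sup>2 \<le> 4" by linarith+
        then have "((\<rho> j)\<^sup>2 - s\<^sup>2) powr (real k / 2 - 1) \<le> 4 powr (real k / 2 - 1)"
          using k s by (intro powr_mono2) auto
        then have "s ^ (n - k - 1) * ((\<rho> j)\<^sup>2 - s\<^sup>2) powr (real k / 2 - 1) * norm (v s) \<le>
          s ^ (n - k - 1) * 4 powr (real k / 2 - 1) * norm (v s)"
          using s by (intro mult_right_mono mult_left_mono) auto
        then show ?thesis using s
          by (simp add: abel_kernel_def norm_mult norm_power abs_mult mult_ac)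
      qed (auto simp: indicator_def)
    qed
    have "AE s in lebesgue. s \<noteq> (1::real)"
      by (rule AE_completion, rule AE_lborel_singleton)
    then show "AE s in lebesgue. (\<lambda>j. ?F (\<rho> j) s) \<longlonglongrightarrow> ?F 1 s"
    proof eventually_elim
      case (elim s)
      show ?case
      proof (cases "0 < s \<and> s < 1")
        case True
        then have "s\<^sup>2 < 1" by (simp add: power_less_one_iff abs_square_less_1)
        then have "(\<lambda>j. ((\<rho> j)\<^sup>2 - s\<^sup>2) powr (real k / 2 - 1)) \<longlonglongrightarrow> (1\<^sup>2 - s\<^sup>2) powr (real k / 2 - 1)"
          by (intro tendsto_intros lim\<rho>) simp
        then have "(\<lambda>j. indicator {0<..<1} s *\<^sub>R (complex_of_real (abel_kernel n k (\<rho> j) s) * v s)) \<longlonglongrightarrow> ?F 1 s"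
          unfolding abel_kernel_def by (auto intro!: tendsto_intros)
        moreover have "s < \<rho> j" for j using True \<rho>(1)[of j] by simp
        ultimately show ?thesis using True by (simp add: indicator_def)
      next
        case False
        show ?thesis
        proof (cases "0 < s")
          case True
          then have "1 < s" using False elim by simp
          with lim\<rho> have "\<forall>\<^sub>F j in sequentially. \<rho> j < s" by (rule order_tendstoD)
          then have "\<forall>\<^sub>F j in sequentially. ?F (\<rho> j) s = ?F 1 s"
            by eventually_elim (use \<open>1 < s\<close> in auto)
          then show ?thesis by (rule tendsto_eventually)
        qed simp
      qed
    qed
  qed
  then have "(\<integral>s. ?F 1 s \<partial>lebesgue) = 0"
    unfolding zero by (simp add: LIMSEQ_const_iff)
  then show False using eq[of 1] by (simp add: psi_def)
qed

section \<open>The wavelet transform as a convolution\<close>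

lemma AE_lborel_affine:
  fixes t :: "'a :: euclidean_space"
  assumes c: "c \<noteq> 0" and P: "AE x in lborel. P x"
  shows "AE x in lborel. P (t + c *\<^sub>R x)"
proof -
  have "AE x in density (distr lborel borel (\<lambda>x. t + c *\<^sub>R x)) (\<lambda>_. \<bar>c\<bar> ^ DIM('a)). P x"
    using P by (simp only: lborel_affine[OF c, symmetric])
  then have "AE x in distr lborel borel (\<lambda>x. t + c *\<^sub>R x). P x"
    using c by (subst (asm) AE_density) auto
  then show ?thesis by (rule AE_distrD[rotated]) measurable
qed

lemma nn_integral_lborel_reflect:
  fixes f :: "'a :: euclidean_space \<Rightarrow> ennreal"
  assumes [measurable]: "f \<in> borel_measurable borel"
  shows "(\<integral>\<^sup>+y. f (x - y) \<partial>lborel) = (\<integral>\<^sup>+y. f y \<partial>lborel)"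
  by (subst lborel_affine[of "-1" x], simp, subst nn_integral_density) (auto simp: nn_integral_distr)

text \<open>Passing from functions that are merely measurable with respect to a completion to Borel
  representatives.\<close>

lemma completion_AE_eq:
  fixes f g :: "'a \<Rightarrow> 'b :: {banach, second_countable_topology}"
  assumes g: "g \<in> borel_measurable M" and eq: "AE x in M. f x = g x"
  shows "f \<in> borel_measurable (completion M)"
    and "integrable (completion M) f \<longleftrightarrow> integrable M g"
    and "(\<integral>x. f x \<partial>completion M) = (\<integral>x. g x \<partial>M)"
proof -
  have eq': "AE x in completion M. f x = g x" by (rule AE_completion[OF eq])
  have gc: "g \<in> borel_measurable (completion M)" by (rule measurable_completion[OF g])
  show fc: "f \<in> borel_measurable (completion M)"
  proof (rule measurableI)
    fix A :: "'b set" assume "A \<in> sets borel"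
    then have A: "g -` A \<inter> space (completion M) \<in> sets (completion M)" by (rule measurable_sets[OF gc])
    show "f -` A \<inter> space (completion M) \<in> sets (completion M)"
      by (rule completion.in_sets_AE[OF _ A]) (use eq' in \<open>eventually_elim; auto\<close>, auto)
  qed simp
  have "integrable (completion M) f \<longleftrightarrow> integrable (completion M) g"
    by (rule integrable_cong_AE[OF fc gc eq'])
  then show "integrable (completion M) f \<longleftrightarrow> integrable M g" by (simp add: integrable_completion[OF g])
  have "(\<integral>x. f x \<partial>completion M) = (\<integral>x. g x \<partial>completion M)"
    by (rule integral_cong_AE[OF fc gc eq'])
  then show "(\<integral>x. f x \<partial>completion M) = (\<integral>x. g x \<partial>M)" by (simp add: integral_completion[OF g])
qed

lemma lebesgue_measurable_ex_borel:
  fixes f :: "'a :: euclidean_space \<Rightarrow> complex"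
  assumes f: "f \<in> borel_measurable lebesgue"
  obtains g N where "g \<in> borel_measurable borel" "N \<in> null_sets lborel" "\<And>x. x \<notin> N \<Longrightarrow> f x = g x"
proof -
  obtain r where r: "r \<in> borel_measurable lborel" "AE x in lborel. Re (f x) = r x"
    using completion_ex_borel_measurable_real[of "\<lambda>x. Re (f x)" lborel] f by auto
  obtain i where i: "i \<in> borel_measurable lborel" "AE x in lborel. Im (f x) = i x"
    using completion_ex_borel_measurable_real[of "\<lambda>x. Im (f x)" lborel] f by auto
  have "AE x in lborel. f x = Complex (r x) (i x)"
    using r(2) i(2) by eventually_elim (simp add: complex_eq_iff)
  then obtain N where N: "N \<in> null_sets lborel" "{x \<in> space lborel. f x \<noteq> Complex (r x) (i x)} \<subseteq> N"
    by (auto elim!: AE_E simp: null_sets_def)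
  have "(\<lambda>x. Complex (r x) (i x)) \<in> borel_measurable borel"
    using r(1) i(1) by (subst borel_measurable_complex_iff) simp
  then show thesis using N by (intro that[of "\<lambda>x. Complex (r x) (i x)" N]) auto
qed

lemma infdist_kplane:
  fixes \<zeta> :: "(real ^ 'n) set"
  assumes V: "subspace \<zeta>" and z: "z \<in> \<zeta>\<^sup>\<bottom>"
  shows "infdist x (kplane (\<zeta>, z)) = norm (x - z - closest_point \<zeta> (x - z))"
proof -
  have ne: "\<zeta> \<noteq> {}" using subspace_0[OF V] by auto
  have "infdist x (kplane (\<zeta>, z)) = infdist (x - z) \<zeta>"
    using ne by (simp add: infdist_def kplane_def image_image dist_norm algebra_simps)
  also have "\<dots> = dist (x - z) (closest_point \<zeta> (x - z))"
    using setdist_closest_point[OF closed_subspace[OF V] ne] by (simp add: infdist_eq_setdist)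
  finally show ?thesis by (simp add: dist_norm)
qed

context invariant_grassmann
begin

interpretation pair_sigma_finite \<mu> "lborel :: (real ^ 'n) measure" ..

text \<open>The integrand of the wavelet transform, lifted to pairs of a direction and a point: here
  the plane is the one with the given direction through the given point.\<close>

definition kernel_lift :: "(real ^ 'n \<Rightarrow> complex) \<Rightarrow> (real \<Rightarrow> real) \<Rightarrow> real \<Rightarrow> real ^ 'n
    \<Rightarrow> (real ^ 'n) set \<times> (real ^ 'n) \<Rightarrow> complex" where
  "kernel_lift f w a x = (\<lambda>p. f (snd p) * of_real (w (norm (x - snd p - closest_point (fst p) (x - snd p)) / a)))"

lemma measurable_kernel_lift:
  assumes [measurable]: "f \<in> borel_measurable borel" "w \<in> borel_measurable borel"
  shows "kernel_lift f w a x \<in> borel_measurable (\<mu> \<Otimes>\<^sub>M lborel)"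
proof -
  have [measurable]: "(\<lambda>p. closest_point (fst p) (x - snd p)) \<in> borel_measurable (\<mu> \<Otimes>\<^sub>M lborel)"
    by (rule measurable_compose[OF _ measurable_pair_projection(1), of "\<lambda>p. (fst p, x - snd p)", simplified])
      measurable
  show ?thesis unfolding kernel_lift_def by measurable
qed

text \<open>The distance from a subspace is homogeneous, so the dilation parameter can be moved into
  the argument of the mean over the directions.\<close>

lemma norm_scaled_distance:
  assumes \<zeta>: "\<zeta> \<in> grassmannian k" and a: "0 < a"
  shows "norm (x - y - closest_point \<zeta> (x - y)) / a =
    norm ((x /\<^sub>R a + (- (1 / a)) *\<^sub>R y) - closest_point \<zeta> (x /\<^sub>R a + (- (1 / a)) *\<^sub>R y))"
proof -
  \<comment> \<open>The affine form of the argument matches the invariance of null sets under affine maps.\<close>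
  have z: "x /\<^sub>R a + (- (1 / a)) *\<^sub>R y = (1 / a) *\<^sub>R (x - y)"
    by (simp add: algebra_simps divide_inverse)
  have c: "closest_point \<zeta> ((1 / a) *\<^sub>R (x - y)) = (1 / a) *\<^sub>R closest_point \<zeta> (x - y)"
    by (rule linear_cmul[OF linear_closest_point[OF grassmannianD(1)[OF \<zeta>]]])
  have "(1 / a) *\<^sub>R (x - y) - closest_point \<zeta> ((1 / a) *\<^sub>R (x - y)) =
      (1 / a) *\<^sub>R (x - y - closest_point \<zeta> (x - y))"
    unfolding c by (simp only: scaleR_diff_right)
  then show ?thesis unfolding z using a by simp
qed

lemma kernel_lift_integrable:
  assumes [measurable]: "f \<in> borel_measurable borel" "w \<in> borel_measurable borel" and a: "0 < a"
    and fin: "(\<integral>\<^sup>+y. ennreal (norm (f y)) *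
        mean_distance (\<lambda>s. ennreal \<bar>w s\<bar>) (x /\<^sub>R a + (- (1 / a)) *\<^sub>R y) \<partial>lborel) < \<infinity>"
  shows "integrable (\<mu> \<Otimes>\<^sub>M lborel) (kernel_lift f w a x)"
proof (rule integrableI_bounded)
  note [measurable] = measurable_kernel_lift[of f w a x]
  let ?z = "\<lambda>y. x /\<^sub>R a + (- (1 / a)) *\<^sub>R y"
  show "kernel_lift f w a x \<in> borel_measurable (\<mu> \<Otimes>\<^sub>M lborel)" by measurable
  have "(\<integral>\<^sup>+p. ennreal (norm (kernel_lift f w a x p)) \<partial>(\<mu> \<Otimes>\<^sub>M lborel)) =
      (\<integral>\<^sup>+y. (\<integral>\<^sup>+\<zeta>. ennreal (norm (kernel_lift f w a x (\<zeta>, y))) \<partial>\<mu>) \<partial>lborel)"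
    by (rule nn_integral_snd[symmetric]) measurable
  also have "\<dots> = (\<integral>\<^sup>+y. ennreal (norm (f y)) * mean_distance (\<lambda>s. ennreal \<bar>w s\<bar>) (?z y) \<partial>lborel)"
  proof (rule nn_integral_cong)
    fix y :: "real ^ 'n"
    have "(\<integral>\<^sup>+\<zeta>. ennreal (norm (kernel_lift f w a x (\<zeta>, y))) \<partial>\<mu>) =
        (\<integral>\<^sup>+\<zeta>. ennreal (norm (f y)) * ennreal \<bar>w (norm (?z y - closest_point \<zeta> (?z y)))\<bar> \<partial>\<mu>)"
    proof (rule nn_integral_cong)
      fix \<zeta> assume "\<zeta> \<in> space \<mu>"
      then have \<zeta>: "\<zeta> \<in> grassmannian k" by simp
      show "ennreal (norm (kernel_lift f w a x (\<zeta>, y))) =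
          ennreal (norm (f y)) * ennreal \<bar>w (norm (?z y - closest_point \<zeta> (?z y)))\<bar>"
        unfolding kernel_lift_def fst_conv snd_conv norm_scaled_distance[OF \<zeta> a]
        by (simp add: norm_mult ennreal_mult)
    qed
    also have "\<dots> = ennreal (norm (f y)) * mean_distance (\<lambda>s. ennreal \<bar>w s\<bar>) (?z y)"
      unfolding mean_distance_def by (rule nn_integral_cmult, rule measurable_distance) measurable
    finally show "(\<integral>\<^sup>+\<zeta>. ennreal (norm (kernel_lift f w a x (\<zeta>, y))) \<partial>\<mu>) = \<dots>" .
  qed
  also have "\<dots> < \<infinity>" by (rule fin)
  finally show "(\<integral>\<^sup>+p. ennreal (norm (kernel_lift f w a x p)) \<partial>(\<mu> \<Otimes>\<^sub>M lborel)) < \<infinity>" .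
qed

lemma integral_kernel_lift:
  assumes I: "integrable (\<mu> \<Otimes>\<^sub>M lborel) (kernel_lift f w a x)" and a: "0 < a"
    and f: "f \<in> borel_measurable borel" and \<psi>: "\<psi> \<in> borel_measurable borel"
    and mean: "AE z in lborel. (\<integral>\<zeta>. w (norm (z - closest_point \<zeta> z)) \<partial>\<mu>) = \<psi> (norm z)"
  shows "(\<integral>p. kernel_lift f w a x p \<partial>(\<mu> \<Otimes>\<^sub>M lborel)) = (\<integral>y. f y * of_real (\<psi> (norm (x - y) / a)) \<partial>lborel)"
proof -
  let ?z = "\<lambda>y. x /\<^sub>R a + (- (1 / a)) *\<^sub>R y"
  note [measurable] = f \<psi>
  have "(\<integral>p. kernel_lift f w a x p \<partial>(\<mu> \<Otimes>\<^sub>M lborel)) =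
      (\<integral>y. (\<integral>\<zeta>. kernel_lift f w a x (\<zeta>, y) \<partial>\<mu>) \<partial>lborel)"
    using integral_snd[of "\<lambda>\<zeta> y. kernel_lift f w a x (\<zeta>, y)"] I by simp
  also have "\<dots> = (\<integral>y. f y * of_real (\<psi> (norm (x - y) / a)) \<partial>lborel)"
  proof (rule integral_cong_AE)
    show "(\<lambda>y. \<integral>\<zeta>. kernel_lift f w a x (\<zeta>, y) \<partial>\<mu>) \<in> borel_measurable lborel"
      using integrable_snd[of "\<lambda>\<zeta> y. kernel_lift f w a x (\<zeta>, y)"] I by auto
    have "AE y in lborel. (\<integral>\<zeta>. w (norm (?z y - closest_point \<zeta> (?z y))) \<partial>\<mu>) = \<psi> (norm (?z y))"
      by (rule AE_lborel_affine[OF _ mean]) (use a in simp)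
    then show "AE y in lborel. (\<integral>\<zeta>. kernel_lift f w a x (\<zeta>, y) \<partial>\<mu>) = f y * of_real (\<psi> (norm (x - y) / a))"
    proof eventually_elim
      case (elim y)
      have "(\<integral>\<zeta>. kernel_lift f w a x (\<zeta>, y) \<partial>\<mu>) =
          (\<integral>\<zeta>. f y * of_real (w (norm (?z y - closest_point \<zeta> (?z y)))) \<partial>\<mu>)"
      proof (rule Bochner_Integration.integral_cong[OF refl])
        fix \<zeta> assume "\<zeta> \<in> space \<mu>"
        then have \<zeta>: "\<zeta> \<in> grassmannian k" by simp
        show "kernel_lift f w a x (\<zeta>, y) = f y * of_real (w (norm (?z y - closest_point \<zeta> (?z y))))"
          unfolding kernel_lift_def fst_conv snd_conv norm_scaled_distance[OF \<zeta> a] ..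
      qed
      also have "\<dots> = f y * of_real (\<psi> (norm (?z y)))"
        by (simp only: integral_mult_right_zero integral_complex_of_real elim)
      also have "norm (?z y) = norm (x - y) / a"
      proof -
        have "?z y = (1 / a) *\<^sub>R (x - y)" by (simp add: algebra_simps divide_inverse)
        then show ?thesis using a by simp
      qed
      finally show ?case .
    qed
  qed measurable
  finally show ?thesis .
qed

text \<open>On a plane the distance from \<open>x\<close> is constant, so the weight can be moved into the integral
  over the plane.\<close>

lemma wavelet_integrand_eq_fibre_integral:
  fixes f :: "real ^ 'n \<Rightarrow> complex"
  assumes [measurable]: "g \<in> borel_measurable borel" "w \<in> borel_measurable borel" and N: "N \<in> null_sets lborel"
    and fg: "\<And>x. x \<notin> N \<Longrightarrow> f x = g x"
  shows "AE \<tau> in borel_affine_grassmann k \<mu>. wavelet_integrand (\<lambda>r. of_real (w r)) a (kplane_transform f) x \<tau> =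
    (\<integral>y. kernel_lift g w a x (fst \<tau>, y + snd \<tau>) \<partial>borel_subspace (fst \<tau>))"
  using AE_affine_grassmann_null_fibre[OF N] AE_space
proof eventually_elim
  case (elim \<tau>)
  then have \<zeta>: "fst \<tau> \<in> grassmannian k" and z: "snd \<tau> \<in> (fst \<tau>)\<^sup>\<bottom>"
    by (auto simp: affine_grassmannian_def)
  note V = grassmannianD(1)[OF \<zeta>]
  note lin = linear_closest_point[OF V]
  let ?d = "norm (x - snd \<tau> - closest_point (fst \<tau>) (x - snd \<tau>))"
  note [measurable] = measurable_closest_point_subspace[OF V]
  have "AE y in borel_subspace (fst \<tau>). f (y + snd \<tau>) = g (y + snd \<tau>)"
    using elim(1) by eventually_elim (simp add: fg)
  then have kt: "kplane_transform f \<tau> = (\<integral>y. g (y + snd \<tau>) \<partial>borel_subspace (fst \<tau>))"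
    unfolding kplane_transform_def lebesgue_subspace_eq_completion by (intro completion_AE_eq) measurable
  have "infdist x (kplane \<tau>) = ?d" using infdist_kplane[OF V z] by simp
  then have "wavelet_integrand (\<lambda>r. of_real (w r)) a (kplane_transform f) x \<tau> =
      (\<integral>y. g (y + snd \<tau>) * of_real (w (?d / a)) \<partial>borel_subspace (fst \<tau>))"
    by (simp add: wavelet_integrand_def kt)
  also have "\<dots> = (\<integral>y. kernel_lift g w a x (fst \<tau>, y + snd \<tau>) \<partial>borel_subspace (fst \<tau>))"
  proof (rule integral_cong_AE)
    show "AE y in borel_subspace (fst \<tau>). g (y + snd \<tau>) * of_real (w (?d / a)) = kernel_lift g w a x (fst \<tau>, y + snd \<tau>)"
      using AE_borel_subspace_mem[OF V]
    proof eventually_elim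
      case (elim y)
      have "closest_point (fst \<tau>) y = y" using closest_point_subspace_add[OF V elim, of 0] by (simp add: subspace_0 subspace_orthogonal_comp)
      then have c: "closest_point (fst \<tau>) (x - snd \<tau> - y) = closest_point (fst \<tau>) (x - snd \<tau>) - y"
        by (simp only: linear_diff[OF lin])
      have "x - (y + snd \<tau>) = x - snd \<tau> - y" by simp
      moreover have "x - snd \<tau> - y - (closest_point (fst \<tau>) (x - snd \<tau>) - y) =
          x - snd \<tau> - closest_point (fst \<tau>) (x - snd \<tau>)"
        by simp
      ultimately show ?case unfolding kernel_lift_def fst_conv snd_conv by (simp only: c)
    qed
  qed (unfold kernel_lift_def fst_conv snd_conv, measurable)
  finally show ?case .
qed

text \<open>The combination of \<open>fibre_integral\<close> with Fubini in the other order, where the integral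
  over the directions comes first and gives the mean.\<close>

theorem wavelet_transform_eq_convolution:
  fixes f :: "real ^ 'n \<Rightarrow> complex"
  assumes G: "grassmann_measure k = \<mu>"
    and g: "g \<in> borel_measurable borel" and w: "w \<in> borel_measurable borel" and N: "N \<in> null_sets lborel"
    and fg: "\<And>x. x \<notin> N \<Longrightarrow> f x = g x" and a: "0 < a" and \<psi>: "\<psi> \<in> borel_measurable borel"
    and fin: "(\<integral>\<^sup>+y. ennreal (norm (g y)) *
        mean_distance (\<lambda>s. ennreal \<bar>w s\<bar>) (x /\<^sub>R a + (- (1 / a)) *\<^sub>R y) \<partial>lborel) < \<infinity>"
    and mean: "AE z in lborel. (\<integral>\<zeta>. w (norm (z - closest_point \<zeta> z)) \<partial>\<mu>) = \<psi> (norm z)"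
  shows "integrable (affine_grassmann_measure k) (wavelet_integrand (\<lambda>r. of_real (w r)) a (kplane_transform f) x)"
    and "wavelet_transform k (\<lambda>r. of_real (w r)) a (kplane_transform f) x =
      of_real (1 / a ^ CARD('n)) * (\<integral>y. g y * of_real (\<psi> (norm (x - y) / a)) \<partial>lborel)"
proof -
  have A: "affine_grassmann_measure k = completion (borel_affine_grassmann k \<mu>)"
    unfolding affine_grassmann_measure_def G borel_affine_grassmann_eq_measure_of ..
  note I = kernel_lift_integrable[OF g w a fin]
  note F = fibre_integral[OF I]
  have ae: "AE \<tau> in borel_affine_grassmann k \<mu>. wavelet_integrand (\<lambda>r. of_real (w r)) a (kplane_transform f) x \<tau> =
      (\<integral>y. kernel_lift g w a x (fst \<tau>, y + snd \<tau>) \<partial>borel_subspace (fst \<tau>))"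
    by (rule wavelet_integrand_eq_fibre_integral[OF g w N]) (simp add: fg)
  note E = completion_AE_eq[OF borel_measurable_integrable[OF F(1)] ae]
  show "integrable (affine_grassmann_measure k) (wavelet_integrand (\<lambda>r. of_real (w r)) a (kplane_transform f) x)"
    unfolding A by (rule E(2)[THEN iffD2, OF F(1)])
  show "wavelet_transform k (\<lambda>r. of_real (w r)) a (kplane_transform f) x =
      of_real (1 / a ^ CARD('n)) * (\<integral>y. g y * of_real (\<psi> (norm (x - y) / a)) \<partial>lborel)"
    unfolding wavelet_transform_def A E(3) F(2) integral_kernel_lift[OF I a g \<psi> mean] ..
qed

end

section \<open>Reduction to ball means\<close>

text \<open>In polar coordinates the integrand is \<open>r\<^sup>(n-1)\<close> near the origin and \<open>r powr (n - 1 - e)\<close>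
  at infinity, with exponent less than -1.\<close>

lemma nn_integral_radial_decay_finite:
  assumes a: "0 < a" and e: "real CARD('n) < e"
  shows "(\<integral>\<^sup>+y. ennreal ((max 1 (norm y / a)) powr (- e)) \<partial>(lborel :: (real ^ 'n) measure)) < \<infinity>"
proof -
  let ?n = "CARD('n)"
  let ?C = "real ?n * unit_ball_vol (real ?n)"
  have C: "0 \<le> ?C" by simp
  have n1: "real (?n - 1) = real ?n - 1" by (simp add: of_nat_diff)
  have "(\<integral>\<^sup>+y. ennreal ((max 1 (norm y / a)) powr (- e)) \<partial>(lborel :: (real ^ 'n) measure)) =
      (\<integral>\<^sup>+r. ennreal ((max 1 (r / a)) powr (- e)) \<partial>distr (lborel :: (real ^ 'n) measure) borel norm)"
    by (subst nn_integral_distr) auto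
  also have "\<dots> = (\<integral>\<^sup>+r. ennreal (?C * r ^ (?n - 1) * indicator {0<..} r) * ennreal ((max 1 (r / a)) powr (- e)) \<partial>lborel)"
    unfolding distr_norm_lborel by (subst nn_integral_density) simp_all
  also have "\<dots> \<le> (\<integral>\<^sup>+r. ennreal (?C * a ^ (?n - 1)) * indicator {0..a} r +
      ennreal (?C * a powr e) * ennreal (indicator {a..} r * r powr (real ?n - 1 - e)) \<partial>lborel)"
  proof (rule nn_integral_mono)
    fix r :: real
    consider "r \<le> 0" | "0 < r" "r \<le> a" | "a < r" "0 < r" using a by linarith
    then show "ennreal (?C * r ^ (?n - 1) * indicator {0<..} r) * ennreal ((max 1 (r / a)) powr (- e)) \<le>
      ennreal (?C * a ^ (?n - 1)) * indicator {0..a} r +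
      ennreal (?C * a powr e) * ennreal (indicator {a..} r * r powr (real ?n - 1 - e))"
    proof cases
      case 2
      then have "max 1 (r / a) = 1" using a by simp
      moreover have "?C * r ^ (?n - 1) \<le> ?C * a ^ (?n - 1)"
        using 2 C by (intro mult_left_mono power_mono) auto
      ultimately have "ennreal (?C * r ^ (?n - 1) * indicator {0<..} r) * ennreal ((max 1 (r / a)) powr (- e)) \<le>
        ennreal (?C * a ^ (?n - 1)) * indicator {0..a} r"
        using 2 by (simp add: ennreal_leI)
      then show ?thesis by (rule order_trans) simp
    next
      case 3
      then have m: "max 1 (r / a) = r / a" using a by simp
      have "?C * r ^ (?n - 1) * (r / a) powr (- e) = ?C * a powr e * r powr (real ?n - 1 - e)"
      proof -
        have "r ^ (?n - 1) = r powr (real ?n - 1)" using powr_realpow[OF 3(2), of "?n - 1"] by (simp add: n1)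
        moreover have "(r / a) powr (- e) = r powr (- e) * a powr e"
          using 3 a by (simp add: powr_divide powr_minus_divide)
        moreover have "r powr (real ?n - 1) * r powr (- e) = r powr (real ?n - 1 - e)"
          by (simp flip: powr_add)
        ultimately show ?thesis by (simp add: mult_ac)
      qed
      then have "ennreal (?C * r ^ (?n - 1) * indicator {0<..} r) * ennreal ((max 1 (r / a)) powr (- e)) =
        ennreal (?C * a powr e) * ennreal (indicator {a..} r * r powr (real ?n - 1 - e))"
        using 3 C by (simp add: m flip: ennreal_mult)
      then show ?thesis by simp
    qed simp
  qed
  also have "\<dots> = ennreal (?C * a ^ (?n - 1)) * emeasure lborel {0..a} +
      ennreal (?C * a powr e) * (\<integral>\<^sup>+r. ennreal (indicator {a..} r * r powr (real ?n - 1 - e)) \<partial>lborel)"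
    by (subst nn_integral_add) (simp_all add: nn_integral_cmult nn_integral_cmult_indicator)
  also have "(\<integral>\<^sup>+r. ennreal (indicator {a..} r * r powr (real ?n - 1 - e)) \<partial>lborel) =
      ennreal (- (a powr (real ?n - 1 - e + 1)) / (real ?n - 1 - e + 1))"
    by (rule nn_integral_has_integral_lebesgue[OF _ has_integral_powr_to_inf]) (use a e in auto)
  also have "ennreal (?C * a ^ (?n - 1)) * emeasure lborel {0..a} +
      ennreal (?C * a powr e) * ennreal (- (a powr (real ?n - 1 - e + 1)) / (real ?n - 1 - e + 1)) < \<infinity>"
    using a by (simp add: ennreal_mult_less_top)
  finally show ?thesis .
qed

text \<open>Beyond the unit ball the positive and the negative part of \<open>abel_w\<close> have the same mean.
  Inside it the negative part has mean 0 and the positive part has mean 1. So their difference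
  is \<open>psi\<close>, and their sum is at most twice the mean of the positive part, for which bounds are
  known.\<close>

lemma abel_w_mean_bound:
  fixes \<mu> :: "(real ^ 'n) set measure"
  assumes n: "2 \<le> CARD('n)" and \<mu>: "invariant_grassmann \<mu> 1"
  shows "AE z in lborel. (\<integral>\<zeta>. abel_w CARD('n) (norm (z - closest_point \<zeta> z)) \<partial>\<mu>) = psi (norm z)"
    and "AE z in lborel. invariant_grassmann.mean_distance \<mu> (\<lambda>s. ennreal \<bar>abel_w CARD('n) s\<bar>) z \<le>
      ennreal ((2 ^ CARD('n) + 4 * abel_const CARD('n) 1) * (max 1 (norm z)) powr (1 - real CARD('n)))"
proof -
  let ?n = "CARD('n)"
  let ?w = "abel_w ?n"
  interpret invariant_grassmann \<mu> 1 by (rule \<mu>)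
  let ?P = "nn_abel_operator ?n 1 (\<lambda>s. ennreal (?w s))"
  let ?N = "nn_abel_operator ?n 1 (\<lambda>s. ennreal (- ?w s))"
  have N: "?N r = (if r \<le> 1 then 0 else ?P r)" if "0 < r" for r
    using nn_abel_operator_head[OF n that] by simp
  have "AE z in lborel. mean_distance (\<lambda>s. ennreal (?w s)) (z :: real ^ 'n) = ?P (norm z)"
    by (rule AE_mean_distance_eq_abel[OF n]) (use n in auto)
  moreover have "AE z in lborel. mean_distance (\<lambda>s. ennreal (- ?w s)) (z :: real ^ 'n) = ?N (norm z)"
    by (rule AE_mean_distance_eq_abel[OF n]) (use n in auto)
  moreover have "AE z in lborel. z \<noteq> (0 :: real ^ 'n)" by (rule AE_lborel_singleton)
  ultimately have both: "AE z in lborel. z \<noteq> (0 :: real ^ 'n) \<and> mean_distance (\<lambda>s. ennreal (?w s)) z = ?P (norm z) \<and>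
      mean_distance (\<lambda>s. ennreal (- ?w s)) z = ?N (norm z)"
    by eventually_elim simp
  have meas: "(\<lambda>\<zeta>. ?w (norm (z - closest_point \<zeta> z))) \<in> borel_measurable \<mu>" for z :: "real ^ 'n"
    by (rule measurable_distance) measurable
  show "AE z in lborel. (\<integral>\<zeta>. ?w (norm (z - closest_point \<zeta> z)) \<partial>\<mu>) = psi (norm z)"
    using both
  proof eventually_elim
    case (elim z)
    then have z: "0 < norm z" by simp
    have P: "(\<integral>\<^sup>+\<zeta>. ennreal (?w (norm (z - closest_point \<zeta> z))) \<partial>\<mu>) = ?P (norm z)"
      and N': "(\<integral>\<^sup>+\<zeta>. ennreal (- ?w (norm (z - closest_point \<zeta> z))) \<partial>\<mu>) = ?N (norm z)"
      using elim by (simp_all add: mean_distance_def)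
    have fin: "?P (norm z) < \<infinity>"
      using nn_abel_operator_pos_le_1(1)[OF n z] by (simp add: order_le_less_trans[OF _ ennreal_one_less_top])
    have finN: "?N (norm z) < \<infinity>" unfolding N[OF z] using fin by simp
    have I: "integrable \<mu> (\<lambda>\<zeta>. ?w (norm (z - closest_point \<zeta> z)))"
      unfolding real_integrable_def P N' using meas fin finN by (auto simp: less_top)
    have "(\<integral>\<zeta>. ?w (norm (z - closest_point \<zeta> z)) \<partial>\<mu>) = enn2real (?P (norm z)) - enn2real (?N (norm z))"
      by (subst real_lebesgue_integral_def[OF I]) (simp only: P N')
    also have "\<dots> = psi (norm z)"
      unfolding N[OF z] psi_def using nn_abel_operator_pos_le_1(2)[OF n z] by simp
    finally show ?case .
  qed
  \<comment> \<open>The first summand covers \<open>|z| < 2\<close>, where \<open>max 1 |z|\<close> is at most 2, and the second one the decay for larger \<open>z\<close>.\<close>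
  let ?K = "2 ^ ?n + 4 * abel_const ?n 1"
  have c: "0 < abel_const ?n 1" by (rule abel_const_pos)
  show "AE z in lborel. mean_distance (\<lambda>s. ennreal \<bar>?w s\<bar>) z \<le>
      ennreal (?K * (max 1 (norm z)) powr (1 - real ?n))"
    using both
  proof eventually_elim
    case (elim z)
    then have z: "0 < norm z" by simp
    have abs: "ennreal \<bar>x\<bar> = ennreal x + ennreal (- x)" for x :: real
      by (cases "0 \<le> x") (simp_all add: ennreal_neg)
    have "mean_distance (\<lambda>s. ennreal \<bar>?w s\<bar>) z = ?P (norm z) + ?N (norm z)"
      using elim meas unfolding mean_distance_def abs by (subst nn_integral_add) auto
    also have "\<dots> \<le> 2 * ?P (norm z)" unfolding N[OF z] by (simp add: mult_2)
    also have "\<dots> \<le> ennreal (?K * (max 1 (norm z)) powr (1 - real ?n))"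
    proof (cases "norm z < 2")
      case True
      have "2 \<le> 2 ^ ?n * (2::real) powr (1 - real ?n)"
        by (simp add: powr_diff powr_realpow)
      also have "\<dots> \<le> 2 ^ ?n * (max 1 (norm z)) powr (1 - real ?n)"
        using True n by (intro mult_left_mono powr_mono2') auto
      also have "\<dots> \<le> ?K * (max 1 (norm z)) powr (1 - real ?n)"
        by (intro mult_right_mono) (auto simp: less_imp_le[OF abel_const_pos])
      finally have "ennreal 2 \<le> ennreal (?K * (max 1 (norm z)) powr (1 - real ?n))" by (rule ennreal_leI)
      moreover have "2 * ?P (norm z) \<le> 2 * 1"
        by (rule mult_left_mono[OF nn_abel_operator_pos_le_1(1)[OF n z]]) simp
      then have "2 * ?P (norm z) \<le> ennreal 2" by simp
      ultimately show ?thesis by (rule order_trans[rotated])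
    next
      case False
      then have r: "2 \<le> norm z" by simp
      have "2 * ?P (norm z) \<le> 2 * ennreal (2 * abel_const ?n 1 * norm z powr (1 - real ?n))"
        by (rule mult_left_mono[OF nn_abel_operator_pos_decay[OF n r]]) simp
      also have "\<dots> = ennreal (4 * abel_const ?n 1 * norm z powr (1 - real ?n))"
        by (subst ennreal_numeral[symmetric], subst ennreal_mult'[symmetric]) (simp_all add: mult.assoc)
      also have "\<dots> \<le> ennreal (?K * (max 1 (norm z)) powr (1 - real ?n))"
        using r by (intro ennreal_leI mult_mono) (auto simp: max_def less_imp_le[OF abel_const_pos])
      finally show ?thesis .
    qed
    finally show ?case .
  qed
qed

text \<open>By Young's inequality it suffices that the conjugate power of the second factor is
  integrable. The conjugate exponent \<open>q = p / (p - 1)\<close> satisfies \<open>(n - 1) q > n\<close> exactly for \<open>p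
  < n\<close>. For \<open>p = 1\<close> boundedness is enough.\<close>

lemma Lp_times_decay_finite:
  fixes g :: "real ^ 'n \<Rightarrow> complex"
  assumes n: "2 \<le> CARD('n)" and p: "1 \<le> p" "p < real CARD('n)" and a: "0 < a" and K: "0 \<le> K"
    and [measurable]: "g \<in> borel_measurable borel" and gp: "integrable lborel (\<lambda>y. norm (g y) powr p)"
  shows "(\<integral>\<^sup>+y. ennreal (norm (g y)) *
    ennreal (K * (max 1 (norm (x - y) / a)) powr (1 - real CARD('n))) \<partial>lborel) < \<infinity>"
proof -
  let ?n = "CARD('n)"
  let ?b = "\<lambda>y. (max 1 (norm (x - y) / a)) powr (1 - real ?n)"
  have fin: "(\<integral>\<^sup>+y. ennreal (norm (g y) powr p) \<partial>lborel) < \<infinity>"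
    using gp by (simp add: integrable_iff_bounded)
  show ?thesis
  proof (cases "p = 1")
    case True
    have "(\<integral>\<^sup>+y. ennreal (norm (g y)) * ennreal (K * ?b y) \<partial>lborel) \<le>
        (\<integral>\<^sup>+y. ennreal K * ennreal (norm (g y) powr p) \<partial>lborel)"
    proof (rule nn_integral_mono)
      fix y :: "real ^ 'n"
      have "?b y \<le> 1 powr (1 - real ?n)" using n by (intro powr_mono2') auto
      then have "norm (g y) * (K * ?b y) \<le> norm (g y) * (K * 1)"
        using K by (intro mult_left_mono) auto
      then show "ennreal (norm (g y)) * ennreal (K * ?b y) \<le> ennreal K * ennreal (norm (g y) powr p)"
        using K True by (simp add: mult.commute ennreal_leI flip: ennreal_mult)
    qed
    also have "\<dots> < \<infinity>" using fin by (simp add: nn_integral_cmult ennreal_mult_less_top)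
    finally show ?thesis .
  next
    case False
    then have p1: "1 < p" using p by simp
    define q where "q = p / (p - 1)"
    have q: "1 < q" "1 / p + 1 / q = 1" using p1 by (simp_all add: q_def field_simps)
    define e where "e = (real ?n - 1) * q"
    have e: "real ?n < e" using p p1 by (simp add: e_def q_def field_simps)
    have "(\<integral>\<^sup>+y. ennreal (norm (g y)) * ennreal (K * ?b y) \<partial>lborel) \<le>
        (\<integral>\<^sup>+y. ennreal (norm (g y) powr p) + ennreal (K powr q) * ennreal ((max 1 (norm (x - y) / a)) powr (- e)) \<partial>lborel)"
    proof (rule nn_integral_mono)
      fix y :: "real ^ 'n"
      have "norm (g y) * (K * ?b y) \<le> norm (g y) powr p / p + (K * ?b y) powr q / q"
        using K by (intro Youngs_inequality p1 q) auto
      also have "\<dots> \<le> norm (g y) powr p + (K * ?b y) powr q"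
        using p1 q(1) by (intro add_mono) (simp_all add: divide_le_eq mult_le_cancel_left1)
      also have "(K * ?b y) powr q = K powr q * (max 1 (norm (x - y) / a)) powr (- e)"
        using K by (simp add: powr_mult powr_powr e_def algebra_simps)
      finally show "ennreal (norm (g y)) * ennreal (K * ?b y) \<le>
          ennreal (norm (g y) powr p) + ennreal (K powr q) * ennreal ((max 1 (norm (x - y) / a)) powr (- e))"
        using K by (simp add: ennreal_leI flip: ennreal_mult ennreal_plus)
    qed
    also have "\<dots> = (\<integral>\<^sup>+y. ennreal (norm (g y) powr p) \<partial>lborel) +
        ennreal (K powr q) * (\<integral>\<^sup>+y. ennreal ((max 1 (norm (x - y) / a)) powr (- e)) \<partial>lborel)"
      by (subst nn_integral_add) (simp_all add: nn_integral_cmult)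
    also have "(\<integral>\<^sup>+y. ennreal ((max 1 (norm (x - y) / a)) powr (- e)) \<partial>lborel) =
        (\<integral>\<^sup>+y. ennreal ((max 1 (norm y / a)) powr (- e)) \<partial>(lborel :: (real ^ 'n) measure))"
      by (rule nn_integral_lborel_reflect) measurable
    also have "(\<integral>\<^sup>+y. ennreal (norm (g y) powr p) \<partial>lborel) + ennreal (K powr q) * \<dots> < \<infinity>"
      using fin nn_integral_radial_decay_finite[OF a e] by (simp add: ennreal_mult_less_top)
    finally show ?thesis .
  qed
qed

lemma invariant_grassmann_lines: "invariant_grassmann (grassmann_measure 1 :: (real ^ 'n) set measure) 1"
proof -
  have "invariant_grassmann_prob 1 (grassmann_measure 1 :: (real ^ 'n) set measure)"
    by (rule invariant_grassmann_prob_lines)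
  then show ?thesis
    unfolding invariant_grassmann_prob_def invariant_grassmann_def grassmann_prob_def
      grassmann_prob_axioms_def invariant_grassmann_axioms_def by blast
qed

theorem wavelet_transform_eq_ball_integral:
  fixes f g :: "real ^ 'n \<Rightarrow> complex"
  assumes n: "2 \<le> CARD('n)" and p: "1 \<le> p" "p < real CARD('n)" and a: "0 < a"
    and g[measurable]: "g \<in> borel_measurable borel" and gp: "integrable lborel (\<lambda>y. norm (g y) powr p)"
    and N: "N \<in> null_sets lborel" and fg: "\<And>x. x \<notin> N \<Longrightarrow> f x = g x"
  shows "integrable (affine_grassmann_measure 1)
      (wavelet_integrand (\<lambda>r. of_real (abel_w CARD('n) r)) a (kplane_transform f) x)"
    and "wavelet_transform 1 (\<lambda>r. of_real (abel_w CARD('n) r)) a (kplane_transform f) x =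
      of_real (1 / a ^ CARD('n)) * (\<integral>y. indicator (cball x a) y *\<^sub>R g y \<partial>lborel)"
proof -
  let ?n = "CARD('n)"
  let ?\<mu> = "grassmann_measure 1 :: (real ^ 'n) set measure"
  interpret G: invariant_grassmann ?\<mu> 1 by (rule invariant_grassmann_lines)
  let ?K = "2 ^ ?n + 4 * abel_const ?n 1"
  let ?z = "\<lambda>y. x /\<^sub>R a + (- (1 / a)) *\<^sub>R y"
  have K: "0 \<le> ?K" by (simp add: less_imp_le[OF abel_const_pos])
  have nz: "norm (?z y) = norm (x - y) / a" for y
  proof -
    have "?z y = (1 / a) *\<^sub>R (x - y)" by (simp add: algebra_simps divide_inverse)
    then show ?thesis using a by simp
  qed
  have "AE y in lborel. G.mean_distance (\<lambda>s. ennreal \<bar>abel_w ?n s\<bar>) (?z y) \<le>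
      ennreal (?K * (max 1 (norm (?z y))) powr (1 - real ?n))"
    by (rule AE_lborel_affine[OF _ abel_w_mean_bound(2)[OF n G.invariant_grassmann_axioms]]) (use a in simp)
  then have "AE y in lborel. ennreal (norm (g y)) * G.mean_distance (\<lambda>s. ennreal \<bar>abel_w ?n s\<bar>) (?z y) \<le>
      ennreal (norm (g y)) * ennreal (?K * (max 1 (norm (x - y) / a)) powr (1 - real ?n))"
  proof eventually_elim
    case (elim y)
    then show ?case unfolding nz by (rule mult_left_mono) simp
  qed
  then have "(\<integral>\<^sup>+y. ennreal (norm (g y)) * G.mean_distance (\<lambda>s. ennreal \<bar>abel_w ?n s\<bar>) (?z y) \<partial>lborel) \<le>
      (\<integral>\<^sup>+y. ennreal (norm (g y)) * ennreal (?K * (max 1 (norm (x - y) / a)) powr (1 - real ?n)) \<partial>lborel)"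
    by (rule nn_integral_mono_AE)
  also have "\<dots> < \<infinity>" by (rule Lp_times_decay_finite[OF n p a K g gp])
  finally have fin: "(\<integral>\<^sup>+y. ennreal (norm (g y)) *
      G.mean_distance (\<lambda>s. ennreal \<bar>abel_w ?n s\<bar>) (?z y) \<partial>lborel) < \<infinity>" .
  have psi: "psi \<in> borel_measurable borel" unfolding psi_def by measurable
  note W = G.wavelet_transform_eq_convolution[OF refl g measurable_abel_w N _ a psi fin
      abel_w_mean_bound(1)[OF n G.invariant_grassmann_axioms]]
  show "integrable (affine_grassmann_measure 1)
      (wavelet_integrand (\<lambda>r. of_real (abel_w ?n r)) a (kplane_transform f) x)"
    by (rule W(1)) (rule fg)
  have "wavelet_transform 1 (\<lambda>r. of_real (abel_w ?n r)) a (kplane_transform f) x =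
      of_real (1 / a ^ ?n) * (\<integral>y. g y * of_real (psi (norm (x - y) / a)) \<partial>lborel)"
    by (rule W(2)) (rule fg)
  also have "(\<integral>y. g y * of_real (psi (norm (x - y) / a)) \<partial>lborel) = (\<integral>y. indicator (cball x a) y *\<^sub>R g y \<partial>lborel)"
  proof (rule Bochner_Integration.integral_cong[OF refl])
    fix y
    show "g y * of_real (psi (norm (x - y) / a)) = indicator (cball x a) y *\<^sub>R g y"
      using a by (simp add: psi_def indicator_def dist_norm)
  qed
  finally show "wavelet_transform 1 (\<lambda>r. of_real (abel_w ?n r)) a (kplane_transform f) x =
      of_real (1 / a ^ ?n) * (\<integral>y. indicator (cball x a) y *\<^sub>R g y \<partial>lborel)" .
qed

section \<open>Lebesgue points\<close>

text \<open>Reflections in coordinate hyperplanes. They carry the statement that averages over small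
  cubes with corner \<open>x\<close> converge from the positive orthant to the other orthants, and the cubes
  in all orthants together cover a ball about \<open>x\<close>.\<close>

definition sign_flip :: "('a :: euclidean_space \<Rightarrow> real) \<Rightarrow> 'a \<Rightarrow> 'a" where
  "sign_flip c x = (\<Sum>j\<in>Basis. (c j * (x \<bullet> j)) *\<^sub>R j)"

abbreviation "signs \<equiv> (Basis :: 'a :: euclidean_space set) \<rightarrow>\<^sub>E {1, - 1 :: real}"

lemma signsD: "c \<in> signs \<Longrightarrow> b \<in> Basis \<Longrightarrow> c b = 1 \<or> c b = - 1"
  by (auto simp: PiE_iff)

lemma inner_sign_flip: "b \<in> Basis \<Longrightarrow> sign_flip c x \<bullet> b = c b * (x \<bullet> b)"
  by (simp add: sign_flip_def inner_sum_left inner_Basis if_distrib cong: if_cong)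

lemma sign_flip_involution: "c \<in> signs \<Longrightarrow> sign_flip c (sign_flip c x) = x"
  by (rule euclidean_eqI) (auto simp: inner_sign_flip dest: signsD)

lemma measurable_sign_flip [measurable]: "sign_flip c \<in> borel_measurable borel"
  unfolding sign_flip_def by measurable

lemma measurable_indicator_sign_flip [measurable]:
  "A \<in> sets borel \<Longrightarrow> (\<lambda>y. indicator A (sign_flip c y) :: ennreal) \<in> borel_measurable borel"
  by (rule measurable_compose[OF measurable_sign_flip]) simp

lemma distr_sign_flip:
  assumes c: "c \<in> signs"
  shows "distr lborel borel (sign_flip c) = (lborel :: 'a :: euclidean_space measure)"
proof -
  have "lborel = density (distr lborel borel (\<lambda>x :: 'a. 0 + (\<Sum>j\<in>Basis. (c j * (x \<bullet> j)) *\<^sub>R j)))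
      (\<lambda>_. (\<Prod>j\<in>(Basis :: 'a set). \<bar>c j\<bar>))"
  proof (rule lborel_affine_euclidean)
    show "c j \<noteq> 0" if "j \<in> Basis" for j using signsD[OF c that] by auto
  qed
  also have "(\<Prod>j\<in>(Basis :: 'a set). \<bar>c j\<bar>) = 1"
    by (rule prod.neutral) (use signsD[OF c] in fastforce)
  finally show ?thesis by (simp add: sign_flip_def[abs_def] density_1)
qed

lemma AE_sign_flip:
  assumes c: "c \<in> signs" and P: "AE x in lborel. P (x :: 'a :: euclidean_space)"
  shows "AE x in lborel. P (sign_flip c x)"
proof -
  have "AE x in distr lborel borel (sign_flip c). P x" using P by (simp only: distr_sign_flip[OF c])
  then show ?thesis by (rule AE_distrD[rotated]) measurable
qed

lemma nn_integral_sign_flip: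
  assumes c: "c \<in> signs" and [measurable]: "f \<in> borel_measurable borel"
  shows "(\<integral>\<^sup>+x. f (sign_flip c x) \<partial>lborel) = (\<integral>\<^sup>+x. f x \<partial>(lborel :: 'a :: euclidean_space measure))"
proof -
  have "(\<integral>\<^sup>+x. f x \<partial>lborel) = (\<integral>\<^sup>+x. f x \<partial>distr lborel borel (sign_flip c))"
    by (simp only: distr_sign_flip[OF c])
  then show ?thesis by (simp add: nn_integral_distr)
qed

lemma cball_sets_borel [measurable]: "cball x r \<in> sets borel"
  by (rule borel_closed[OF closed_cball])

lemma cball_covered_by_orthants:
  fixes x y :: "'a :: euclidean_space"
  assumes y: "y \<in> cball x h"
  shows "\<exists>c\<in>signs. sign_flip c y \<in> cbox (sign_flip c x) (sign_flip c x + h *\<^sub>R One)"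
proof -
  \<comment> \<open>The orthant of \<open>y\<close> as seen from \<open>x\<close>.\<close>
  define c where "c = (\<lambda>b\<in>(Basis :: 'a set). if x \<bullet> b \<le> y \<bullet> b then 1 else - 1 :: real)"
  have c: "c \<in> signs" by (auto simp: c_def)
  have "\<bar>y \<bullet> b - x \<bullet> b\<bar> \<le> h" if "b \<in> Basis" for b
    using Basis_le_norm[OF that, of "y - x"] y by (simp add: dist_norm norm_minus_commute inner_diff_left)
  then have "y \<bullet> b \<le> x \<bullet> b + h" "- (y \<bullet> b) \<le> h - x \<bullet> b" if "b \<in> Basis" for b
    using that by (fastforce simp: abs_le_iff)+
  then have "sign_flip c y \<in> cbox (sign_flip c x) (sign_flip c x + h *\<^sub>R One)"
    by (auto simp: mem_box inner_sign_flip inner_add_left c_def inner_diff_left)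
  with c show ?thesis by blast
qed

lemma locally_integrable_diff:
  fixes g :: "'a :: euclidean_space \<Rightarrow> complex"
  assumes [measurable]: "g \<in> borel_measurable borel"
    and loc: "\<And>r. (\<integral>\<^sup>+y. ennreal (norm (g y)) * indicator (cball 0 r) y \<partial>lborel) < \<infinity>"
    and c: "c \<in> signs"
  shows "set_integrable lborel (cbox a b) (\<lambda>y. norm (g (sign_flip c y) - q))"
proof -
  obtain r where r: "cbox a b \<subseteq> cball 0 r"
    using bounded_subset_ballD[OF bounded_cbox, of a b 0] ball_subset_cball by blast
  have nr: "norm (sign_flip c y) = norm y" for y :: 'a
  proof -
    have "(sign_flip c y \<bullet> b)\<^sup>2 = (y \<bullet> b)\<^sup>2" if "b \<in> Basis" for b
      using signsD[OF c that] by (auto simp: inner_sign_flip[OF that])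
    then show ?thesis
      using euclidean_dist_l2[of "sign_flip c y" 0] euclidean_dist_l2[of y 0] by (simp add: L2_set_def)
  qed
  have "integrable lborel (\<lambda>y. indicator (cbox a b) y * norm (g (sign_flip c y) - q))"
  proof (rule integrableI_bounded)
    have "(\<integral>\<^sup>+y. ennreal (norm (indicator (cbox a b) y * norm (g (sign_flip c y) - q))) \<partial>lborel) \<le>
        (\<integral>\<^sup>+y. ennreal (norm (g (sign_flip c y))) * indicator (cball 0 r) (sign_flip c y) +
          ennreal (norm q) * indicator (cball 0 r) y \<partial>lborel)"
    proof (rule nn_integral_mono)
      fix y :: 'a
      have "ennreal (norm (g (sign_flip c y) - q)) \<le> ennreal (norm (g (sign_flip c y))) + ennreal (norm q)"
        by (simp add: norm_triangle_ineq4 ennreal_leI flip: ennreal_plus)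
      then show "ennreal (norm (indicator (cbox a b) y * norm (g (sign_flip c y) - q))) \<le>
        ennreal (norm (g (sign_flip c y))) * indicator (cball 0 r) (sign_flip c y) +
          ennreal (norm q) * indicator (cball 0 r) y"
        using r by (cases "y \<in> cbox a b") (auto simp: nr indicator_def)
    qed
    also have "\<dots> = (\<integral>\<^sup>+y. ennreal (norm (g (sign_flip c y))) * indicator (cball 0 r) (sign_flip c y) \<partial>lborel) +
        ennreal (norm q) * emeasure lborel (cball (0 :: 'a) r)"
      by (subst nn_integral_add; (measurable; fail | simp add: nn_integral_cmult_indicator))
    also have "(\<integral>\<^sup>+y. ennreal (norm (g (sign_flip c y))) * indicator (cball 0 r) (sign_flip c y) \<partial>lborel) =
        (\<integral>\<^sup>+y. ennreal (norm (g y)) * indicator (cball 0 r) y \<partial>lborel)"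
      by (rule nn_integral_sign_flip[OF c]) measurable
    also have "\<dots> + ennreal (norm q) * emeasure lborel (cball (0 :: 'a) r) < \<infinity>"
      using loc[of r] emeasure_lborel_cball_finite[of "0 :: 'a" r] by (simp add: ennreal_mult_less_top)
    finally show "(\<integral>\<^sup>+y. ennreal (norm (indicator (cbox a b) y * norm (g (sign_flip c y) - q))) \<partial>lborel) < \<infinity>" .
  qed measurable
  then show ?thesis by (simp add: set_integrable_def)
qed

text \<open>Cube differentiation for the reflected function, transported back by the reflection.\<close>

lemma orthant_average_converges:
  fixes g :: "'a :: euclidean_space \<Rightarrow> complex"
  assumes g[measurable]: "g \<in> borel_measurable borel"
    and loc: "\<And>r. (\<integral>\<^sup>+y. ennreal (norm (g y)) * indicator (cball 0 r) y \<partial>lborel) < \<infinity>"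
    and c: "c \<in> signs"
  shows "AE x in lborel. \<forall>e>0. \<exists>d>0. \<forall>h. 0 < h \<and> h < d \<longrightarrow>
    (\<integral>\<^sup>+y. ennreal (norm (g y - q)) * indicator (cbox (sign_flip c x) (sign_flip c x + h *\<^sub>R One)) (sign_flip c y) \<partial>lborel)
      \<le> ennreal ((norm (g x - q) + e) * h ^ DIM('a))"
proof -
  let ?k = "\<lambda>y. norm (g (sign_flip c y) - q)"
  have si: "set_integrable lborel (cbox a b) ?k" for a b
    by (rule locally_integrable_diff[OF g loc c])
  have int: "?k integrable_on cbox a b" for a b
    using set_borel_integral_eq_integral(1)[OF si] .
  obtain N where N: "negligible N" and lim: "\<And>x e. \<lbrakk>x \<notin> N; 0 < e\<rbrakk> \<Longrightarrow>
      \<exists>d>0. \<forall>h. 0 < h \<and> h < d \<longrightarrow> norm (integral (cbox x (x + h *\<^sub>R One)) ?k /\<^sub>R h ^ DIM('a) - ?k x) < e"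
    using integrable_ccontinuous_explicit[OF int] by metis
  have "AE x in lebesgue. x \<notin> N"
    using N by (simp add: negligible_iff_null_sets AE_not_in)
  then have "AE x in lborel. x \<notin> N" by (simp add: AE_completion_iff)
  then have "AE x in lborel. sign_flip c x \<notin> N" by (rule AE_sign_flip[OF c])
  then show ?thesis
  proof eventually_elim
    case (elim x)
    let ?x = "sign_flip c x"
    show ?case
    proof (intro allI impI)
      fix e :: real assume e: "0 < e"
      obtain d where d: "0 < d" and *: "\<And>h. 0 < h \<Longrightarrow> h < d \<Longrightarrow>
          norm (integral (cbox ?x (?x + h *\<^sub>R One)) ?k /\<^sub>R h ^ DIM('a) - ?k ?x) < e"
        using lim[OF elim e] by blast
      show "\<exists>d>0. \<forall>h. 0 < h \<and> h < d \<longrightarrow>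
        (\<integral>\<^sup>+y. ennreal (norm (g y - q)) * indicator (cbox ?x (?x + h *\<^sub>R One)) (sign_flip c y) \<partial>lborel)
          \<le> ennreal ((norm (g x - q) + e) * h ^ DIM('a))"
      proof (intro exI conjI allI impI)
        fix h assume h: "0 < h \<and> h < d"
        let ?B = "cbox ?x (?x + h *\<^sub>R One)"
        have "\<bar>integral ?B ?k / h ^ DIM('a) - norm (g x - q)\<bar> < e"
          using *[of h] h by (simp add: sign_flip_involution[OF c] divide_inverse_commute)
        then have "integral ?B ?k / h ^ DIM('a) \<le> norm (g x - q) + e" by linarith
        then have le: "integral ?B ?k \<le> (norm (g x - q) + e) * h ^ DIM('a)"
          using h by (simp add: pos_divide_le_eq)
        have "(\<integral>\<^sup>+y. ennreal (norm (g y - q)) * indicator ?B (sign_flip c y) \<partial>lborel) =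
            (\<integral>\<^sup>+y. ennreal (norm (g (sign_flip c (sign_flip c y)) - q)) * indicator ?B (sign_flip c y) \<partial>lborel)"
          by (simp add: sign_flip_involution[OF c])
        also have "\<dots> = (\<integral>\<^sup>+y. ennreal (?k y) * indicator ?B y \<partial>lborel)"
          by (rule nn_integral_sign_flip[OF c, of "\<lambda>y. ennreal (?k y) * indicator ?B y"]) measurable
        also have "\<dots> = (\<integral>\<^sup>+y. ennreal (indicator ?B y * ?k y) \<partial>lborel)"
          by (intro nn_integral_cong) (auto simp: indicator_def)
        also have "\<dots> = ennreal (integral ?B ?k)"
          by (rule nn_integral_has_integral_lebesgue[OF _ integrable_integral[OF int]]) simp
        also have "\<dots> \<le> ennreal ((norm (g x - q) + e) * h ^ DIM('a))" by (rule ennreal_leI[OF le])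
        finally show "(\<integral>\<^sup>+y. ennreal (norm (g y - q)) * indicator ?B (sign_flip c y) \<partial>lborel) \<le> \<dots>" .
      qed (rule d)
    qed
  qed
qed

text \<open>Applying the convergence of averages to \<open>|g - q|\<close> for all \<open>q\<close> in a countable dense set,
  rather than to \<open>g\<close>, gives control of the mean oscillation: for \<open>q\<close> close to \<open>g x\<close> both the
  average of \<open>|g - q|\<close> and the difference of \<open>q\<close> and \<open>g x\<close> are small.\<close>

theorem AE_Lebesgue_point:
  fixes g :: "'a :: euclidean_space \<Rightarrow> complex"
  assumes g[measurable]: "g \<in> borel_measurable borel"
    and loc: "\<And>r. (\<integral>\<^sup>+y. ennreal (norm (g y)) * indicator (cball 0 r) y \<partial>lborel) < \<infinity>"
  shows "AE x in lborel. \<forall>e>0. \<exists>d>0. \<forall>h. 0 < h \<and> h < d \<longrightarrow>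
    (\<integral>\<^sup>+y. ennreal (norm (g y - g x)) * indicator (cball x h) y \<partial>lborel) \<le> ennreal (e * h ^ DIM('a))"
proof -
  obtain D :: "complex set" where D: "countable D" and dense: "\<And>X. open X \<Longrightarrow> X \<noteq> {} \<Longrightarrow> \<exists>d\<in>D. d \<in> X"
    using countable_dense_exists by blast
  have fin: "finite (signs :: ('a \<Rightarrow> real) set)" by (intro finite_PiE) auto
  let ?B = "\<lambda>c x h. cbox (sign_flip c x) (sign_flip c x + h *\<^sub>R One) :: 'a set"
  have "AE x in lborel. \<forall>q\<in>D. \<forall>c\<in>signs. \<forall>e>0. \<exists>d>0. \<forall>h. 0 < h \<and> h < d \<longrightarrow>
    (\<integral>\<^sup>+y. ennreal (norm (g y - q)) * indicator (?B c x h) (sign_flip c y) \<partial>lborel)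
      \<le> ennreal ((norm (g x - q) + e) * h ^ DIM('a))"
    using fin D orthant_average_converges[OF g loc]
    by (subst AE_ball_countable) (auto simp: AE_ball_countable countable_finite)
  then show ?thesis
  proof eventually_elim
    case (elim x)
    let ?M = "real (card (signs :: ('a \<Rightarrow> real) set))"
    let ?V = "unit_ball_vol (real DIM('a))"
    show ?case
    proof (intro allI impI)
      fix e :: real assume e: "0 < e"
      \<comment> \<open>After division by the power of \<open>h\<close>, each orthant contributes at most \<open>2 * \<delta>\<close>, and the change from \<open>q\<close> to \<open>g x\<close> at most the volume of the unit ball times \<open>\<delta>\<close>.\<close>
      define \<delta> where "\<delta> = e / (2 * ?M + ?V + 1)"
      have den: "0 < 2 * ?M + ?V + 1" by (intro add_nonneg_pos add_nonneg_nonneg) auto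
      have \<delta>: "0 < \<delta>" using e den by (simp add: \<delta>_def)
      have "\<delta> * (2 * ?M + ?V + 1) = e" using den by (simp add: \<delta>_def)
      then have \<delta>e: "?M * (2 * \<delta>) + \<delta> * ?V \<le> e" using \<delta> by (simp add: algebra_simps)
      obtain q where q: "q \<in> D" "norm (g x - q) < \<delta>"
        using dense[of "ball (g x) \<delta>"] \<delta> by (auto simp: dist_norm)
      have ex: "\<forall>c\<in>signs. \<exists>d>0. \<forall>h. 0 < h \<and> h < d \<longrightarrow>
        (\<integral>\<^sup>+y. ennreal (norm (g y - q)) * indicator (?B c x h) (sign_flip c y) \<partial>lborel)
          \<le> ennreal ((norm (g x - q) + \<delta>) * h ^ DIM('a))"
      proof
        fix c :: "'a \<Rightarrow> real" assume c: "c \<in> signs"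
        show "\<exists>d>0. \<forall>h. 0 < h \<and> h < d \<longrightarrow>
          (\<integral>\<^sup>+y. ennreal (norm (g y - q)) * indicator (?B c x h) (sign_flip c y) \<partial>lborel)
            \<le> ennreal ((norm (g x - q) + \<delta>) * h ^ DIM('a))"
          by (rule bspec[OF bspec[OF elim q(1)] c, THEN spec[of _ \<delta>], THEN mp, OF \<delta>])
      qed
      from bchoice[OF ex] obtain d where dd: "\<forall>c\<in>signs. 0 < d c \<and> (\<forall>h. 0 < h \<and> h < d c \<longrightarrow>
        (\<integral>\<^sup>+y. ennreal (norm (g y - q)) * indicator (?B c x h) (sign_flip c y) \<partial>lborel)
          \<le> ennreal ((norm (g x - q) + \<delta>) * h ^ DIM('a)))" ..
      have d: "0 < d c" if "c \<in> signs" for c using dd that by blast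
      have dh: "(\<integral>\<^sup>+y. ennreal (norm (g y - q)) * indicator (?B c x h) (sign_flip c y) \<partial>lborel)
          \<le> ennreal ((norm (g x - q) + \<delta>) * h ^ DIM('a))" if "c \<in> signs" "0 < h" "h < d c" for c h
        by (rule bspec[OF dd that(1), THEN conjunct2, THEN spec[of _ h], THEN mp]) (use that in simp)
      define d0 where "d0 = Min (insert 1 (d ` signs))"
      have d0: "0 < d0" using fin d by (simp add: d0_def)
      have d0_le: "d0 \<le> d c" if "c \<in> signs" for c using fin that by (simp add: d0_def)
      show "\<exists>d>0. \<forall>h. 0 < h \<and> h < d \<longrightarrow>
        (\<integral>\<^sup>+y. ennreal (norm (g y - g x)) * indicator (cball x h) y \<partial>lborel) \<le> ennreal (e * h ^ DIM('a))"
      proof (intro exI conjI allI impI)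
        fix h assume h: "0 < h \<and> h < d0"
        have "(\<integral>\<^sup>+y. ennreal (norm (g y - g x)) * indicator (cball x h) y \<partial>lborel) \<le>
          (\<integral>\<^sup>+y. (\<Sum>c\<in>signs. ennreal (norm (g y - q)) * indicator (?B c x h) (sign_flip c y)) +
            ennreal \<delta> * indicator (cball x h) y \<partial>lborel)"
        proof (rule nn_integral_mono)
          fix y :: 'a
          show "ennreal (norm (g y - g x)) * indicator (cball x h) y \<le>
            (\<Sum>c\<in>signs. ennreal (norm (g y - q)) * indicator (?B c x h) (sign_flip c y)) +
            ennreal \<delta> * indicator (cball x h) y"
          proof (cases "y \<in> cball x h")
            case True
            then obtain c where c: "c \<in> signs" "sign_flip c y \<in> ?B c x h"
              using cball_covered_by_orthants by blast
            have "norm (g y - g x) \<le> norm (g y - q) + \<delta>"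
              using norm_triangle_ineq[of "g y - q" "q - g x"] q(2) by (simp add: norm_minus_commute)
            then have "ennreal (norm (g y - g x)) \<le> ennreal (norm (g y - q)) + ennreal \<delta>"
              using \<delta> by (simp add: ennreal_leI flip: ennreal_plus)
            also have "ennreal (norm (g y - q)) = ennreal (norm (g y - q)) * indicator (?B c x h) (sign_flip c y)"
              using c by simp
            also have "\<dots> \<le> (\<Sum>c\<in>signs. ennreal (norm (g y - q)) * indicator (?B c x h) (sign_flip c y))"
              by (rule member_le_sum[OF c(1) _ fin]) simp
            finally show ?thesis using True by (simp add: add_mono)
          qed simp
        qed
        also have "\<dots> = (\<Sum>c\<in>signs. \<integral>\<^sup>+y. ennreal (norm (g y - q)) * indicator (?B c x h) (sign_flip c y) \<partial>lborel) +
            ennreal \<delta> * emeasure lborel (cball x h)"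
        proof (subst nn_integral_add)
          show "(\<lambda>y. \<Sum>c\<in>signs. ennreal (norm (g y - q)) * indicator (?B c x h) (sign_flip c y)) \<in> borel_measurable lborel"
            by measurable
          show "(\<integral>\<^sup>+y. (\<Sum>c\<in>signs. ennreal (norm (g y - q)) * indicator (?B c x h) (sign_flip c y)) \<partial>lborel) +
              (\<integral>\<^sup>+y. ennreal \<delta> * indicator (cball x h) y \<partial>lborel) =
            (\<Sum>c\<in>signs. \<integral>\<^sup>+y. ennreal (norm (g y - q)) * indicator (?B c x h) (sign_flip c y) \<partial>lborel) +
            ennreal \<delta> * emeasure lborel (cball x h)"
            by (subst nn_integral_sum) (auto simp: nn_integral_cmult_indicator)
        qed measurable
        also have "\<dots> \<le> (\<Sum>c\<in>(signs :: ('a \<Rightarrow> real) set). ennreal (2 * \<delta> * h ^ DIM('a))) + ennreal \<delta> * ennreal (?V * h ^ DIM('a))"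
        proof (rule add_mono[OF sum_mono])
          fix c :: "'a \<Rightarrow> real" assume c: "c \<in> signs"
          have "(\<integral>\<^sup>+y. ennreal (norm (g y - q)) * indicator (?B c x h) (sign_flip c y) \<partial>lborel)
            \<le> ennreal ((norm (g x - q) + \<delta>) * h ^ DIM('a))"
            using h d0_le[OF c] by (intro dh[OF c]) auto
          also have "\<dots> \<le> ennreal (2 * \<delta> * h ^ DIM('a))"
            using q(2) h by (intro ennreal_leI mult_right_mono) auto
          finally show "(\<integral>\<^sup>+y. ennreal (norm (g y - q)) * indicator (?B c x h) (sign_flip c y) \<partial>lborel) \<le> \<dots>" .
        next
          show "ennreal \<delta> * emeasure lborel (cball x h) \<le> ennreal \<delta> * ennreal (?V * h ^ DIM('a))"
            using h by (subst emeasure_cball) auto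
        qed
        also have "\<dots> = ennreal ((?M * (2 * \<delta>) + \<delta> * ?V) * h ^ DIM('a))"
          using \<delta> h by (simp add: ennreal_of_nat_eq_real_of_nat algebra_simps flip: ennreal_mult ennreal_plus)
        also have "\<dots> \<le> ennreal (e * h ^ DIM('a))"
          using \<delta>e h by (intro ennreal_leI mult_right_mono) auto
        finally show "(\<integral>\<^sup>+y. ennreal (norm (g y - g x)) * indicator (cball x h) y \<partial>lborel) \<le> ennreal (e * h ^ DIM('a))" .
      qed (rule d0)
    qed
  qed
qed

section \<open>Convergence in mean\<close>

text \<open>The inequality of the power mean. It is obtained by integrating the tangent inequality of
  \<open>s powr p\<close> at the mean value \<open>t\<close>, which is a case of Young's inequality.\<close>

lemma average_power_le:
  fixes u :: "'a \<Rightarrow> real"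
  assumes p: "1 \<le> p" and V: "0 < V" "emeasure M B = ennreal V" and B[measurable]: "B \<in> sets M"
    and u[measurable]: "u \<in> borel_measurable M" and nonneg: "\<And>y. 0 \<le> u y"
    and I: "integrable M (\<lambda>y. indicator B y * u y powr p)"
  shows "integrable M (\<lambda>y. indicator B y * u y)"
    and "(\<integral>y. indicator B y * u y \<partial>M) powr p \<le> V powr (p - 1) * (\<integral>y. indicator B y * u y powr p \<partial>M)"
proof -
  have IB: "integrable M (\<lambda>y. indicator B y :: real)"
    using V by (simp add: integrable_real_indicator)
  have mB: "measure M B = V"
    using V by (simp add: measure_def)
  show Iu: "integrable M (\<lambda>y. indicator B y * u y)"
  proof (rule Bochner_Integration.integrable_bound)
    show "integrable M (\<lambda>y. indicator B y + indicator B y * u y powr p)" using IB I by simp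
    show "AE y in M. norm (indicator B y * u y) \<le> norm (indicator B y + indicator B y * u y powr p)"
    proof (rule AE_I2)
      fix y
      have "u y \<le> 1 + u y powr p"
      proof (cases "u y \<le> 1")
        case False
        then have "u y powr 1 \<le> u y powr p" using p by (intro powr_mono) auto
        then show ?thesis using False by simp
      qed (simp add: add_increasing2)
      then show "norm (indicator B y * u y) \<le> norm (indicator B y + indicator B y * u y powr p)"
        using nonneg[of y] by (auto simp: indicator_def)
    qed
  qed measurable
  define t where "t = (\<integral>y. indicator B y * u y \<partial>M) / V"
  have int_t: "(\<integral>y. indicator B y * u y \<partial>M) = V * t" using V by (simp add: t_def)
  have t0: "0 \<le> t" unfolding t_def using nonneg V by (intro divide_nonneg_pos integral_nonneg_AE) auto
  \<comment> \<open>The line through \<open>(t, t powr p)\<close> with slope \<open>p * t powr (p - 1)\<close> lies below the graph.\<close>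
  have tangent: "p * s * t powr (p - 1) \<le> s powr p + (p - 1) * t powr p" if s: "0 \<le> s" for s
  proof (cases "p = 1")
    case True
    then show ?thesis using s t0 by (cases "t = 0") auto
  next
    case False
    then have p1: "1 < p" using p by simp
    have "s * t powr (p - 1) \<le> s powr p / p + (t powr (p - 1)) powr (p / (p - 1)) / (p / (p - 1))"
      using p1 s by (intro Youngs_inequality) (auto simp: field_simps)
    also have "(t powr (p - 1)) powr (p / (p - 1)) = t powr p" using p1 by (simp add: powr_powr)
    finally have "p * (s * t powr (p - 1)) \<le> p * (s powr p / p + t powr p / (p / (p - 1)))"
      using p1 by (intro mult_left_mono) auto
    also have "\<dots> = s powr p + (p - 1) * t powr p" using p1 by (simp add: field_simps)
    finally show ?thesis by (simp add: mult.assoc)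
  qed
  have "(\<integral>y. p * t powr (p - 1) * (indicator B y * u y) \<partial>M) \<le>
      (\<integral>y. indicator B y * u y powr p + (p - 1) * t powr p * indicator B y \<partial>M)"
  proof (rule integral_mono)
    show "p * t powr (p - 1) * (indicator B y * u y) \<le> indicator B y * u y powr p + (p - 1) * t powr p * indicator B y" for y
      using tangent[OF nonneg[of y]] by (auto simp: indicator_def mult_ac)
  qed (use Iu I IB in auto)
  also have "\<dots> = (\<integral>y. indicator B y * u y powr p \<partial>M) + (p - 1) * t powr p * V"
    using I IB by (simp add: mB)
  also have "(\<integral>y. p * t powr (p - 1) * (indicator B y * u y) \<partial>M) = p * t powr (p - 1) * (V * t)"
    by (simp add: int_t)
  finally have "p * (t powr (p - 1) * t) * V \<le> (\<integral>y. indicator B y * u y powr p \<partial>M) + (p - 1) * t powr p * V"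
    by (simp add: mult_ac)
  also have "t powr (p - 1) * t = t powr p"
  proof (cases "t = 0")
    case False
    then have "0 < t" using t0 by simp
    have "t powr (p - 1) * t powr 1 = t powr p" by (simp only: powr_add[symmetric]) simp
    then show ?thesis using \<open>0 < t\<close> by simp
  qed simp
  finally have "t powr p * V \<le> (\<integral>y. indicator B y * u y powr p \<partial>M)" by (simp add: algebra_simps)
  then have "V powr (p - 1) * (t powr p * V) \<le> V powr (p - 1) * (\<integral>y. indicator B y * u y powr p \<partial>M)"
    by (rule mult_left_mono) simp
  also have "V powr (p - 1) * (t powr p * V) = (V * t) powr p"
  proof -
    have "V powr (p - 1) * V powr 1 = V powr p" by (simp only: powr_add[symmetric]) simp
    then have "V powr (p - 1) * V = V powr p" using V by simp
    then show ?thesis using V t0 by (simp add: powr_mult)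
  qed
  finally show "(\<integral>y. indicator B y * u y \<partial>M) powr p \<le> V powr (p - 1) * (\<integral>y. indicator B y * u y powr p \<partial>M)"
    by (simp only: int_t)
qed

lemma norm_diff_powr_le:
  fixes u v :: "'a :: real_normed_vector"
  assumes p: "1 \<le> p"
  shows "norm (u - v) powr p \<le> 2 powr p * (norm u powr p + norm v powr p)"
proof -
  let ?m = "max (norm u) (norm v)"
  have "norm (u - v) \<le> 2 * ?m" using norm_triangle_ineq4[of u v] by simp
  then have "norm (u - v) powr p \<le> (2 * ?m) powr p" using p by (intro powr_mono2) auto
  also have "\<dots> = 2 powr p * ?m powr p" by (simp add: powr_mult le_max_iff_disj)
  also have "?m powr p \<le> norm u powr p + norm v powr p" by (simp add: max_def)
  finally show ?thesis by simp
qed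

text \<open>This is the theorem of Riesz: apply Fatou's lemma to the nonnegative functions \<open>2\<^sup>p
  (|u\<^sub>j|\<^sup>p + |v|\<^sup>p) - |u\<^sub>j - v|\<^sup>p\<close>, whose limit is \<open>2 * 2\<^sup>p |v|\<^sup>p\<close>. Since the norms of \<open>u\<^sub>j\<close> do
  not exceed that of \<open>v\<close>, this leaves no mass for the subtracted terms.\<close>

theorem Lp_convergence_from_norm_bound:
  fixes u :: "nat \<Rightarrow> 'a \<Rightarrow> 'b :: {banach, second_countable_topology}"
  assumes p: "1 \<le> p" and [measurable]: "\<And>j. u j \<in> borel_measurable M" "v \<in> borel_measurable M"
    and lim: "AE x in M. (\<lambda>j. u j x) \<longlonglongrightarrow> v x"
    and vp: "integrable M (\<lambda>x. norm (v x) powr p)"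
    and up: "\<And>j. integrable M (\<lambda>x. norm (u j x) powr p)"
    and bound: "\<And>j. (\<integral>x. norm (u j x) powr p \<partial>M) \<le> (\<integral>x. norm (v x) powr p \<partial>M)"
  shows "(\<lambda>j. \<integral>x. norm (u j x - v x) powr p \<partial>M) \<longlonglongrightarrow> 0"
proof -
  have I: "integrable M (\<lambda>x. norm (u j x - v x) powr p)" for j
  proof (rule Bochner_Integration.integrable_bound)
    show "integrable M (\<lambda>x. 2 powr p * (norm (u j x) powr p + norm (v x) powr p))" using vp up by simp
    show "AE x in M. norm (norm (u j x - v x) powr p) \<le> norm (2 powr p * (norm (u j x) powr p + norm (v x) powr p))"
      by (rule AE_I2) (simp add: norm_diff_powr_le[OF p])
  qed measurable
  let ?\<phi> = "\<lambda>j x. 2 powr p * (norm (u j x) powr p + norm (v x) powr p) - norm (u j x - v x) powr p"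
  define X where "X = 2 * 2 powr p * (\<integral>x. norm (v x) powr p \<partial>M)"
  let ?e = "\<lambda>j. \<integral>x. norm (u j x - v x) powr p \<partial>M"
  have \<phi>0: "0 \<le> ?\<phi> j x" for j x by (simp add: norm_diff_powr_le[OF p])
  have \<phi>I: "integrable M (?\<phi> j)" for j using I up vp by simp
  have \<phi>le: "(\<integral>x. ?\<phi> j x \<partial>M) \<le> X - ?e j" for j
  proof -
    have "(\<integral>x. ?\<phi> j x \<partial>M) = 2 powr p * ((\<integral>x. norm (u j x) powr p \<partial>M) + (\<integral>x. norm (v x) powr p \<partial>M)) - ?e j"
      using I up vp by simp
    also have "\<dots> \<le> 2 powr p * ((\<integral>x. norm (v x) powr p \<partial>M) + (\<integral>x. norm (v x) powr p \<partial>M)) - ?e j"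
      using bound[of j] by (intro diff_right_mono mult_left_mono add_right_mono) auto
    also have "\<dots> = X - ?e j" by (simp add: X_def)
    finally show ?thesis .
  qed
  have "ennreal X = (\<integral>\<^sup>+x. ennreal (2 * 2 powr p * norm (v x) powr p) \<partial>M)"
    unfolding X_def using vp by (subst nn_integral_eq_integral) auto
  also have "\<dots> \<le> (\<integral>\<^sup>+x. liminf (\<lambda>j. ennreal (?\<phi> j x)) \<partial>M)"
  proof (rule nn_integral_mono_AE)
    show "AE x in M. ennreal (2 * 2 powr p * norm (v x) powr p) \<le> liminf (\<lambda>j. ennreal (?\<phi> j x))"
      using lim
    proof eventually_elim
      case (elim x)
      have pw: "(\<lambda>j. norm (z j) powr p) \<longlonglongrightarrow> norm w powr p" if "z \<longlonglongrightarrow> w" for z :: "nat \<Rightarrow> 'b" and w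
        using p by (intro tendsto_powr' tendsto_norm that tendsto_const) auto
      have "(\<lambda>j. u j x - v x) \<longlonglongrightarrow> v x - v x" by (intro tendsto_diff elim tendsto_const)
      then have "(\<lambda>j. norm (u j x - v x) powr p) \<longlonglongrightarrow> 0" using pw[of "\<lambda>j. u j x - v x" 0] p by simp
      then have "(\<lambda>j. ?\<phi> j x) \<longlonglongrightarrow> 2 powr p * (norm (v x) powr p + norm (v x) powr p) - 0"
        by (intro tendsto_diff tendsto_mult tendsto_add tendsto_const pw[OF elim])
      then have "(\<lambda>j. ennreal (?\<phi> j x)) \<longlonglongrightarrow> ennreal (2 powr p * (norm (v x) powr p + norm (v x) powr p) - 0)"
        by (rule tendsto_ennrealI)
      then have "liminf (\<lambda>j. ennreal (?\<phi> j x)) = ennreal (2 powr p * (norm (v x) powr p + norm (v x) powr p) - 0)"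
        by (rule lim_imp_Liminf[OF sequentially_bot])
      then show ?case by simp
    qed
  qed
  also have "\<dots> \<le> liminf (\<lambda>j. \<integral>\<^sup>+x. ennreal (?\<phi> j x) \<partial>M)"
    by (rule nn_integral_liminf) measurable
  also have "(\<lambda>j. \<integral>\<^sup>+x. ennreal (?\<phi> j x) \<partial>M) = (\<lambda>j. ennreal (\<integral>x. ?\<phi> j x \<partial>M))"
    by (intro ext nn_integral_eq_integral \<phi>I AE_I2 \<phi>0)
  finally have X: "ennreal X \<le> liminf (\<lambda>j. ennreal (\<integral>x. ?\<phi> j x \<partial>M))" .
  show "?e \<longlonglongrightarrow> 0"
  proof (rule LIMSEQ_I)
    fix r :: real assume r: "0 < r"
    have e0: "0 \<le> ?e j" for j by simp
    show "\<exists>no. \<forall>n\<ge>no. norm (?e n - 0) < r"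
    proof (cases "X < r")
      case True
      have "?e n \<le> X" for n
      proof -
        have "0 \<le> (\<integral>x. ?\<phi> n x \<partial>M)" by (rule integral_nonneg_AE) (rule AE_I2, rule \<phi>0)
        then show ?thesis using \<phi>le[of n] by linarith
      qed
      then show ?thesis using True e0 by (intro exI[of _ 0]) (auto intro: le_less_trans)
    next
      case False
      then have "ennreal (X - r) < ennreal X" using r by (intro ennreal_lessI) auto
      then have "\<forall>\<^sub>F j in sequentially. ennreal (X - r) < ennreal (\<integral>x. ?\<phi> j x \<partial>M)"
        using X unfolding le_Liminf_iff by blast
      then obtain no where no: "\<And>j. no \<le> j \<Longrightarrow> ennreal (X - r) < ennreal (\<integral>x. ?\<phi> j x \<partial>M)"
        unfolding eventually_sequentially by blast
      have Xr: "0 \<le> X - r" using False by simp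
      have "?e j < r" if "no \<le> j" for j
      proof -
        have "X - r < (\<integral>x. ?\<phi> j x \<partial>M)" using no[OF that] by (simp only: ennreal_less_iff[OF Xr])
        then show ?thesis using \<phi>le[of j] by linarith
      qed
      then show ?thesis using e0 by (intro exI[of _ no]) auto
    qed
  qed
qed

section \<open>Limits of ball means and the reconstruction theorem\<close>

text \<open>The division is by \<open>a\<^sup>n\<close>, not by the volume of the ball; this is the reason for the factor
  \<open>L\<close> in the theorem.\<close>

definition ball_mean :: "real \<Rightarrow> (real ^ 'n \<Rightarrow> complex) \<Rightarrow> real ^ 'n \<Rightarrow> complex" where
  "ball_mean a g x = of_real (1 / a ^ CARD('n)) * (\<integral>y. indicator (cball x a) y *\<^sub>R g y \<partial>lborel)"

lemma emeasure_cball_vec: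
  "0 < a \<Longrightarrow> emeasure lborel (cball (x :: real ^ 'n) a) = ennreal (unit_ball_vol (real CARD('n)) * a ^ CARD('n))"
  using emeasure_cball[of a x] by simp

lemma measurable_cball_indicator [measurable]:
  "(\<lambda>p. indicator (cball (fst p) a) (snd p) :: 'b :: {zero_neq_one, topological_space}) \<in>
    borel_measurable (borel \<Otimes>\<^sub>M (borel :: (real ^ 'n) measure))"
proof -
  have ind: "indicator (cball (fst p) a) (snd p) = (if dist (fst p) (snd p) \<le> a then 1 else 0 :: 'b)"
    for p :: "(real ^ 'n) \<times> (real ^ 'n)"
    by (simp add: indicator_def)
  show ?thesis unfolding ind by measurable
qed

lemma measurable_ball_mean [measurable]:
  fixes g :: "real ^ 'n \<Rightarrow> complex"
  assumes [measurable]: "g \<in> borel_measurable borel"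
  shows "ball_mean a g \<in> borel_measurable borel"
proof -
  have "(\<lambda>p. indicator (cball (fst p) a) (snd p) *\<^sub>R g (snd p)) \<in> borel_measurable (borel \<Otimes>\<^sub>M (lborel :: (real ^ 'n) measure))"
    by (subst measurable_cong_sets[OF sets_pair_measure_cong[OF refl sets_lborel] refl]) measurable
  then have "(\<lambda>x. \<integral>y. indicator (cball x a) y *\<^sub>R g y \<partial>lborel) \<in> borel_measurable borel"
    by (intro lborel.borel_measurable_lebesgue_integral) (simp add: split_def)
  then show ?thesis unfolding ball_mean_def by measurable
qed

context
  fixes g :: "real ^ 'n \<Rightarrow> complex" and p :: real
  assumes g [measurable]: "g \<in> borel_measurable borel" and p: "1 \<le> p"
    and gp: "integrable lborel (\<lambda>y. norm (g y) powr p)"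
begin

lemma ball_power_integrable: "integrable lborel (\<lambda>y. indicator (cball x a) y * norm (g y) powr p)"
  by (rule Bochner_Integration.integrable_bound[OF gp]) (auto simp: indicator_def)

lemma ball_norm_integrable:
  assumes a: "0 < a"
  shows "integrable lborel (\<lambda>y. indicator (cball x a) y * norm (g y))"
proof (rule average_power_le(1)[OF p _ emeasure_cball_vec[OF a]])
  show "integrable lborel (\<lambda>y. indicator (cball x a) y * norm (g y) powr p)"
    by (rule ball_power_integrable)
qed (use a in auto)

lemma ball_integrable:
  assumes a: "0 < a"
  shows "integrable lborel (\<lambda>y. indicator (cball x a) y *\<^sub>R g y)"
  by (rule Bochner_Integration.integrable_bound[OF ball_norm_integrable[OF a, of x]]) auto

lemma ball_nn_integral_finite: "(\<integral>\<^sup>+y. ennreal (norm (g y)) * indicator (cball 0 r) y \<partial>lborel) < \<infinity>"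
proof (cases "0 < r")
  case True
  have "(\<integral>\<^sup>+y. ennreal (norm (g y)) * indicator (cball 0 r) y \<partial>lborel) =
      (\<integral>\<^sup>+y. ennreal (norm (indicator (cball 0 r) y *\<^sub>R g y)) \<partial>lborel)"
    by (intro nn_integral_cong) (auto simp: indicator_def)
  also have "\<dots> < \<infinity>" using ball_integrable[OF True] by (simp only: integrable_iff_bounded)
  finally show ?thesis .
next
  case False
  have "cball (0 :: real ^ 'n) r \<subseteq> {0}"
  proof
    fix x :: "real ^ 'n" assume "x \<in> cball 0 r"
    then have "norm x \<le> r" by simp
    then have "norm x \<le> 0" using False by linarith
    then show "x \<in> {0}" by simp
  qed
  then have "(\<integral>\<^sup>+y. ennreal (norm (g y)) * indicator (cball 0 r) y \<partial>lborel) = (\<integral>\<^sup>+y. 0 \<partial>(lborel :: (real ^ 'n) measure))"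
    by (intro nn_integral_cong_AE) (use AE_lborel_singleton[of "0 :: real ^ 'n"] in \<open>eventually_elim; auto simp: indicator_def\<close>)
  then show ?thesis by simp
qed

text \<open>Pointwise by the power mean inequality, and then by Tonelli.\<close>

lemma ball_mean_Lp_bound:
  assumes a: "0 < a"
  shows "integrable lborel (\<lambda>x. norm (ball_mean a g x) powr p)"
    and "(\<integral>x. norm (ball_mean a g x) powr p \<partial>lborel) \<le>
      (\<integral>x. norm (of_real (unit_ball_vol (real CARD('n))) * g x) powr p \<partial>lborel)"
proof -
  let ?n = "CARD('n)"
  define V where "V = unit_ball_vol (real ?n) * a ^ ?n"
  have V: "0 < V" using a by (simp add: V_def)
  define C where "C = (1 / a ^ ?n) powr p * V powr (p - 1)"
  have C: "0 \<le> C" by (simp add: C_def)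
  have pt: "norm (ball_mean a g x) powr p \<le> C * (\<integral>y. indicator (cball x a) y * norm (g y) powr p \<partial>lborel)" for x
  proof -
    have "norm (ball_mean a g x) \<le> 1 / a ^ ?n * (\<integral>y. norm (indicator (cball x a) y *\<^sub>R g y) \<partial>lborel)"
      unfolding ball_mean_def norm_mult using a by (intro mult_mono integral_norm_bound) (auto simp: norm_divide norm_power)
    also have "(\<integral>y. norm (indicator (cball x a) y *\<^sub>R g y) \<partial>lborel) = (\<integral>y. indicator (cball x a) y * norm (g y) \<partial>lborel)"
      by (intro Bochner_Integration.integral_cong) auto
    finally have "norm (ball_mean a g x) powr p \<le> (1 / a ^ ?n * (\<integral>y. indicator (cball x a) y * norm (g y) \<partial>lborel)) powr p"
      using p by (intro powr_mono2) auto
    also have "\<dots> = (1 / a ^ ?n) powr p * (\<integral>y. indicator (cball x a) y * norm (g y) \<partial>lborel) powr p"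
      using a by (intro powr_mult)
    also have "\<dots> \<le> (1 / a ^ ?n) powr p * (V powr (p - 1) * (\<integral>y. indicator (cball x a) y * norm (g y) powr p \<partial>lborel))"
      by (intro mult_left_mono average_power_le(2)[OF p V])
        (use a ball_power_integrable in \<open>auto simp: emeasure_cball_vec V_def\<close>)
    finally show ?thesis by (simp add: C_def mult.assoc)
  qed
  have CV: "C * V = unit_ball_vol (real ?n) powr p"
  proof -
    have "V powr (p - 1) * V powr 1 = V powr p" by (simp only: powr_add[symmetric]) simp
    then have "C * V = (1 / a ^ ?n) powr p * V powr p" using V by (simp add: C_def)
    also have "\<dots> = (1 / a ^ ?n * V) powr p" using V a by (intro powr_mult[symmetric])
    also have "1 / a ^ ?n * V = unit_ball_vol (real ?n)" using a by (simp add: V_def)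
    finally show ?thesis .
  qed
  have "(\<integral>\<^sup>+x. ennreal (norm (ball_mean a g x) powr p) \<partial>lborel) \<le>
      (\<integral>\<^sup>+x. (\<integral>\<^sup>+y. ennreal C * (indicator (cball x a) y * ennreal (norm (g y) powr p)) \<partial>lborel) \<partial>lborel)"
  proof (rule nn_integral_mono)
    fix x :: "real ^ 'n"
    have "ennreal (norm (ball_mean a g x) powr p) \<le> ennreal (C * (\<integral>y. indicator (cball x a) y * norm (g y) powr p \<partial>lborel))"
      by (rule ennreal_leI[OF pt])
    also have "\<dots> = ennreal C * ennreal (\<integral>y. indicator (cball x a) y * norm (g y) powr p \<partial>lborel)"
      by (rule ennreal_mult'[OF C])
    also have "\<dots> = ennreal C * (\<integral>\<^sup>+y. ennreal (indicator (cball x a) y * norm (g y) powr p) \<partial>lborel)"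
      by (subst nn_integral_eq_integral[OF ball_power_integrable]) auto
    also have "\<dots> = (\<integral>\<^sup>+y. ennreal C * (indicator (cball x a) y * ennreal (norm (g y) powr p)) \<partial>lborel)"
      by (subst nn_integral_cmult[symmetric]) (auto intro!: nn_integral_cong simp: indicator_def)
    finally show "ennreal (norm (ball_mean a g x) powr p) \<le> \<dots>" .
  qed
  also have "\<dots> = (\<integral>\<^sup>+y. (\<integral>\<^sup>+x. ennreal C * (indicator (cball x a) y * ennreal (norm (g y) powr p)) \<partial>lborel) \<partial>lborel)"
  proof (rule lborel_pair.Fubini'[symmetric])
    have "(\<lambda>p'. ennreal C * (indicator (cball (fst p') a) (snd p') * ennreal (norm (g (snd p')) powr p)))
        \<in> borel_measurable (borel \<Otimes>\<^sub>M borel)"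
      by measurable
    then show "(\<lambda>(x, y). ennreal C * (indicator (cball x a) y * ennreal (norm (g y) powr p)))
        \<in> borel_measurable (lborel \<Otimes>\<^sub>M lborel)"
      by (simp add: split_def measurable_cong_sets[OF sets_pair_measure_cong[OF sets_lborel sets_lborel] refl])
  qed
  also have "\<dots> = (\<integral>\<^sup>+y. ennreal (norm (of_real (unit_ball_vol (real ?n)) * g y) powr p) \<partial>lborel)"
  proof (rule nn_integral_cong)
    fix y :: "real ^ 'n"
    have "(\<integral>\<^sup>+x. ennreal C * (indicator (cball x a) y * ennreal (norm (g y) powr p)) \<partial>lborel) =
        (\<integral>\<^sup>+x. ennreal C * ennreal (norm (g y) powr p) * indicator (cball y a) x \<partial>lborel)"
      by (intro nn_integral_cong) (auto simp: indicator_def dist_commute mult_ac)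
    also have "\<dots> = ennreal C * ennreal (norm (g y) powr p) * ennreal V"
      using a by (subst nn_integral_cmult_indicator) (simp_all add: emeasure_cball_vec V_def)
    also have "\<dots> = ennreal (C * V * norm (g y) powr p)"
      using C V by (simp add: mult_ac flip: ennreal_mult)
    also have "C * V * norm (g y) powr p = norm (of_real (unit_ball_vol (real ?n)) * g y) powr p"
      by (simp add: CV norm_mult powr_mult)
    finally show "(\<integral>\<^sup>+x. ennreal C * (indicator (cball x a) y * ennreal (norm (g y) powr p)) \<partial>lborel) =
        ennreal (norm (of_real (unit_ball_vol (real ?n)) * g y) powr p)" .
  qed
  also have "\<dots> = ennreal (\<integral>y. norm (of_real (unit_ball_vol (real ?n)) * g y) powr p \<partial>lborel)"
    using gp by (intro nn_integral_eq_integral) (simp_all add: norm_mult powr_mult)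
  finally have le: "(\<integral>\<^sup>+x. ennreal (norm (ball_mean a g x) powr p) \<partial>lborel) \<le>
      ennreal (\<integral>y. norm (of_real (unit_ball_vol (real ?n)) * g y) powr p \<partial>lborel)" .
  show I: "integrable lborel (\<lambda>x. norm (ball_mean a g x) powr p)"
    by (rule integrableI_bounded) (use le in \<open>auto simp: le_less_trans[OF _ ennreal_less_top]\<close>)
  show "(\<integral>x. norm (ball_mean a g x) powr p \<partial>lborel) \<le>
      (\<integral>x. norm (of_real (unit_ball_vol (real CARD('n))) * g x) powr p \<partial>lborel)"
    using le by (subst (asm) nn_integral_eq_integral[OF I]) auto
qed

lemma ball_mean_diff_le:
  assumes a: "0 < a" and K: "0 \<le> K"
    and le: "(\<integral>\<^sup>+y. ennreal (norm (g y - c)) * indicator (cball x a) y \<partial>lborel) \<le> ennreal (K * a ^ CARD('n))"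
  shows "norm (ball_mean a g x - of_real (unit_ball_vol (real CARD('n))) * c) \<le> K"
proof -
  let ?n = "CARD('n)"
  let ?V = "unit_ball_vol (real ?n)"
  have cI: "integrable lborel (\<lambda>y. indicator (cball x a) y *\<^sub>R c)"
    by (rule integrable_scaleR_left, rule integrable_real_indicator) (simp_all add: emeasure_cball_vec[OF a])
  have "measure lborel (cball x a) = ?V * a ^ ?n"
    using emeasure_cball_vec[OF a, of x] a by (simp add: measure_def)
  then have cE: "(\<integral>y. indicator (cball x a) y *\<^sub>R c \<partial>lborel) = of_real (?V * a ^ ?n) * c"
    using emeasure_cball_vec[OF a, of x] by (subst integral_scaleR_left) (auto simp: scaleR_conv_of_real)
  let ?d = "\<lambda>y. indicator (cball x a) y *\<^sub>R (g y - c)"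
  have dI: "integrable lborel ?d"
    using ball_integrable[OF a, of x] cI by (simp add: scaleR_diff_right)
  have "(\<integral>y. ?d y \<partial>lborel) = (\<integral>y. indicator (cball x a) y *\<^sub>R g y \<partial>lborel) - of_real (?V * a ^ ?n) * c"
    unfolding scaleR_diff_right using ball_integrable[OF a, of x] cI by (subst Bochner_Integration.integral_diff) (simp_all add: cE)
  then have eq: "ball_mean a g x - of_real ?V * c = of_real (1 / a ^ ?n) * (\<integral>y. ?d y \<partial>lborel)"
    using a by (simp add: ball_mean_def field_simps)
  have "norm (ball_mean a g x - of_real ?V * c) = 1 / a ^ ?n * norm (\<integral>y. ?d y \<partial>lborel)"
    unfolding eq norm_mult using a by (simp add: norm_divide norm_power)
  also have "\<dots> \<le> 1 / a ^ ?n * (\<integral>y. norm (?d y) \<partial>lborel)"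
    using a by (intro mult_left_mono integral_norm_bound) auto
  also have "\<dots> \<le> 1 / a ^ ?n * (K * a ^ ?n)"
  proof (intro mult_left_mono)
    have "ennreal (\<integral>y. norm (?d y) \<partial>lborel) = (\<integral>\<^sup>+y. ennreal (norm (?d y)) \<partial>lborel)"
      by (rule nn_integral_eq_integral[OF integrable_norm[OF dI], symmetric]) auto
    also have "\<dots> = (\<integral>\<^sup>+y. ennreal (norm (g y - c)) * indicator (cball x a) y \<partial>lborel)"
      by (intro nn_integral_cong) (auto simp: indicator_def)
    finally have "ennreal (\<integral>y. norm (?d y) \<partial>lborel) \<le> ennreal (K * a ^ ?n)" using le by simp
    then show "(\<integral>y. norm (?d y) \<partial>lborel) \<le> K * a ^ ?n" using K a by (subst (asm) ennreal_le_iff) auto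
  qed (use a in auto)
  also have "\<dots> = K" using a by simp
  finally show ?thesis .
qed

lemma ball_mean_AE_convergence:
  "AE x in lborel. ((\<lambda>a. ball_mean a g x) \<longlongrightarrow> of_real (unit_ball_vol (real CARD('n))) * g x) (at_right 0)"
  using AE_Lebesgue_point[OF g ball_nn_integral_finite]
proof eventually_elim
  case (elim x)
  show ?case
  proof (rule tendstoI)
    fix e :: real assume e: "0 < e"
    obtain d where d: "0 < d" and dh: "\<forall>h. 0 < h \<and> h < d \<longrightarrow>
        (\<integral>\<^sup>+y. ennreal (norm (g y - g x)) * indicator (cball x h) y \<partial>lborel) \<le> ennreal (e / 2 * h ^ DIM(real ^ 'n))"
      using elim e by (meson half_gt_zero)
    have "dist (ball_mean a g x) (of_real (unit_ball_vol (real CARD('n))) * g x) < e" if a: "0 < a" "a < d" for a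
    proof -
      have "(\<integral>\<^sup>+y. ennreal (norm (g y - g x)) * indicator (cball x a) y \<partial>lborel) \<le> ennreal (e / 2 * a ^ CARD('n))"
        using dh a by simp
      then have "norm (ball_mean a g x - of_real (unit_ball_vol (real CARD('n))) * g x) \<le> e / 2"
        using e by (intro ball_mean_diff_le[OF a(1)]) auto
      then show ?thesis using e by (simp add: dist_norm)
    qed
    then show "\<forall>\<^sub>F a in at_right 0. dist (ball_mean a g x) (of_real (unit_ball_vol (real CARD('n))) * g x) < e"
      using d by (auto simp: eventually_at_right_field)
  qed
qed

text \<open>The bound on the norms and the limit almost everywhere imply the limit in mean.\<close>

lemma ball_mean_Lp_convergence:
  "((\<lambda>a. \<integral>x. norm (ball_mean a g x - of_real (unit_ball_vol (real CARD('n))) * g x) powr p \<partial>lborel) \<longlongrightarrow> 0) (at_right 0)"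
proof -
  let ?v = "\<lambda>x. of_real (unit_ball_vol (real CARD('n))) * g x"
  have vp: "integrable lborel (\<lambda>x. norm (?v x) powr p)" using gp by (simp add: norm_mult powr_mult)
  show "((\<lambda>a. \<integral>x. norm (ball_mean a g x - ?v x) powr p \<partial>lborel) \<longlongrightarrow> 0) (at_right 0)"
  proof (rule tendsto_at_right_sequentially[of 0 1])
    fix S :: "nat \<Rightarrow> real" assume S: "\<And>n. 0 < S n" "S \<longlonglongrightarrow> 0"
    have S0: "filterlim S (at_right 0) sequentially"
    proof -
      have "S n \<noteq> 0" for n using S(1)[of n] by simp
      then show ?thesis using S by (simp add: filterlim_at)
    qed
    have "AE x in lborel. (\<lambda>n. ball_mean (S n) g x) \<longlonglongrightarrow> ?v x"
      using ball_mean_AE_convergence by eventually_elim (rule filterlim_compose[OF _ S0])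
    then show "(\<lambda>n. \<integral>x. norm (ball_mean (S n) g x - ?v x) powr p \<partial>lborel) \<longlonglongrightarrow> 0"
      by (rule Lp_convergence_from_norm_bound[OF p _ _ _ vp ball_mean_Lp_bound(1)[OF S(1)] ball_mean_Lp_bound(2)[OF S(1)], rotated -1]) auto
  qed simp
qed

text \<open>A continuous function with limit 0 at infinity is uniformly continuous: near the origin by
  compactness, and far away because its values are small.\<close>

lemma ball_mean_uniform_convergence:
  assumes C0: "in_C0 g"
  shows "uniform_limit UNIV (\<lambda>a. ball_mean a g) (\<lambda>x. of_real (unit_ball_vol (real CARD('n))) * g x) (at_right 0)"
proof (rule uniform_limitI)
  fix e :: real assume e: "0 < e"
  let ?V = "unit_ball_vol (real CARD('n))"
  have V: "0 < ?V" by simp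
  define \<epsilon> where "\<epsilon> = e / (2 * ?V)"
  have \<epsilon>: "0 < \<epsilon>" using e V by (simp add: \<epsilon>_def)
  have cont: "continuous_on UNIV g" and lim: "(g \<longlongrightarrow> 0) at_infinity" using C0 by (auto simp: in_C0_def)
  obtain b where b: "\<And>x. b \<le> norm x \<Longrightarrow> norm (g x) < \<epsilon> / 2"
    using tendstoD[OF lim, of "\<epsilon> / 2"] \<epsilon> by (auto simp: eventually_at_infinity)
  have "uniformly_continuous_on (cball 0 (b + 1)) g"
    by (rule compact_uniformly_continuous[OF continuous_on_subset[OF cont]]) auto
  then obtain d where d: "0 < d" and dg: "\<And>x y. x \<in> cball 0 (b + 1) \<Longrightarrow> y \<in> cball 0 (b + 1) \<Longrightarrow> dist y x < d \<Longrightarrow> dist (g y) (g x) < \<epsilon>"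
    using \<epsilon> unfolding uniformly_continuous_on_def by metis
  \<comment> \<open>If one of the points is outside the larger ball, both are outside the smaller one.\<close>
  have close: "norm (g y - g x) \<le> \<epsilon>" if "dist x y < d" "dist x y < 1" for x y
  proof (cases "norm x \<le> b + 1 \<and> norm y \<le> b + 1")
    case True
    moreover have "dist y x < d" using that(1) by (simp add: dist_commute)
    ultimately have "dist (g y) (g x) < \<epsilon>" by (intro dg) auto
    then show ?thesis by (simp add: dist_norm)
  next
    case False
    then have "b \<le> norm x" "b \<le> norm y"
      using that(2) norm_triangle_ineq2[of x y] norm_triangle_ineq2[of y x] by (auto simp: dist_norm norm_minus_commute)
    then show ?thesis using b[of x] b[of y] norm_triangle_ineq4[of "g y" "g x"] by linarith
  qed
  have "dist (ball_mean a g x) (of_real ?V * g x) < e" if a: "0 < a" "a < min d 1" for a x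
  proof -
    have "(\<integral>\<^sup>+y. ennreal (norm (g y - g x)) * indicator (cball x a) y \<partial>lborel) \<le>
        (\<integral>\<^sup>+y. ennreal \<epsilon> * indicator (cball x a) y \<partial>lborel)"
      using a by (intro nn_integral_mono) (auto simp: indicator_def intro!: ennreal_leI close)
    also have "\<dots> = ennreal (\<epsilon> * ?V * a ^ CARD('n))"
      using a \<epsilon> by (simp add: nn_integral_cmult_indicator emeasure_cball_vec mult.assoc flip: ennreal_mult)
    finally have "norm (ball_mean a g x - of_real ?V * g x) \<le> \<epsilon> * ?V"
      using \<epsilon> by (intro ball_mean_diff_le[OF a(1)]) auto
    also have "\<dots> < e" using e V by (simp add: \<epsilon>_def)
    finally show ?thesis by (simp add: dist_norm)
  qed
  then have "\<forall>\<^sub>F a in at_right 0. \<forall>x. dist (ball_mean a g x) (of_real ?V * g x) < e"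
    using d by (auto simp: eventually_at_right_field intro!: exI[of _ "min d 1"])
  then show "\<forall>\<^sub>F a in at_right 0. \<forall>x\<in>UNIV. dist (ball_mean a g x) (of_real ?V * g x) < e" by simp
qed

end

lemma unit_ball_weight:
  "(\<integral>x. psi (norm x) \<partial>(lebesgue :: (real ^ 'n) measure)) = unit_ball_vol (real CARD('n))"
proof -
  have "(\<integral>x. psi (norm x) \<partial>(lebesgue :: (real ^ 'n) measure)) = (\<integral>x. indicator (cball (0 :: real ^ 'n) 1) x \<partial>lebesgue)"
    by (intro Bochner_Integration.integral_cong refl) (simp add: psi_def indicator_def)
  also have "\<dots> = unit_ball_vol (real CARD('n))"
    using content_cball[of 1 "0 :: real ^ 'n"] by simp
  finally show ?thesis .
qed

theorem theoremA:
  fixes w :: "real \<Rightarrow> complex" and L :: real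
  assumes n: "CARD('n::finite) \<ge> 2"
    and w: "w = (\<lambda>r. of_real (abel_w CARD('n) r))"
    and L: "L = (\<integral>x. psi (norm x) \<partial>(lebesgue :: (real ^ 'n) measure))"
  shows
    "(abel_solution CARD('n) 1 psi w \<and>
      (\<forall>(p::real) (f :: real ^ 'n \<Rightarrow> complex).
         1 \<le> p \<and> p < real CARD('n) \<and> in_Lp p f \<longrightarrow>
           (\<forall>a>0. AE x in lebesgue.
              integrable (affine_grassmann_measure 1)
                (wavelet_integrand w a (kplane_transform f) x)) \<and>
           (\<forall>a>0. in_Lp p (wavelet_transform 1 w a (kplane_transform f))) \<and>
           ((\<lambda>a. Lp_norm p (\<lambda>x. wavelet_transform 1 w a (kplane_transform f) x - of_real L * f x))
              \<longlongrightarrow> 0) (at_right 0) \<and>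
           (AE x in lebesgue.
              ((\<lambda>a. wavelet_transform 1 w a (kplane_transform f) x) \<longlongrightarrow> of_real L * f x)
                (at_right 0))) \<and>
      (\<forall>(p::real) (f :: real ^ 'n \<Rightarrow> complex).
         1 \<le> p \<and> p < real CARD('n) \<and> in_Lp p f \<and> in_C0 f \<longrightarrow>
           (\<forall>a>0. \<forall>x.
              integrable (affine_grassmann_measure 1)
                (wavelet_integrand w a (kplane_transform f) x)) \<and>
           uniform_limit UNIV (\<lambda>a. wavelet_transform 1 w a (kplane_transform f))
             (\<lambda>x. of_real L * f x) (at_right 0)))
     \<and> (\<forall>k. 1 < k \<and> k < CARD('n) \<longrightarrow> \<not> (\<exists>v. abel_solution CARD('n) k psi v))"
proof (intro conjI)
  have LV: "L = unit_ball_vol (real CARD('n))" using L unit_ball_weight[where 'n = 'n] by simp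
  show "abel_solution CARD('n) 1 psi w" unfolding w by (rule abel_solution_abel_w[OF n])
  show "\<forall>k. 1 < k \<and> k < CARD('n) \<longrightarrow> \<not> (\<exists>v. abel_solution CARD('n) k psi v)"
    using no_abel_solution by blast
  show "\<forall>(p::real) (f :: real ^ 'n \<Rightarrow> complex).
     1 \<le> p \<and> p < real CARD('n) \<and> in_Lp p f \<longrightarrow>
       (\<forall>a>0. AE x in lebesgue.
          integrable (affine_grassmann_measure 1) (wavelet_integrand w a (kplane_transform f) x)) \<and>
       (\<forall>a>0. in_Lp p (wavelet_transform 1 w a (kplane_transform f))) \<and>
       ((\<lambda>a. Lp_norm p (\<lambda>x. wavelet_transform 1 w a (kplane_transform f) x - of_real L * f x))
          \<longlongrightarrow> 0) (at_right 0) \<and>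
       (AE x in lebesgue.
          ((\<lambda>a. wavelet_transform 1 w a (kplane_transform f) x) \<longlongrightarrow> of_real L * f x) (at_right 0))"
  proof (intro allI impI, elim conjE)
    fix p :: real and f :: "real ^ 'n \<Rightarrow> complex"
    assume p: "1 \<le> p" "p < real CARD('n)" and f: "in_Lp p f"
    obtain g N where g: "g \<in> borel_measurable borel" and N: "N \<in> null_sets lborel" and fg: "\<And>x. x \<notin> N \<Longrightarrow> f x = g x"
      using lebesgue_measurable_ex_borel f unfolding in_Lp_def by metis
    note [measurable] = g
    have AE_N: "AE x in lborel. x \<notin> N" by (rule AE_not_in[OF N])
    have fg_AE: "AE x in lborel. f x = g x" using AE_N by eventually_elim (rule fg)
    have "AE x in lborel. norm (f x) powr p = norm (g x) powr p" using fg_AE by eventually_elim simp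
    then have gp: "integrable lborel (\<lambda>y. norm (g y) powr p)"
      using f completion_AE_eq(2)[of "\<lambda>y. norm (g y) powr p" lborel] by (simp add: in_Lp_def)
    let ?W = "\<lambda>a. wavelet_transform 1 w a (kplane_transform f)"
    have W: "?W a = ball_mean a g" if "0 < a" for a
      unfolding w ball_mean_def by (rule ext, rule wavelet_transform_eq_ball_integral(2)[OF n p that g gp N]) (rule fg)
    have ev: "\<forall>\<^sub>F a in at_right 0. ball_mean a g = ?W a"
      using W by (auto simp: eventually_at_right_field intro!: exI[of _ 1])
    show "(\<forall>a>0. AE x in lebesgue.
          integrable (affine_grassmann_measure 1) (wavelet_integrand w a (kplane_transform f) x)) \<and>
       (\<forall>a>0. in_Lp p (?W a)) \<and>
       ((\<lambda>a. Lp_norm p (\<lambda>x. ?W a x - of_real L * f x)) \<longlongrightarrow> 0) (at_right 0) \<and>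
       (AE x in lebesgue. ((\<lambda>a. ?W a x) \<longlongrightarrow> of_real L * f x) (at_right 0))"
    proof (intro conjI allI impI)
      fix a :: real assume a: "0 < a"
      show "AE x in lebesgue. integrable (affine_grassmann_measure 1) (wavelet_integrand w a (kplane_transform f) x)"
        unfolding w by (rule AE_I2, rule wavelet_transform_eq_ball_integral(1)[OF n p a g gp N]) (rule fg)
      show "in_Lp p (?W a)"
        unfolding W[OF a] in_Lp_def
      proof
        show "ball_mean a g \<in> borel_measurable lebesgue" by (rule measurable_completion) measurable
        show "integrable lebesgue (\<lambda>x. norm (ball_mean a g x) powr p)"
          using ball_mean_Lp_bound(1)[OF g p(1) gp a] by (simp add: integrable_completion)
      qed
    next
      let ?I = "\<lambda>a. \<integral>x. norm (ball_mean a g x - of_real L * g x) powr p \<partial>lborel"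
      have I: "(?I \<longlongrightarrow> 0) (at_right 0)" unfolding LV by (rule ball_mean_Lp_convergence[OF g p(1) gp])
      have "((\<lambda>a. ?I a powr (1 / p)) \<longlongrightarrow> 0 powr (1 / p)) (at_right 0)"
        using p(1) by (intro tendsto_powr' I tendsto_const) auto
      moreover have "\<forall>\<^sub>F a in at_right 0. ?I a powr (1 / p) = Lp_norm p (\<lambda>x. ?W a x - of_real L * f x)"
        using ev
      proof eventually_elim
        case (elim a)
        have "AE x in lborel. norm (ball_mean a g x - of_real L * f x) powr p = norm (ball_mean a g x - of_real L * g x) powr p"
          using fg_AE by eventually_elim simp
        then have "(\<integral>x. norm (ball_mean a g x - of_real L * f x) powr p \<partial>lebesgue) = ?I a"
          by (intro completion_AE_eq(3)) measurable
        then show ?case unfolding Lp_norm_def elim[symmetric] by simp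
      qed
      ultimately show "((\<lambda>a. Lp_norm p (\<lambda>x. ?W a x - of_real L * f x)) \<longlongrightarrow> 0) (at_right 0)"
        by (simp add: tendsto_cong)
      have "AE x in lborel. ((\<lambda>a. ?W a x) \<longlongrightarrow> of_real L * f x) (at_right 0)"
        using ball_mean_AE_convergence[OF g p(1) gp] fg_AE
      proof eventually_elim
        case (elim x)
        have "\<forall>\<^sub>F a in at_right 0. ball_mean a g x = ?W a x" using ev by eventually_elim simp
        then show ?case using elim by (simp add: LV tendsto_cong)
      qed
      then show "AE x in lebesgue. ((\<lambda>a. ?W a x) \<longlongrightarrow> of_real L * f x) (at_right 0)"
        by (rule AE_completion)
    qed
  qed
  show "\<forall>(p::real) (f :: real ^ 'n \<Rightarrow> complex).
     1 \<le> p \<and> p < real CARD('n) \<and> in_Lp p f \<and> in_C0 f \<longrightarrow>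
       (\<forall>a>0. \<forall>x. integrable (affine_grassmann_measure 1) (wavelet_integrand w a (kplane_transform f) x)) \<and>
       uniform_limit UNIV (\<lambda>a. wavelet_transform 1 w a (kplane_transform f)) (\<lambda>x. of_real L * f x) (at_right 0)"
  proof (intro allI impI, elim conjE)
    fix p :: real and f :: "real ^ 'n \<Rightarrow> complex"
    assume p: "1 \<le> p" "p < real CARD('n)" and f: "in_Lp p f" and C0: "in_C0 f"
    have fm: "f \<in> borel_measurable borel"
      using C0 by (auto simp: in_C0_def intro: borel_measurable_continuous_onI)
    have fp: "integrable lborel (\<lambda>y. norm (f y) powr p)"
      using f fm by (simp add: in_Lp_def integrable_completion)
    have N: "{} \<in> null_sets (lborel :: (real ^ 'n) measure)" by simp
    let ?W = "\<lambda>a. wavelet_transform 1 w a (kplane_transform f)"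
    have W: "?W a = ball_mean a f" if "0 < a" for a
      unfolding w ball_mean_def by (rule ext, rule wavelet_transform_eq_ball_integral(2)[OF n p that fm fp N]) (rule refl)
    have ev: "\<forall>\<^sub>F a in at_right 0. ball_mean a f = ?W a"
      using W by (auto simp: eventually_at_right_field intro!: exI[of _ 1])
    show "(\<forall>a>0. \<forall>x. integrable (affine_grassmann_measure 1) (wavelet_integrand w a (kplane_transform f) x)) \<and>
       uniform_limit UNIV ?W (\<lambda>x. of_real L * f x) (at_right 0)"
    proof (intro conjI allI impI)
      show "integrable (affine_grassmann_measure 1) (wavelet_integrand w a (kplane_transform f) x)" if "0 < a" for a x
        unfolding w by (rule wavelet_transform_eq_ball_integral(1)[OF n p that fm fp N]) (rule refl)
      have "uniform_limit UNIV (\<lambda>a. ball_mean a f) (\<lambda>x. of_real L * f x) (at_right 0)"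
        unfolding LV by (rule ball_mean_uniform_convergence[OF fm p(1) fp C0])
      moreover have "\<forall>\<^sub>F a in at_right 0. \<forall>x\<in>UNIV. ball_mean a f x = ?W a x" using ev by eventually_elim simp
      ultimately show "uniform_limit UNIV ?W (\<lambda>x. of_real L * f x) (at_right 0)"
        by (subst (asm) uniform_limit_cong[where g = ?W]) auto
    qed
  qed
qed

end
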